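(* Let $(R,\mathfrak m)$ be a Noetherian local ring and $M$ a finite $R$-module with $\dim M=d$ and $\operatorname{depth} M=d-1$. Let $J$ be an ideal generated by a system of parameters for $M$. Then $e_1(J,M)<0$.
   Context: $\lambda$ denotes length as an $R$-module. A system of parameters for $M$ is a sequence of $d=\dim M$ elements of $\mathfrak m$ generating an ideal $J$ with $\lambda(M/JM)<\infty$. The function $n\mapsto\lambda(M/J^{n+1}M)$ agrees for $n\gg0$ with a polynomial $P_J(M,X)\in\mathbb Q[X]$ of degree $d$; write $P_J(M,X)=\sum_{i=0}^d(-1)^ie_i(J,M)\binom{X+d-i}{d-i}$ with integers $e_i(J,M)$. *)

theory Defs
  imports
    "HOL-Computational_Algebra.Polynomial"
    "HOL-Library.Extended_Nat"
    "HOL-Algebra.Algebra"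
begin

locale noetherian_local_ring =
  cring R + noetherian_ring R + maximalideal \<mm> R
  for R (structure) and \<mm> +
  assumes maximal_unique: "maximalideal I R \<Longrightarrow> I = \<mm>"


definition gen_submodule ::
  "('a, 'b) ring_scheme \<Rightarrow> ('a, 'm, 'c) module_scheme \<Rightarrow> 'm set \<Rightarrow> 'm set"
  where "gen_submodule R M S = \<Inter>{N. submodule N R M \<and> S \<subseteq> N}"

definition fin_gen_module ::
  "('a, 'b) ring_scheme \<Rightarrow> ('a, 'm, 'c) module_scheme \<Rightarrow> bool"
  where "fin_gen_module R M \<longleftrightarrow>
    (\<exists>S. finite S \<and> S \<subseteq> carrier M \<and> gen_submodule R M S = carrier M)"

definition ideal_smult ::
  "('a, 'b) ring_scheme \<Rightarrow> 'a set \<Rightarrow> ('a, 'm, 'c) module_scheme \<Rightarrow> 'm set"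
  where "ideal_smult R I M =
    gen_submodule R M {a \<odot>\<^bsub>M\<^esub> x | a x. a \<in> I \<and> x \<in> carrier M}"

text \<open>
  The record \<^type>\<open>module_ext\<close> extends the ring record, but the locale \<^locale>\<open>module\<close>
  ignores the fields \<open>mult\<close> and \<open>one\<close>; they are given dummy values here.
  The remaining fields follow \<^const>\<open>FactRing\<close>.
\<close>
definition quot_module :: "('a, 'm, 'c) module_scheme \<Rightarrow> 'm set \<Rightarrow> ('a, 'm set) module"
  where "quot_module M N =
    \<lparr>carrier = a_rcosets\<^bsub>M\<^esub> N, monoid.mult = (\<lambda>_ _. N), one = N, ring.zero = N, add = set_add M,
     smult = (\<lambda>a A. \<Union>x\<in>A. N +>\<^bsub>M\<^esub> (a \<odot>\<^bsub>M\<^esub> x))\<rparr>"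

definition quot_by_ideal ::
  "('a, 'b) ring_scheme \<Rightarrow> ('a, 'm, 'c) module_scheme \<Rightarrow> 'a set \<Rightarrow> ('a, 'm set) module"
  where "quot_by_ideal R M I = quot_module M (ideal_smult R I M)"

definition annihilator ::
  "('a, 'b) ring_scheme \<Rightarrow> ('a, 'm, 'c) module_scheme \<Rightarrow> 'a set"
  where "annihilator R M = {a \<in> carrier R. \<forall>x\<in>carrier M. a \<odot>\<^bsub>M\<^esub> x = \<zero>\<^bsub>M\<^esub>}"


definition module_length ::
  "('a, 'b) ring_scheme \<Rightarrow> ('a, 'm, 'c) module_scheme \<Rightarrow> enat"
  where "module_length R M =
    Sup {enat n | n. \<exists>C :: nat \<Rightarrow> 'm set.
      (\<forall>i\<le>n. submodule (C i) R M) \<and> (\<forall>i<n. C i \<subset> C (Suc i))}"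

definition krull_dim :: "('a, 'b) ring_scheme \<Rightarrow> enat"
  where "krull_dim R =
    Sup {enat n | n. \<exists>P :: nat \<Rightarrow> 'a set.
      (\<forall>i\<le>n. primeideal (P i) R) \<and> (\<forall>i<n. P i \<subset> P (Suc i))}"

text \<open>The zero module gets dimension \<open>0\<close> (a supremum over the empty set), not \<open>-\<infinity>\<close>.\<close>
definition module_dim ::
  "('a, 'b) ring_scheme \<Rightarrow> ('a, 'm, 'c) module_scheme \<Rightarrow> enat"
  where "module_dim R M = krull_dim (R Quot annihilator R M)"

definition regular_sequence ::
  "('a, 'b) ring_scheme \<Rightarrow> ('a, 'm, 'c) module_scheme \<Rightarrow> 'a list \<Rightarrow> bool"
  where "regular_sequence R M xs \<longleftrightarrow>
    set xs \<subseteq> carrier R \<and>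
    (\<forall>i<length xs. let Q = quot_by_ideal R M (Idl\<^bsub>R\<^esub> (set (take i xs)))
       in \<forall>y\<in>carrier Q. (xs ! i) \<odot>\<^bsub>Q\<^esub> y = \<zero>\<^bsub>Q\<^esub> \<longrightarrow> y = \<zero>\<^bsub>Q\<^esub>) \<and>
    ideal_smult R (Idl\<^bsub>R\<^esub> (set xs)) M \<noteq> carrier M"

text \<open>
  The empty sequence is regular exactly when \<open>M \<noteq> 0\<close>; the zero module gets depth \<open>\<infinity>\<close>.
\<close>
definition module_depth ::
  "('a, 'b) ring_scheme \<Rightarrow> 'a set \<Rightarrow> ('a, 'm, 'c) module_scheme \<Rightarrow> enat"
  where "module_depth R \<mm> M =
    (if carrier M = {\<zero>\<^bsub>M\<^esub>} then \<infinity>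
     else Sup {enat (length xs) | xs. set xs \<subseteq> \<mm> \<and> regular_sequence R M xs})"

definition system_of_parameters ::
  "('a, 'b) ring_scheme \<Rightarrow> 'a set \<Rightarrow> ('a, 'm, 'c) module_scheme \<Rightarrow> 'a list \<Rightarrow> bool"
  where "system_of_parameters R \<mm> M xs \<longleftrightarrow>
    set xs \<subseteq> \<mm> \<and>
    enat (length xs) = module_dim R M \<and>
    module_length R (quot_by_ideal R M (Idl\<^bsub>R\<^esub> (set xs))) < \<infinity>"


definition hilbert_samuel_fun ::
  "('a, 'b) ring_scheme \<Rightarrow> 'a set \<Rightarrow> ('a, 'm, 'c) module_scheme \<Rightarrow> nat \<Rightarrow> enat"
  where "hilbert_samuel_fun R J M n =
    module_length R (quot_by_ideal R M (J [^]\<^bsub>ideals_set R\<^esub> (n + 1)))"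

definition hilbert_samuel_poly ::
  "('a, 'b) ring_scheme \<Rightarrow> 'a set \<Rightarrow> ('a, 'm, 'c) module_scheme \<Rightarrow> rat poly"
  where "hilbert_samuel_poly R J M =
    (THE p. \<exists>N. \<forall>n\<ge>N. \<exists>l. hilbert_samuel_fun R J M n = enat l \<and> poly p (of_nat n) = of_nat l)"

text \<open>
  The polynomial identity in \<open>\<rat>[X]\<close> defining the coefficients is stated pointwise on \<open>\<rat>\<close>.
  Coefficients beyond the dimension are set to \<open>0\<close>, which makes the sequence unique.
\<close>
definition hilbert_coeff ::
  "('a, 'b) ring_scheme \<Rightarrow> 'a set \<Rightarrow> ('a, 'm, 'c) module_scheme \<Rightarrow> nat \<Rightarrow> int"
  where "hilbert_coeff R J M =
    (let d = the_enat (module_dim R M) in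
      THE e. (\<forall>i>d. e i = 0) \<and>
        (\<forall>x :: rat. poly (hilbert_samuel_poly R J M) x =
          (\<Sum>i\<le>d. (-1) ^ i * of_int (e i) * ((x + of_nat (d - i)) gchoose (d - i)))))"

end

theory Submission
  imports Defs
begin

text \<open>
  Write \<open>\<ell>\<close> for length. By prime avoidance in the coset \<open>x\<^sub>1 + (x\<^sub>2, \<dots>, x\<^sub>d)\<close>, and so on, the ideal
  \<open>J\<close> has generators \<open>y\<^sub>1, \<dots>, y\<^sub>r, x\<close> with \<open>r = d - 1\<close> and \<open>y\<close> an \<open>M\<close>-regular sequence. Put
  \<open>l = \<ell>(M/JM)\<close> and \<open>h = \<ell>((yM : x)/yM)\<close>; then \<open>h > 0\<close>, as otherwise \<open>depth M \<ge> d\<close>.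
  Multiplication by \<open>x\<close> maps \<open>M/J\<^sup>nM\<close> to \<open>M/J\<^sup>n\<^sup>+\<^sup>1M\<close>. Comparing its kernel and cokernel with those of \<open>x\<close> on
  \<open>M/y\<^sup>n\<^sup>+\<^sup>1M\<close>, whose Euler characteristic is known because \<open>y\<close> is quasi-regular, gives for
  \<open>g n = \<ell>(M/J\<^sup>n\<^sup>+\<^sup>1M)\<close> the lower bound in
  \<open>h * (n+r choose r) \<le> g n - (l - h) * (n+d choose d) \<le> c * (n+r choose r)\<close>,
  where \<open>c\<close> does not depend on \<open>n\<close>; the upper bound comes from filtering \<open>M/J\<^sup>n\<^sup>+\<^sup>1M\<close> by the \<open>y\<^sup>iM\<close>.
  As \<open>g\<close> is eventually a polynomial (Hilbert--Serre), \<open>e\<^sub>0 = l - h\<close> and \<open>-e\<^sub>1 \<ge> h > 0\<close>.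
\<close>

section \<open>Submodules and lengths of subquotients\<close>

context module
begin

text \<open>Since \<open>x\<close> is a zero divisor on M/yM, the length of M/J^n M is not computed
  exactly; only a surplus is estimated. Write U = (yM : x), so that h is the length of U/yM. As
  J^(n+1) M = x J^n M + y^(n+1) M, the map \<open>x\<close> from M/J^n M to M/J^(n+1) M has the same
  cokernel as \<open>x\<close> on M/y^(n+1) M, and its kernel is the image of (y^(n+1) M : x). So
  the lengths of target and source differ by the Euler characteristic of \<open>x\<close> on
  M/y^(n+1) M, which is (l - h) * (n+r choose r), plus the length of ((y^(n+1) M : x) \<inter> J^n
  M)/y^(n+1) M. This surplus contains y^n U/y^(n+1) M, of length h * (n+r-1 choose n), and summation
  over n gives the term with h in the lower bound. The other delicate point is the choice of y. Its
  elements are dictated by J, so depth must be known to drop by one modulo every regular element,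
  not just modulo a well-chosen one; this is proved by exchanging regular elements. No quotient,
  localized or graded module is formed on the way: everything takes place among submodules of
  M.\<close>

abbreviation sub where "sub N \<equiv> submodule N R M"

abbreviation msum (infixl "\<boxplus>" 65) where "A \<boxplus> B \<equiv> A <+>\<^bsub>M\<^esub> B"

definition scale where "scale a N = (\<lambda>u. a \<odot>\<^bsub>M\<^esub> u) ` N"

definition colon where "colon N a = {u \<in> carrier M. a \<odot>\<^bsub>M\<^esub> u \<in> N}"

lemma sub_carrier: "sub N \<Longrightarrow> u \<in> N \<Longrightarrow> u \<in> carrier M"
  using submoduleE(1) by blast

lemma sub_subset: "sub N \<Longrightarrow> N \<subseteq> carrier M"
  by (rule submoduleE(1))

lemma sub_add: "sub N \<Longrightarrow> u \<in> N \<Longrightarrow> v \<in> N \<Longrightarrow> u \<oplus>\<^bsub>M\<^esub> v \<in> N"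
  by (rule submoduleE(5))

lemma sub_neg: "sub N \<Longrightarrow> u \<in> N \<Longrightarrow> \<ominus>\<^bsub>M\<^esub> u \<in> N"
  by (rule submoduleE(3))

lemma sub_smult: "sub N \<Longrightarrow> a \<in> carrier R \<Longrightarrow> u \<in> N \<Longrightarrow> a \<odot>\<^bsub>M\<^esub> u \<in> N"
  by (rule submoduleE(4))

lemma sub_diff: "sub N \<Longrightarrow> u \<in> N \<Longrightarrow> v \<in> N \<Longrightarrow> u \<ominus>\<^bsub>M\<^esub> v \<in> N"
  unfolding a_minus_def by (intro sub_add sub_neg)

lemma sub_zero: "sub N \<Longrightarrow> \<zero>\<^bsub>M\<^esub> \<in> N"
  using submodule.axioms(1) subgroup.one_closed by fastforce

lemma add_diff_cancel:
  assumes "u \<in> carrier M" "v \<in> carrier M"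
  shows "(u \<oplus>\<^bsub>M\<^esub> v) \<ominus>\<^bsub>M\<^esub> u = v" "(u \<ominus>\<^bsub>M\<^esub> v) \<oplus>\<^bsub>M\<^esub> v = u" "u \<oplus>\<^bsub>M\<^esub> (v \<ominus>\<^bsub>M\<^esub> u) = v"
  using assms M.a_lcomm[of u v "\<ominus>\<^bsub>M\<^esub> u"] by (simp_all add: a_minus_def M.a_assoc M.r_neg M.l_neg)

lemma sub_add_cancel:
  assumes "sub N" "u \<in> N" "v \<in> carrier M" "u \<oplus>\<^bsub>M\<^esub> v \<in> N"
  shows "v \<in> N"
proof -
  have "(u \<oplus>\<^bsub>M\<^esub> v) \<ominus>\<^bsub>M\<^esub> u = v"
    using add_diff_cancel sub_carrier[OF assms(1,2)] assms(3) by simp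
  then show ?thesis using sub_diff[OF assms(1,4,2)] by simp
qed

lemma sub_diff_cancel:
  assumes "sub N" "v \<in> N" "u \<in> carrier M" "u \<ominus>\<^bsub>M\<^esub> v \<in> N"
  shows "u \<in> N"
proof -
  have "(u \<ominus>\<^bsub>M\<^esub> v) \<oplus>\<^bsub>M\<^esub> v = u"
    using add_diff_cancel sub_carrier[OF assms(1,2)] assms(3) by simp
  then show ?thesis using sub_add[OF assms(1,4,2)] by simp
qed

lemma smult_diff:
  "a \<in> carrier R \<Longrightarrow> u \<in> carrier M \<Longrightarrow> v \<in> carrier M \<Longrightarrow>
    a \<odot>\<^bsub>M\<^esub> (u \<ominus>\<^bsub>M\<^esub> v) = a \<odot>\<^bsub>M\<^esub> u \<ominus>\<^bsub>M\<^esub> a \<odot>\<^bsub>M\<^esub> v"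
  by (simp add: a_minus_def smult_r_distr smult_r_minus)

lemma smult_comm:
  "a \<in> carrier R \<Longrightarrow> b \<in> carrier R \<Longrightarrow> u \<in> carrier M \<Longrightarrow>
    a \<odot>\<^bsub>M\<^esub> (b \<odot>\<^bsub>M\<^esub> u) = b \<odot>\<^bsub>M\<^esub> (a \<odot>\<^bsub>M\<^esub> u)"
  by (metis m_comm smult_assoc1)

lemma msumI: "u \<in> A \<Longrightarrow> v \<in> B \<Longrightarrow> u \<oplus>\<^bsub>M\<^esub> v \<in> A \<boxplus> B"
  by (auto simp: set_add_def')

lemma msumE:
  assumes "w \<in> A \<boxplus> B"
  obtains u v where "u \<in> A" "v \<in> B" "w = u \<oplus>\<^bsub>M\<^esub> v"
  using assms by (auto simp: set_add_def')

lemma sub_msum: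
  assumes A: "sub A" and B: "sub B"
  shows "sub (A \<boxplus> B)"
proof (rule submoduleI)
  show "A \<boxplus> B \<subseteq> carrier M"
    using sub_carrier[OF A] sub_carrier[OF B] by (auto elim!: msumE)
  show "\<zero>\<^bsub>M\<^esub> \<in> A \<boxplus> B"
    using msumI[OF sub_zero[OF A] sub_zero[OF B]] by simp
next
  fix w assume "w \<in> A \<boxplus> B"
  then obtain u v where uv: "u \<in> A" "v \<in> B" "w = u \<oplus>\<^bsub>M\<^esub> v" by (rule msumE)
  then have "\<ominus>\<^bsub>M\<^esub> w = \<ominus>\<^bsub>M\<^esub> u \<oplus>\<^bsub>M\<^esub> \<ominus>\<^bsub>M\<^esub> v"
    using sub_carrier[OF A] sub_carrier[OF B] by (simp add: M.minus_add)
  then show "\<ominus>\<^bsub>M\<^esub> w \<in> A \<boxplus> B"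
    using msumI[OF sub_neg[OF A uv(1)] sub_neg[OF B uv(2)]] by simp
next
  fix w w' assume "w \<in> A \<boxplus> B" "w' \<in> A \<boxplus> B"
  then obtain u v u' v' where uv: "u \<in> A" "v \<in> B" "w = u \<oplus>\<^bsub>M\<^esub> v"
    "u' \<in> A" "v' \<in> B" "w' = u' \<oplus>\<^bsub>M\<^esub> v'" by (meson msumE)
  then have "u \<in> carrier M" "v \<in> carrier M" "u' \<in> carrier M" "v' \<in> carrier M"
    using sub_carrier A B by auto
  then have "w \<oplus>\<^bsub>M\<^esub> w' = (u \<oplus>\<^bsub>M\<^esub> u') \<oplus>\<^bsub>M\<^esub> (v \<oplus>\<^bsub>M\<^esub> v')"
    using uv by (simp add: M.a_ac)
  then show "w \<oplus>\<^bsub>M\<^esub> w' \<in> A \<boxplus> B"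
    using msumI[OF sub_add[OF A] sub_add[OF B]] uv by simp
next
  fix a w assume a: "a \<in> carrier R" and "w \<in> A \<boxplus> B"
  then obtain u v where uv: "u \<in> A" "v \<in> B" "w = u \<oplus>\<^bsub>M\<^esub> v" by (auto elim: msumE)
  then have "a \<odot>\<^bsub>M\<^esub> w = a \<odot>\<^bsub>M\<^esub> u \<oplus>\<^bsub>M\<^esub> a \<odot>\<^bsub>M\<^esub> v"
    using sub_carrier[OF A] sub_carrier[OF B] a by (simp add: smult_r_distr)
  then show "a \<odot>\<^bsub>M\<^esub> w \<in> A \<boxplus> B"
    using msumI[OF sub_smult[OF A a uv(1)] sub_smult[OF B a uv(2)]] by simp
qed

lemma sub_scale:
  assumes a: "a \<in> carrier R" and N: "sub N"
  shows "sub (scale a N)"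
proof (rule submoduleI)
  show "scale a N \<subseteq> carrier M"
    using a sub_carrier[OF N] by (auto simp: scale_def)
  show "\<zero>\<^bsub>M\<^esub> \<in> scale a N"
    using sub_zero[OF N] a by (force simp: scale_def)
next
  fix w assume "w \<in> scale a N"
  then show "\<ominus>\<^bsub>M\<^esub> w \<in> scale a N"
    using a sub_neg[OF N] sub_carrier[OF N] by (auto simp: scale_def smult_r_minus[symmetric])
next
  fix w w' assume "w \<in> scale a N" "w' \<in> scale a N"
  then show "w \<oplus>\<^bsub>M\<^esub> w' \<in> scale a N"
    using a sub_add[OF N] sub_carrier[OF N] by (auto simp: scale_def smult_r_distr[symmetric])
next
  fix b w assume b: "b \<in> carrier R" and "w \<in> scale a N"
  then obtain u where u: "u \<in> N" "w = a \<odot>\<^bsub>M\<^esub> u" by (auto simp: scale_def)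
  then have "b \<odot>\<^bsub>M\<^esub> w = a \<odot>\<^bsub>M\<^esub> (b \<odot>\<^bsub>M\<^esub> u)"
    using a b sub_carrier[OF N] smult_comm by simp
  then show "b \<odot>\<^bsub>M\<^esub> w \<in> scale a N"
    using sub_smult[OF N b u(1)] by (auto simp: scale_def)
qed

lemma sub_colon:
  assumes a: "a \<in> carrier R" and N: "sub N"
  shows "sub (colon N a)"
proof (rule submoduleI)
  fix b w assume b: "b \<in> carrier R" and "w \<in> colon N a"
  then show "b \<odot>\<^bsub>M\<^esub> w \<in> colon N a"
    using a sub_smult[OF N b, of "a \<odot>\<^bsub>M\<^esub> w"] by (auto simp: colon_def smult_comm[of a b])
qed (use a sub_zero[OF N] sub_neg[OF N] sub_add[OF N] in
    \<open>auto simp: colon_def smult_r_minus smult_r_distr\<close>)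

lemma sub_Int: "sub A \<Longrightarrow> sub B \<Longrightarrow> sub (A \<inter> B)"
  by (rule submoduleI) (auto intro: sub_carrier sub_zero sub_neg sub_add sub_smult)

lemma sub_zero_set: "sub {\<zero>\<^bsub>M\<^esub>}"
  by (rule submoduleI) auto

lemma sub_Inter: "S \<noteq> {} \<Longrightarrow> (\<And>N. N \<in> S \<Longrightarrow> sub N) \<Longrightarrow> sub (\<Inter>S)"
  by (rule submoduleI) (auto intro: sub_carrier sub_zero sub_neg sub_add sub_smult)

lemmas sub_intros = sub_msum sub_scale sub_colon sub_Int sub_zero_set carrier_is_submodule

lemma scaleI: "u \<in> N \<Longrightarrow> a \<odot>\<^bsub>M\<^esub> u \<in> scale a N"
  by (auto simp: scale_def)

lemma scaleE:
  assumes "w \<in> scale a N" obtains u where "u \<in> N" "w = a \<odot>\<^bsub>M\<^esub> u"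
  using assms by (auto simp: scale_def)

lemma colonI: "u \<in> carrier M \<Longrightarrow> a \<odot>\<^bsub>M\<^esub> u \<in> N \<Longrightarrow> u \<in> colon N a"
  by (simp add: colon_def)

lemma colonD: "u \<in> colon N a \<Longrightarrow> a \<odot>\<^bsub>M\<^esub> u \<in> N" "u \<in> colon N a \<Longrightarrow> u \<in> carrier M"
  by (simp_all add: colon_def)

lemma msum_upper1: "sub A \<Longrightarrow> sub B \<Longrightarrow> A \<subseteq> A \<boxplus> B"
  using msumI[of _ A "\<zero>\<^bsub>M\<^esub>" B] sub_zero sub_carrier by fastforce

lemma msum_upper2: "sub A \<Longrightarrow> sub B \<Longrightarrow> B \<subseteq> A \<boxplus> B"
  using msumI[of "\<zero>\<^bsub>M\<^esub>" A _ B] sub_zero sub_carrier by fastforce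

lemma msum_least: "sub C \<Longrightarrow> A \<subseteq> C \<Longrightarrow> B \<subseteq> C \<Longrightarrow> A \<boxplus> B \<subseteq> C"
  by (auto elim!: msumE intro!: sub_add)

lemma msum_mono: "A \<subseteq> A' \<Longrightarrow> B \<subseteq> B' \<Longrightarrow> A \<boxplus> B \<subseteq> A' \<boxplus> B'"
  by (auto elim!: msumE intro: msumI)

lemma msum_commute: "sub A \<Longrightarrow> sub B \<Longrightarrow> A \<boxplus> B = B \<boxplus> A"
  by (simp add: msum_least msum_upper1 msum_upper2 sub_msum subset_antisym)

lemma msum_assoc: "sub A \<Longrightarrow> sub B \<Longrightarrow> sub C \<Longrightarrow> A \<boxplus> B \<boxplus> C = A \<boxplus> (B \<boxplus> C)"
proof
  assume S: "sub A" "sub B" "sub C"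
  have *: "A \<subseteq> A \<boxplus> B" "B \<subseteq> A \<boxplus> B" "A \<boxplus> B \<subseteq> A \<boxplus> B \<boxplus> C" "C \<subseteq> A \<boxplus> B \<boxplus> C"
    "B \<subseteq> B \<boxplus> C" "C \<subseteq> B \<boxplus> C" "B \<boxplus> C \<subseteq> A \<boxplus> (B \<boxplus> C)" "A \<subseteq> A \<boxplus> (B \<boxplus> C)"
    by (intro msum_upper1 msum_upper2 sub_msum S)+
  show "A \<boxplus> B \<boxplus> C \<subseteq> A \<boxplus> (B \<boxplus> C)"
    by (intro msum_least sub_msum S) (use * in blast)+
  show "A \<boxplus> (B \<boxplus> C) \<subseteq> A \<boxplus> B \<boxplus> C"
    by (intro msum_least sub_msum S) (use * in blast)+
qed

lemma msum_absorb1: "sub A \<Longrightarrow> sub B \<Longrightarrow> B \<subseteq> A \<Longrightarrow> A \<boxplus> B = A"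
  by (simp add: msum_least msum_upper1 subset_antisym)

lemma msum_absorb2: "sub A \<Longrightarrow> sub B \<Longrightarrow> A \<subseteq> B \<Longrightarrow> A \<boxplus> B = B"
  by (simp add: msum_least msum_upper2 subset_antisym)

lemma modular_law:
  assumes "sub A" "sub B" "sub C" "B \<subseteq> A"
  shows "A \<inter> (B \<boxplus> C) = B \<boxplus> (A \<inter> C)"
proof
  show "B \<boxplus> (A \<inter> C) \<subseteq> A \<inter> (B \<boxplus> C)"
    using assms by (simp add: msum_least msum_mono)
  show "A \<inter> (B \<boxplus> C) \<subseteq> B \<boxplus> (A \<inter> C)"
  proof
    fix w assume w: "w \<in> A \<inter> (B \<boxplus> C)"
    then obtain u v where uv: "u \<in> B" "v \<in> C" "w = u \<oplus>\<^bsub>M\<^esub> v" by (auto elim: msumE)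
    then have "v \<in> A" using sub_add_cancel[OF assms(1), of u v] w assms sub_carrier by auto
    then show "w \<in> B \<boxplus> (A \<inter> C)" using uv by (auto intro: msumI)
  qed
qed

lemma scale_mono: "A \<subseteq> B \<Longrightarrow> scale a A \<subseteq> scale a B"
  by (auto simp: scale_def)

lemma colon_mono: "A \<subseteq> B \<Longrightarrow> colon A a \<subseteq> colon B a"
  by (auto simp: colon_def)

lemma scale_subset: "a \<in> carrier R \<Longrightarrow> sub N \<Longrightarrow> scale a N \<subseteq> N"
  using sub_smult by (auto simp: scale_def)

lemma colon_upper: "a \<in> carrier R \<Longrightarrow> sub N \<Longrightarrow> N \<subseteq> colon N a"
  using sub_smult sub_carrier by (auto simp: colon_def)

lemma scale_msum:
  assumes "a \<in> carrier R" "sub A" "sub B"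
  shows "scale a (A \<boxplus> B) = scale a A \<boxplus> scale a B"
proof
  show "scale a (A \<boxplus> B) \<subseteq> scale a A \<boxplus> scale a B"
    using assms sub_carrier
    by (auto elim!: scaleE msumE simp: smult_r_distr intro!: msumI scaleI)
  show "scale a A \<boxplus> scale a B \<subseteq> scale a (A \<boxplus> B)"
    by (intro msum_least sub_intros scale_mono msum_upper1 msum_upper2 assms)
qed

lemma scale_comm:
  assumes "a \<in> carrier R" "b \<in> carrier R" "A \<subseteq> carrier M"
  shows "scale a (scale b A) = scale b (scale a A)"
  using assms by (auto simp: scale_def image_image smult_comm[of a b] subset_iff intro!: image_cong)

lemma scale_mult:
  assumes "a \<in> carrier R" "b \<in> carrier R" "A \<subseteq> carrier M"
  shows "scale (a \<otimes> b) A = scale a (scale b A)"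
  using assms by (auto simp: scale_def image_image smult_assoc1 subset_iff intro!: image_cong)

text \<open>If a w = a u + v with u in A and v in D, then a (w - u) lies in D. This computes
  preimages under multiplication by \<open>a\<close>, both for the isomorphism theorems below and
  later for (J^(n+1) M : x).\<close>

lemma colon_scale_msum:
  assumes "a \<in> carrier R" "sub A" "sub D"
  shows "colon (scale a A \<boxplus> D) a = A \<boxplus> colon D a"
proof
  show "A \<boxplus> colon D a \<subseteq> colon (scale a A \<boxplus> D) a"
    using assms
    by (auto elim!: msumE simp: smult_r_distr sub_carrier colonD intro!: colonI msumI scaleI)
  show "colon (scale a A \<boxplus> D) a \<subseteq> A \<boxplus> colon D a"
  proof
    fix w assume "w \<in> colon (scale a A \<boxplus> D) a"
    then obtain u v where *: "w \<in> carrier M" "u \<in> A" "v \<in> D" "a \<odot>\<^bsub>M\<^esub> w = a \<odot>\<^bsub>M\<^esub> u \<oplus>\<^bsub>M\<^esub> v"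
      by (auto simp: colon_def elim!: msumE scaleE)
    then have c: "u \<in> carrier M" "v \<in> carrier M" "a \<odot>\<^bsub>M\<^esub> u \<in> carrier M" using assms sub_carrier by auto
    have "a \<odot>\<^bsub>M\<^esub> (w \<ominus>\<^bsub>M\<^esub> u) = (a \<odot>\<^bsub>M\<^esub> u \<oplus>\<^bsub>M\<^esub> v) \<ominus>\<^bsub>M\<^esub> a \<odot>\<^bsub>M\<^esub> u"
      using smult_diff[OF assms(1) *(1) c(1)] *(4) by simp
    also have "\<dots> = v" using c(2,3) by (simp add: add_diff_cancel)
    finally have "w \<ominus>\<^bsub>M\<^esub> u \<in> colon D a"
      using *(1,3) c by (auto intro: colonI)
    moreover have "w = u \<oplus>\<^bsub>M\<^esub> (w \<ominus>\<^bsub>M\<^esub> u)" using *(1) c(1) by (simp add: add_diff_cancel)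
    ultimately show "w \<in> A \<boxplus> colon D a" using *(2) by (metis msumI)
  qed
qed


section \<open>Lengths of subquotients\<close>

text \<open>A quotient \<open>M/N\<close> is represented throughout by the submodule \<open>N\<close>; \<open>rlen B A\<close> is the length
  of \<open>A/B\<close>.\<close>
primrec has_chain where
  "has_chain 0 B A \<longleftrightarrow> B \<subseteq> A"
| "has_chain (Suc n) B A \<longleftrightarrow> (\<exists>C. sub C \<and> C \<subset> A \<and> has_chain n B C)"

definition rlen where "rlen B A = Sup (enat ` {n. has_chain n B A})"

lemma has_chain_subset: "has_chain n B A \<Longrightarrow> B \<subseteq> A"
  by (induction n arbitrary: A) auto

lemma has_chain_top: "has_chain n B C \<Longrightarrow> C \<subseteq> A \<Longrightarrow> has_chain n B A"
proof (cases n)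
  case (Suc k)
  assume "has_chain n B C" "C \<subseteq> A"
  then obtain D where "sub D" "D \<subset> C" "has_chain k B D" using Suc by auto
  moreover have "D \<subset> A" using \<open>D \<subset> C\<close> \<open>C \<subseteq> A\<close> by (rule psubset_subset_trans)
  ultimately show ?thesis using Suc by auto
qed auto

lemma has_chain_antimono: "has_chain n B A \<Longrightarrow> m \<le> n \<Longrightarrow> has_chain m B A"
proof (induction n arbitrary: m A)
  case (Suc n)
  show ?case
  proof (cases m)
    case 0
    then show ?thesis using has_chain_subset[OF Suc.prems(1)] by simp
  next
    case (Suc k)
    then show ?thesis using Suc.prems Suc.IH[of _ k] by auto
  qed
qed simp

text \<open>The lengths of chains form a downward closed set, so every natural number up to the
  supremum is attained. Equations between lengths, infinite ones included, thus reduce to the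
  existence of chains.\<close>

lemma enat_le_rlen:
  assumes "B \<subseteq> A"
  shows "enat n \<le> rlen B A \<longleftrightarrow> has_chain n B A"
proof
  show "has_chain n B A \<Longrightarrow> enat n \<le> rlen B A"
    by (auto simp: rlen_def intro!: Sup_upper)
  assume le: "enat n \<le> rlen B A"
  show "has_chain n B A"
  proof (rule ccontr)
    assume n: "\<not> has_chain n B A"
    then obtain k where k: "n = Suc k" using assms by (cases n) auto
    have "rlen B A \<le> enat k"
      unfolding rlen_def
    proof (rule Sup_least)
      fix y assume "y \<in> enat ` {m. has_chain m B A}"
      then obtain m where "y = enat m" "has_chain m B A" by auto
      then show "y \<le> enat k"
        using n has_chain_antimono[of m B A n] k by (cases "n \<le> m") auto
    qed
    then have "enat n \<le> enat k" using le by (rule order.trans[rotated])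
    then show False using k by simp
  qed
qed

lemma rlen_le_I: "(\<And>n. has_chain n B A \<Longrightarrow> has_chain n B' A') \<Longrightarrow> rlen B A \<le> rlen B' A'"
  unfolding rlen_def by (rule Sup_subset_mono) auto

text \<open>For lengths, an isomorphism theorem needs only a strictly increasing map between
  intervals of submodules, not a homomorphism of quotients.\<close>

lemma has_chain_map:
  assumes "has_chain n B A" "sub A"
    and "\<And>C. sub C \<Longrightarrow> B \<subseteq> C \<Longrightarrow> C \<subseteq> A \<Longrightarrow> sub (f C) \<and> B' \<subseteq> f C"
    and "\<And>C D. sub C \<Longrightarrow> sub D \<Longrightarrow> B \<subseteq> C \<Longrightarrow> C \<subset> D \<Longrightarrow> D \<subseteq> A \<Longrightarrow> f C \<subset> f D"
  shows "has_chain n B' (f A)"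
  using assms
proof (induction n arbitrary: A)
  case (Suc n)
  then obtain C where C: "sub C" "C \<subset> A" "has_chain n B C" by auto
  have "has_chain n B' (f C)"
    by (rule Suc.IH) (use C Suc.prems in auto)
  moreover have "f C \<subset> f A" "sub (f C)" using C Suc.prems has_chain_subset[OF C(3)] by auto
  ultimately show ?case by auto
qed auto

text \<open>Multiplication by \<open>a\<close> maps A/B onto (aA + D)/(aB + D), and preimages under
  a surjection keep inclusions strict.\<close>

lemma rlen_image_le:
  assumes a: "a \<in> carrier R" and sub: "sub A" "sub B" "sub D" and BA: "B \<subseteq> A"
  shows "rlen (scale a B \<boxplus> D) (scale a A \<boxplus> D) \<le> rlen B A"
proof (rule rlen_le_I)
  fix n assume ch: "has_chain n (scale a B \<boxplus> D) (scale a A \<boxplus> D)"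
  define f where "f C = A \<inter> colon C a" for C
  \<comment> \<open>A submodule between D and aA + D is determined by its preimage in A, so pulling
    back is injective.\<close>
  have recover: "scale a (f C) \<boxplus> D = C" if C: "sub C" "D \<subseteq> C" "C \<subseteq> scale a A \<boxplus> D" for C
  proof
    show "scale a (f C) \<boxplus> D \<subseteq> C"
      by (intro msum_least C) (auto simp: f_def colon_def scale_def)
    show "C \<subseteq> scale a (f C) \<boxplus> D"
    proof
      fix w assume w: "w \<in> C"
      with C obtain u v where uv: "u \<in> A" "v \<in> D" "w = a \<odot>\<^bsub>M\<^esub> u \<oplus>\<^bsub>M\<^esub> v"
        by (fastforce elim!: msumE scaleE)
      then have "a \<odot>\<^bsub>M\<^esub> u \<in> C"
        using w C sub a sub_carrier sub_add_cancel[of C v "a \<odot>\<^bsub>M\<^esub> u"] M.a_comm by auto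
      then have "u \<in> f C" using uv sub sub_carrier by (auto simp: f_def colon_def)
      then show "w \<in> scale a (f C) \<boxplus> D" using uv by (auto intro: msumI scaleI)
    qed
  qed
  have D: "D \<subseteq> scale a B \<boxplus> D" by (intro msum_upper2 sub_intros a sub)
  have "has_chain n B (f (scale a A \<boxplus> D))"
  proof (rule has_chain_map[OF ch])
    show "sub (scale a A \<boxplus> D)" by (intro sub_intros a sub)
    fix C assume C: "sub C" "scale a B \<boxplus> D \<subseteq> C" "C \<subseteq> scale a A \<boxplus> D"
    have "scale a B \<subseteq> scale a B \<boxplus> D" by (intro msum_upper1 sub_intros a sub)
    then show "sub (f C) \<and> B \<subseteq> f C"
      unfolding f_def using C BA a sub sub_carrier by (auto intro!: sub_intros colonI scaleI)
  next
    fix C E assume C: "sub C" "scale a B \<boxplus> D \<subseteq> C" and E: "sub E" "C \<subset> E" "E \<subseteq> scale a A \<boxplus> D"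
    have sub_f: "f C \<subseteq> f E" unfolding f_def using E colon_mono[of C E a] by auto
    have "scale a (f C) \<boxplus> D = C" by (rule recover) (use C D E in auto)
    moreover have "scale a (f E) \<boxplus> D = E" by (rule recover) (use C D E in auto)
    ultimately have "f C \<noteq> f E" using E(2) by (metis psubset_eq)
    then show "f C \<subset> f E" using sub_f by auto
  qed
  moreover have "f (scale a A \<boxplus> D) = A"
    unfolding f_def using colon_scale_msum[OF a sub(1,3)]
      msum_upper1[OF sub(1) sub_colon[OF a sub(3)]] by auto
  ultimately show "has_chain n B A" by simp
qed

text \<open>The assumption \<open>ker\<close> makes the surjection injective: its kernel is the
  class of A \<inter> (B + (D : a)) = B + (A \<inter> (D : a)) = B, by the modular law. With
  \<open>a\<close> the unit element it yields the second isomorphism theorem.\<close>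

lemma rlen_image_eq:
  assumes a: "a \<in> carrier R" and sub: "sub A" "sub B" "sub D" and BA: "B \<subseteq> A"
    and ker: "A \<inter> colon D a \<subseteq> B"
  shows "rlen (scale a B \<boxplus> D) (scale a A \<boxplus> D) = rlen B A"
proof (rule antisym[OF rlen_image_le[OF a sub BA]], rule rlen_le_I)
  fix n assume ch: "has_chain n B A"
  have recover: "A \<inter> colon (scale a C \<boxplus> D) a = C" if C: "sub C" "B \<subseteq> C" "C \<subseteq> A" for C
  proof -
    have "A \<inter> (C \<boxplus> colon D a) = C \<boxplus> (A \<inter> colon D a)"
      by (intro modular_law sub_intros a sub C)
    also have "\<dots> = C" using ker C by (intro msum_absorb1 sub_intros a sub C) auto
    finally show ?thesis using colon_scale_msum[OF a C(1) sub(3)] by simp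
  qed
  show "has_chain n (scale a B \<boxplus> D) (scale a A \<boxplus> D)"
  proof (rule has_chain_map[OF ch sub(1), where f = "\<lambda>C. scale a C \<boxplus> D"])
    fix C assume C: "sub C" "B \<subseteq> C" "C \<subseteq> A"
    show "sub (scale a C \<boxplus> D) \<and> scale a B \<boxplus> D \<subseteq> scale a C \<boxplus> D"
      using C by (auto intro!: sub_intros a sub dest: msum_mono[OF scale_mono[OF C(2)] subset_refl, THEN subsetD])
  next
    fix C E assume C: "sub C" "B \<subseteq> C" and E: "sub E" "C \<subset> E" "E \<subseteq> A"
    have le: "scale a C \<boxplus> D \<subseteq> scale a E \<boxplus> D" using E by (intro msum_mono scale_mono) auto
    have "A \<inter> colon (scale a C \<boxplus> D) a = C" by (rule recover) (use C E in auto)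
    moreover have "A \<inter> colon (scale a E \<boxplus> D) a = E" by (rule recover) (use C E in auto)
    ultimately have "scale a C \<boxplus> D \<noteq> scale a E \<boxplus> D" using E(2) by (metis psubset_eq)
    then show "scale a C \<boxplus> D \<subset> scale a E \<boxplus> D" using le by auto
  qed
qed

lemma scale_one: "N \<subseteq> carrier M \<Longrightarrow> scale \<one> N = N"
  by (force simp: scale_def)

lemma colon_one: "N \<subseteq> carrier M \<Longrightarrow> colon N \<one> = N"
  by (auto simp: colon_def)

lemma rlen_msum_le:
  assumes "sub A" "sub B" "sub D" "B \<subseteq> A"
  shows "rlen (B \<boxplus> D) (A \<boxplus> D) \<le> rlen B A"
  using rlen_image_le[OF R.one_closed assms] assms by (simp add: scale_one sub_subset)

lemma rlen_msum_eq:
  assumes "sub A" "sub B" "sub D" "B \<subseteq> A" "A \<inter> D \<subseteq> B"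
  shows "rlen (B \<boxplus> D) (A \<boxplus> D) = rlen B A"
  using rlen_image_eq[OF R.one_closed assms(1-4)] assms by (simp add: scale_one colon_one sub_subset)

lemma rlen_second_iso:
  assumes "sub A" "sub D"
  shows "rlen (A \<inter> D) A = rlen D (A \<boxplus> D)"
  using rlen_msum_eq[of A "A \<inter> D" D] assms by (simp add: sub_Int msum_absorb2)

text \<open>Remove the top step from C' to C. The second isomorphism theorem moves the upper part of
  the shorter chain from C'/(A \<inter> C') to (A + C')/A. The removed step is regained above A if A
  lies in C', and below A otherwise, as then A \<inter> C' is strictly smaller than A.\<close>

lemma has_chain_split:
  assumes "has_chain n B C" "sub A" "sub B" "sub C" "B \<subseteq> A" "A \<subseteq> C"
  shows "\<exists>p q. n \<le> p + q \<and> has_chain p B A \<and> has_chain q A C"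
  using assms
proof (induction n arbitrary: A C)
  case 0
  then show ?case by (intro exI[of _ 0]) auto
next
  case (Suc n)
  then obtain C' where C': "sub C'" "C' \<subset> C" "has_chain n B C'" by auto
  have BC': "B \<subseteq> C'" using C' has_chain_subset by blast
  obtain p q where pq: "n \<le> p + q" "has_chain p B (A \<inter> C')" "has_chain q (A \<inter> C') C'"
    using Suc.IH[of C' "A \<inter> C'"] C' Suc.prems BC' sub_Int by auto
  have "enat q \<le> rlen (A \<inter> C') C'" using pq enat_le_rlen by simp
  also have "\<dots> = rlen A (C' \<boxplus> A)"
    using rlen_second_iso[OF C'(1) Suc.prems(2)] by (simp add: Int_commute)
  finally have q: "has_chain q A (C' \<boxplus> A)"
    using enat_le_rlen[OF msum_upper2[OF C'(1) Suc.prems(2)]] by simp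
  show ?case
  proof (cases "A \<subseteq> C'")
    case True
    then have "C' \<boxplus> A = C'" using C' Suc.prems by (simp add: msum_absorb1)
    then have "has_chain (Suc q) A C" using q C' by auto
    moreover have "has_chain p B A" using pq has_chain_top by blast
    ultimately show ?thesis using pq(1) by (intro exI[of _ p] exI[of _ "Suc q"]) auto
  next
    case False
    then have "A \<inter> C' \<subset> A" by auto
    moreover have "sub (A \<inter> C')" using sub_Int C' Suc.prems by simp
    ultimately have "has_chain (Suc p) B A" using pq(2) unfolding has_chain.simps by blast
    moreover have "C' \<boxplus> A \<subseteq> C" using C' Suc.prems by (intro msum_least) auto
    then have "has_chain q A C" using q has_chain_top by blast
    ultimately show ?thesis using pq(1) by (intro exI[of _ "Suc p"] exI[of _ q]) auto
  qed
qed

lemma has_chain_concat: "has_chain q A C \<Longrightarrow> has_chain p B A \<Longrightarrow> has_chain (p + q) B C"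
  by (induction q arbitrary: C) (auto intro: has_chain_top)

text \<open>Brings a bound on a sum of possibly infinite lengths into the shape in which
  \<open>has_chain_split\<close> delivers chains.\<close>

lemma enat_le_add_iff:
  fixes x y :: enat
  shows "enat n \<le> x + y \<longleftrightarrow> (\<exists>p q. n \<le> p + q \<and> enat p \<le> x \<and> enat q \<le> y)"
proof
  assume le: "enat n \<le> x + y"
  show "\<exists>p q. n \<le> p + q \<and> enat p \<le> x \<and> enat q \<le> y"
  proof (cases x)
    case (enat p)
    show ?thesis
    proof (cases y)
      case (enat q)
      then show ?thesis using \<open>x = enat p\<close> le by (intro exI[of _ p] exI[of _ q]) auto
    next
      case infinity
      then show ?thesis by (intro exI[of _ 0] exI[of _ n]) (auto simp: enat_0)
    qed
  next
    case infinity
    then show ?thesis by (intro exI[of _ n] exI[of _ 0]) (auto simp: enat_0)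
  qed
next
  assume "\<exists>p q. n \<le> p + q \<and> enat p \<le> x \<and> enat q \<le> y"
  then obtain p q where *: "n \<le> p + q" "enat p \<le> x" "enat q \<le> y" by blast
  have "enat n \<le> enat p + enat q" using * by simp
  also have "\<dots> \<le> x + y" using * by (intro add_mono)
  finally show "enat n \<le> x + y" .
qed

lemma enat_eqI: "(\<And>n. enat n \<le> x \<longleftrightarrow> enat n \<le> y) \<Longrightarrow> x = y"
proof (rule antisym)
  assume eq: "\<And>n. enat n \<le> x \<longleftrightarrow> enat n \<le> y"
  have le: "u \<le> v" if "\<And>n. enat n \<le> u \<longrightarrow> enat n \<le> v" for u v
  proof (cases u)
    case (enat k)
    then show ?thesis using that[of k] by simp
  next
    case infinity
    then have all: "enat n \<le> v" for n using that[of n] by simp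
    show ?thesis
    proof (cases v)
      case (enat k)
      then show ?thesis using all[of "Suc k"] by simp
    qed simp
  qed
  show "x \<le> y" "y \<le> x" using eq by (auto intro: le)
qed

lemma rlen_additive:
  assumes "sub A" "sub B" "sub C" "B \<subseteq> A" "A \<subseteq> C"
  shows "rlen B C = rlen B A + rlen A C"
proof (rule enat_eqI)
  fix n
  have BC: "B \<subseteq> C" using assms by auto
  show "enat n \<le> rlen B C \<longleftrightarrow> enat n \<le> rlen B A + rlen A C"
    unfolding enat_le_add_iff enat_le_rlen[OF BC] enat_le_rlen[OF assms(4)] enat_le_rlen[OF assms(5)]
    using has_chain_split[of n B C A, OF _ assms] by (meson has_chain_concat has_chain_antimono)
qed

lemma rlen_refl: "rlen A A = 0"
proof -
  have "n = 0" if "has_chain n A A" for n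
    using that by (cases n) (auto dest: has_chain_subset)
  then have "{n. has_chain n A A} \<subseteq> {0}" by blast
  then have "rlen A A \<le> Sup (enat ` {0})" unfolding rlen_def by (intro Sup_subset_mono image_mono)
  then show ?thesis by (simp add: enat_0)
qed

lemma rlen_mono_top: "sub A \<Longrightarrow> sub B \<Longrightarrow> sub C \<Longrightarrow> B \<subseteq> A \<Longrightarrow> A \<subseteq> C \<Longrightarrow> rlen B A \<le> rlen B C"
  using rlen_additive[of A B C] by simp

lemma rlen_mono_bot: "sub A \<Longrightarrow> sub B \<Longrightarrow> sub C \<Longrightarrow> B \<subseteq> A \<Longrightarrow> A \<subseteq> C \<Longrightarrow> rlen A C \<le> rlen B C"
  using rlen_additive[of A B C] by simp

lemma rlen_pos:
  assumes "sub B" "B \<subset> A"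
  shows "1 \<le> rlen B A"
proof -
  have "has_chain (Suc 0) B A" unfolding has_chain.simps using assms by blast
  then have "enat (Suc 0) \<le> rlen B A" using enat_le_rlen[of B A "Suc 0"] assms by blast
  then show ?thesis by (simp add: one_enat_def)
qed

end

section \<open>Prime avoidance and Nakayama lemmas\<close>

lemma (in noetherian_ring) ex_maximal_ideal_in:
  assumes "\<F> \<noteq> {}" "\<And>I. I \<in> \<F> \<Longrightarrow> ideal I R"
  shows "\<exists>I\<in>\<F>. \<forall>K\<in>\<F>. I \<subseteq> K \<longrightarrow> K = I"
proof -
  obtain I0 where I0: "I0 \<in> \<F>" using assms by blast
  have "\<exists>I\<in>\<F>. \<forall>K\<in>\<F>. I \<subseteq> K \<longrightarrow> K = I"
  proof (rule subset_Zorn)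
    fix C assume C: "subset.chain \<F> C"
    show "\<exists>U\<in>\<F>. \<forall>K\<in>C. K \<subseteq> U"
    proof (cases "C = {}")
      case True
      then show ?thesis using I0 by auto
    next
      case False
      have "subset.chain {I. ideal I R} C"
        using C assms(2) unfolding subset.chain_def by blast
      then have "\<Union>C \<in> C" using ideal_chain_is_trivial[OF False] by blast
      moreover have "C \<subseteq> \<F>" using C unfolding subset.chain_def by blast
      ultimately show ?thesis by blast
    qed
  qed
  then show ?thesis by blast
qed

lemma (in noetherian_local_ring) unit_outside_maximal:
  assumes "r \<in> carrier R" "r \<notin> \<mm>"
  shows "r \<in> Units R"
proof (rule ccontr)
  assume nu: "r \<notin> Units R"
  let ?F = "{I. ideal I R \<and> I \<noteq> carrier R \<and> PIdl r \<subseteq> I}"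
  have id: "ideal (PIdl r) R" using assms(1) by (rule cgenideal_ideal)
  have "PIdl r \<noteq> carrier R"
  proof
    assume "PIdl r = carrier R"
    then have "\<one> \<in> PIdl r" by simp
    then obtain s where "s \<in> carrier R" "\<one> = s \<otimes> r" unfolding cgenideal_def by blast
    then have "r \<in> Units R" using assms(1) m_comm[of s r] unfolding Units_def by auto
    then show False using nu by simp
  qed
  then have "?F \<noteq> {}" using id by blast
  then have "\<exists>I\<in>?F. \<forall>K\<in>?F. I \<subseteq> K \<longrightarrow> K = I"
    by (rule ex_maximal_ideal_in) blast
  then obtain I where I: "I \<in> ?F" "\<forall>K\<in>?F. I \<subseteq> K \<longrightarrow> K = I"
    by (rule bexE)
  have I': "ideal I R" "I \<noteq> carrier R" "PIdl r \<subseteq> I" using I(1) by blast+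
  have "maximalideal I R"
  proof (rule maximalidealI)
    show "ideal I R" "carrier R \<noteq> I" using I' by blast+
    fix K assume K: "ideal K R" "I \<subseteq> K" "K \<subseteq> carrier R"
    show "K = I \<or> K = carrier R"
    proof (cases "K = carrier R")
      case False
      then have "K \<in> ?F" using K I' by blast
      then show ?thesis using I(2) K(2) by blast
    qed blast
  qed
  then have "I = \<mm>" by (rule maximal_unique)
  moreover have "r \<in> PIdl r" by (rule cgenideal_self[OF assms(1)])
  ultimately show False using I'(3) assms(2) by blast
qed

text \<open>Multiply one witness from each ideal; the product stays outside the prime.\<close>

lemma (in cring) ex_Inter_not_prime:
  assumes "finite \<F>" "\<And>I. I \<in> \<F> \<Longrightarrow> ideal I R \<and> \<not> I \<subseteq> P" "primeideal P R"
  shows "\<exists>r\<in>carrier R. r \<notin> P \<and> (\<forall>I\<in>\<F>. r \<in> I)"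
  using assms(1,2)
proof (induction rule: finite_induct)
  case empty
  interpret P: primeideal P R by fact
  have "\<one> \<notin> P" using P.one_imp_carrier P.I_notcarr by blast
  then show ?case by auto
next
  case (insert I \<F>)
  then obtain r where r: "r \<in> carrier R" "r \<notin> P" "\<forall>I\<in>\<F>. r \<in> I" by auto
  obtain s where s: "s \<in> I" "s \<notin> P" using insert by blast
  have id: "ideal K R" if "K \<in> insert I \<F>" for K using insert that by auto
  have sc: "s \<in> carrier R" using id[of I] s(1) ideal.Icarr by auto
  have "r \<otimes> s \<notin> P" using primeideal.I_prime[OF assms(3) r(1) sc] r s by auto
  moreover have "r \<otimes> s \<in> K" if "K \<in> insert I \<F>" for K
    using that id[OF that] r s sc by (auto intro: ideal.I_l_closed ideal.I_r_closed)
  ultimately show ?case using r sc by blast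
qed

text \<open>Choosing \<open>P\<close> minimal among the primes leaves room to correct a solution \<open>b\<close> for the others
  by an element lying in all of them but not in \<open>P\<close>.\<close>
lemma (in cring) prime_avoidance_coset:
  assumes "finite \<P>" "\<And>P. P \<in> \<P> \<Longrightarrow> primeideal P R" "ideal I R" "a \<in> carrier R"
    "\<And>P. P \<in> \<P> \<Longrightarrow> a \<in> P \<Longrightarrow> \<not> I \<subseteq> P"
  shows "\<exists>b\<in>I. \<forall>P\<in>\<P>. a \<oplus> b \<notin> P"
  using assms(1,2,5)
proof (induction rule: finite_psubset_induct)
  case (psubset \<P>)
  interpret I: ideal I R by fact
  show ?case
  proof (cases "\<P> = {}")
    case True
    then show ?thesis using I.zero_closed by blast
  next
    case False
    then obtain P where P: "P \<in> \<P>" "\<And>Q. Q \<in> \<P> \<Longrightarrow> Q \<subseteq> P \<Longrightarrow> Q = P"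
      using finite_has_minimal[OF psubset.hyps(1)] by auto
    have pP: "primeideal P R" using P psubset.prems by auto
    interpret P: primeideal P R by fact
    have "\<exists>b\<in>I. \<forall>Q\<in>\<P> - {P}. a \<oplus> b \<notin> Q"
      by (rule psubset.IH) (use P psubset.prems in auto)
    then obtain b where b: "b \<in> I" "\<forall>Q\<in>\<P> - {P}. a \<oplus> b \<notin> Q" by blast
    show ?thesis
    proof (cases "a \<oplus> b \<in> P")
      case False
      then show ?thesis using b by (intro bexI[of _ b]) auto
    next
      case True
      have bc: "b \<in> carrier R" using b(1) by (rule I.Icarr)
      have nI: "\<not> I \<subseteq> P"
      proof
        assume IP: "I \<subseteq> P"
        have "b \<in> P" using IP b by blast
        then have "(a \<oplus> b) \<oplus> \<ominus> b \<in> P" by (intro P.a_closed[OF True] P.a_inv_closed)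
        moreover have "(a \<oplus> b) \<oplus> \<ominus> b = a" using bc assms(4) by algebra
        ultimately show False using psubset.prems(2)[OF P(1)] IP by simp
      qed
      have "\<exists>r\<in>carrier R. r \<notin> P \<and> (\<forall>K\<in>insert I (\<P> - {P}). r \<in> K)"
      proof (rule ex_Inter_not_prime[OF _ _ pP])
        show "finite (insert I (\<P> - {P}))" using psubset.hyps by simp
        fix K assume "K \<in> insert I (\<P> - {P})"
        then show "ideal K R \<and> \<not> K \<subseteq> P"
          using nI assms(3) psubset.prems(1) P(2) primeideal.axioms(1) by auto
      qed
      then obtain c where c: "c \<in> carrier R" "c \<notin> P" "c \<in> I" "\<forall>Q\<in>\<P> - {P}. c \<in> Q" by blast
      have eq: "(a \<oplus> (b \<oplus> c)) \<ominus> (a \<oplus> b) = c" "(a \<oplus> (b \<oplus> c)) \<ominus> c = a \<oplus> b"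
        using assms(4) bc c(1) by algebra+
      have "a \<oplus> (b \<oplus> c) \<notin> Q" if Q: "Q \<in> \<P>" for Q
      proof
        assume mem: "a \<oplus> (b \<oplus> c) \<in> Q"
        interpret Q: primeideal Q R using psubset.prems Q by auto
        show False
        proof (cases "Q = P")
          case True
          then have "(a \<oplus> (b \<oplus> c)) \<ominus> (a \<oplus> b) \<in> P"
            using mem \<open>a \<oplus> b \<in> P\<close> by (simp add: a_minus_def)
          then show False using eq c by simp
        next
          case False
          then have "(a \<oplus> (b \<oplus> c)) \<ominus> c \<in> Q" using mem c Q by (simp add: a_minus_def)
          then show False using eq b Q False by simp
        qed
      qed
      moreover have "b \<oplus> c \<in> I" using b c by simp
      ultimately show ?thesis by blast
    qed
  qed
qed

section \<open>Generated submodules and Nakayama's lemma\<close>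

context module
begin

lemma sub_gen: "S \<subseteq> carrier M \<Longrightarrow> sub (gen_submodule R M S)"
  unfolding gen_submodule_def using carrier_is_submodule by (intro sub_Inter) auto

lemma gen_superset: "S \<subseteq> gen_submodule R M S"
  unfolding gen_submodule_def by blast

lemma gen_least: "sub N \<Longrightarrow> S \<subseteq> N \<Longrightarrow> gen_submodule R M S \<subseteq> N"
  unfolding gen_submodule_def by blast

lemma gen_mono: "S \<subseteq> T \<Longrightarrow> gen_submodule R M S \<subseteq> gen_submodule R M T"
  unfolding gen_submodule_def by blast

definition idl_mult where "idl_mult I W = gen_submodule R M {a \<odot>\<^bsub>M\<^esub> u | a u. a \<in> I \<and> u \<in> W}"

lemma sub_idl_mult:
  assumes "I \<subseteq> carrier R" "W \<subseteq> carrier M" shows "sub (idl_mult I W)"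
  unfolding idl_mult_def using assms by (intro sub_gen) auto

lemma idl_multI: "a \<in> I \<Longrightarrow> u \<in> W \<Longrightarrow> a \<odot>\<^bsub>M\<^esub> u \<in> idl_mult I W"
  unfolding idl_mult_def by (rule subsetD[OF gen_superset]) blast

lemma idl_mult_least:
  assumes "sub N" "\<And>a u. a \<in> I \<Longrightarrow> u \<in> W \<Longrightarrow> a \<odot>\<^bsub>M\<^esub> u \<in> N"
  shows "idl_mult I W \<subseteq> N"
  unfolding idl_mult_def using assms by (intro gen_least) auto

lemma sub_ideal_multiples:
  assumes "ideal I R" "s \<in> carrier M"
  shows "sub ((\<lambda>p. p \<odot>\<^bsub>M\<^esub> s) ` I)"
proof -
  interpret I: ideal I R by fact
  show ?thesis
  proof (rule submoduleI)
    show "(\<lambda>p. p \<odot>\<^bsub>M\<^esub> s) ` I \<subseteq> carrier M" using assms I.Icarr by auto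
    show "\<zero>\<^bsub>M\<^esub> \<in> (\<lambda>p. p \<odot>\<^bsub>M\<^esub> s) ` I" 
      using assms(2) by (intro image_eqI[of _ _ \<zero>] I.zero_closed) simp
  next
    fix u assume "u \<in> (\<lambda>p. p \<odot>\<^bsub>M\<^esub> s) ` I"
    then obtain p where "p \<in> I" "u = p \<odot>\<^bsub>M\<^esub> s" by auto
    then have "\<ominus> p \<in> I" "\<ominus>\<^bsub>M\<^esub> u = (\<ominus> p) \<odot>\<^bsub>M\<^esub> s" using assms I.Icarr smult_l_minus by auto
    then show "\<ominus>\<^bsub>M\<^esub> u \<in> (\<lambda>p. p \<odot>\<^bsub>M\<^esub> s) ` I" by auto
  next
    fix u v assume "u \<in> (\<lambda>p. p \<odot>\<^bsub>M\<^esub> s) ` I" "v \<in> (\<lambda>p. p \<odot>\<^bsub>M\<^esub> s) ` I"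
    then obtain p q where "p \<in> I" "u = p \<odot>\<^bsub>M\<^esub> s" "q \<in> I" "v = q \<odot>\<^bsub>M\<^esub> s" by auto
    then have "p \<oplus> q \<in> I" "u \<oplus>\<^bsub>M\<^esub> v = (p \<oplus> q) \<odot>\<^bsub>M\<^esub> s" using assms I.Icarr smult_l_distr by auto
    then show "u \<oplus>\<^bsub>M\<^esub> v \<in> (\<lambda>p. p \<odot>\<^bsub>M\<^esub> s) ` I" by auto
  next
    fix r u assume r: "r \<in> carrier R" and "u \<in> (\<lambda>p. p \<odot>\<^bsub>M\<^esub> s) ` I"
    then obtain p where "p \<in> I" "u = p \<odot>\<^bsub>M\<^esub> s" by auto
    then have "r \<otimes> p \<in> I" "r \<odot>\<^bsub>M\<^esub> u = (r \<otimes> p) \<odot>\<^bsub>M\<^esub> s"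
      using assms r I.Icarr I.I_l_closed smult_assoc1 by auto
    then show "r \<odot>\<^bsub>M\<^esub> u \<in> (\<lambda>p. p \<odot>\<^bsub>M\<^esub> s) ` I" by auto
  qed
qed

lemma gen_insert_subset:
  assumes "s \<in> carrier M" "S \<subseteq> carrier M"
  shows "gen_submodule R M (insert s S) \<subseteq> (\<lambda>r. r \<odot>\<^bsub>M\<^esub> s) ` carrier R \<boxplus> gen_submodule R M S"
proof (rule gen_least)
  let ?Rs = "(\<lambda>r. r \<odot>\<^bsub>M\<^esub> s) ` carrier R"
  have subs: "sub ?Rs" "sub (gen_submodule R M S)"
    using assms sub_gen sub_ideal_multiples[OF oneideal] by auto
  then show "sub (?Rs \<boxplus> gen_submodule R M S)" by (rule sub_msum)
  have "s \<in> ?Rs" using assms(1) by (intro image_eqI[of _ _ \<one>]) auto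
  then show "insert s S \<subseteq> ?Rs \<boxplus> gen_submodule R M S"
    using gen_superset[of S] msum_upper1[OF subs] msum_upper2[OF subs] by auto
qed

text \<open>Nakayama's lemma for the localization at the prime \<open>P\<close>, with denominators cleared.\<close>
lemma localized_nakayama:
  assumes P: "primeideal P R" and \<alpha>: "\<alpha> \<in> carrier R" "\<alpha> \<notin> P"
    and "finite S" "S \<subseteq> carrier M" "sub N"
    and "\<And>w. w \<in> gen_submodule R M S \<Longrightarrow>
      \<alpha> \<odot>\<^bsub>M\<^esub> w \<in> idl_mult P (gen_submodule R M S) \<boxplus> N"
  shows "\<exists>\<beta>\<in>carrier R. \<beta> \<notin> P \<and> (\<forall>w\<in>gen_submodule R M S. \<beta> \<odot>\<^bsub>M\<^esub> w \<in> N)"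
  using assms(4-)
proof (induction S arbitrary: N rule: finite_induct)
  interpret P: primeideal P R by fact
  case empty
  have "\<one> \<notin> P" using P.one_imp_carrier P.I_notcarr by blast
  moreover have "gen_submodule R M {} \<subseteq> N" using empty by (intro gen_least) auto
  ultimately show ?case using empty sub_carrier by (intro bexI[of _ \<one>]) (auto intro: sub_smult)
next
  interpret P: primeideal P R by fact
  case (insert s S)
  define W where "W = gen_submodule R M (insert s S)"
  define W' where "W' = gen_submodule R M S"
  define Rs where "Rs = (\<lambda>r. r \<odot>\<^bsub>M\<^esub> s) ` carrier R"
  define Ps where "Ps = (\<lambda>r. r \<odot>\<^bsub>M\<^esub> s) ` P"
  have s: "s \<in> carrier M" using insert by auto
  have sub: "sub W" "sub W'" "sub Rs" "sub Ps" "sub N"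
    unfolding W_def W'_def Rs_def Ps_def using insert s P.is_ideal
    by (auto intro!: sub_gen sub_ideal_multiples oneideal)
  have PW: "sub (idl_mult P W)" "sub (idl_mult P W')"
    using sub_idl_mult P.a_subset sub_subset sub by auto
  have sW: "s \<in> W" and W'W: "W' \<subseteq> W"
    unfolding W_def W'_def using gen_superset gen_mono by blast+
  have W: "W \<subseteq> Rs \<boxplus> W'"
    unfolding W_def W'_def Rs_def using insert by (intro gen_insert_subset) auto
  have PWsub: "idl_mult P W \<subseteq> idl_mult P W' \<boxplus> Rs"
  proof (rule idl_mult_least)
    show "sub (idl_mult P W' \<boxplus> Rs)" by (intro sub_msum PW sub)
    fix p w assume p: "p \<in> P" and "w \<in> W"
    then obtain u v where uv: "u \<in> Rs" "v \<in> W'" "w = u \<oplus>\<^bsub>M\<^esub> v" using W by (blast elim: msumE)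
    have pc: "p \<in> carrier R" using p P.Icarr by auto
    have c: "u \<in> carrier M" "v \<in> carrier M" using uv sub sub_carrier by auto
    have "p \<odot>\<^bsub>M\<^esub> w = p \<odot>\<^bsub>M\<^esub> v \<oplus>\<^bsub>M\<^esub> p \<odot>\<^bsub>M\<^esub> u"
      using uv c pc by (simp add: smult_r_distr M.a_comm)
    then show "p \<odot>\<^bsub>M\<^esub> w \<in> idl_mult P W' \<boxplus> Rs"
      using idl_multI[OF p uv(2)] sub_smult[OF sub(3) pc uv(1)] by (auto intro: msumI)
  qed
  \<comment> \<open>Modulo the multiples of \<open>s\<close> one generator is lost, so the induction
    hypothesis applies with \<open>Rs \<boxplus> N\<close> in place of \<open>N\<close>.\<close>
  have "\<exists>\<beta>\<in>carrier R. \<beta> \<notin> P \<and> (\<forall>w\<in>W'. \<beta> \<odot>\<^bsub>M\<^esub> w \<in> Rs \<boxplus> N)"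
    unfolding W'_def
  proof (rule insert.IH)
    show "S \<subseteq> carrier M" "sub (Rs \<boxplus> N)" using insert sub by (auto intro: sub_msum)
    fix w assume "w \<in> gen_submodule R M S"
    then have "w \<in> W" using W'W W'_def by auto
    then have "\<alpha> \<odot>\<^bsub>M\<^esub> w \<in> idl_mult P W \<boxplus> N" using insert.prems(3) W_def by auto
    also have "\<dots> \<subseteq> (idl_mult P W' \<boxplus> Rs) \<boxplus> N" using PWsub by (intro msum_mono) auto
    also have "\<dots> = idl_mult P W' \<boxplus> (Rs \<boxplus> N)" by (intro msum_assoc PW sub)
    finally show "\<alpha> \<odot>\<^bsub>M\<^esub> w \<in> idl_mult P (gen_submodule R M S) \<boxplus> (Rs \<boxplus> N)"
      unfolding W'_def .
  qed
  then obtain \<beta> where \<beta>: "\<beta> \<in> carrier R" "\<beta> \<notin> P" "\<forall>w\<in>W'. \<beta> \<odot>\<^bsub>M\<^esub> w \<in> Rs \<boxplus> N" by blast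
  have \<beta>W: "\<exists>r\<in>carrier R. \<exists>n\<in>N. \<beta> \<odot>\<^bsub>M\<^esub> w = r \<odot>\<^bsub>M\<^esub> s \<oplus>\<^bsub>M\<^esub> n" if w: "w \<in> W" for w
  proof -
    obtain u v where uv: "u \<in> Rs" "v \<in> W'" "w = u \<oplus>\<^bsub>M\<^esub> v" using w W by (blast elim: msumE)
    have c: "u \<in> carrier M" "v \<in> carrier M" using uv sub sub_carrier by auto
    have "\<beta> \<odot>\<^bsub>M\<^esub> u \<in> Rs \<boxplus> N"
      using sub_smult[OF sub(3) \<beta>(1) uv(1)] msum_upper1[OF sub(3,5)] by auto
    then have "\<beta> \<odot>\<^bsub>M\<^esub> w \<in> Rs \<boxplus> N"
      using \<beta> uv c sub_add[OF sub_msum[OF sub(3,5)]] by (simp add: smult_r_distr)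
    then show ?thesis by (auto simp: Rs_def elim!: msumE)
  qed
  have "idl_mult P W \<subseteq> colon (Ps \<boxplus> N) \<beta>"
  proof (rule idl_mult_least)
    show "sub (colon (Ps \<boxplus> N) \<beta>)" by (intro sub_intros sub \<beta>)
    fix p w assume p: "p \<in> P" and w: "w \<in> W"
    have pc: "p \<in> carrier R" using p P.Icarr by auto
    have wc: "w \<in> carrier M" using w sub sub_carrier by auto
    obtain r n where rn: "r \<in> carrier R" "n \<in> N" "\<beta> \<odot>\<^bsub>M\<^esub> w = r \<odot>\<^bsub>M\<^esub> s \<oplus>\<^bsub>M\<^esub> n" using \<beta>W[OF w] by auto
    have "\<beta> \<odot>\<^bsub>M\<^esub> (p \<odot>\<^bsub>M\<^esub> w) = p \<odot>\<^bsub>M\<^esub> (\<beta> \<odot>\<^bsub>M\<^esub> w)" using \<beta> pc wc by (rule_tac smult_comm)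
    also have "\<dots> = (p \<otimes> r) \<odot>\<^bsub>M\<^esub> s \<oplus>\<^bsub>M\<^esub> p \<odot>\<^bsub>M\<^esub> n"
      using rn pc s sub_carrier[OF sub(5)] by (simp add: smult_r_distr smult_assoc1)
    also have "\<dots> \<in> Ps \<boxplus> N"
      unfolding Ps_def using p rn pc sub by (intro msumI imageI P.I_r_closed sub_smult) auto
    finally show "p \<odot>\<^bsub>M\<^esub> w \<in> colon (Ps \<boxplus> N) \<beta>" using pc wc by (intro colonI) auto
  qed
  moreover have "N \<subseteq> colon (Ps \<boxplus> N) \<beta>"
    using colon_upper[OF \<beta>(1) sub(5)] colon_mono[OF msum_upper2[OF sub(4,5)]] by blast
  ultimately have "idl_mult P W \<boxplus> N \<subseteq> colon (Ps \<boxplus> N) \<beta>"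
    by (intro msum_least sub_intros sub \<beta>)
  moreover have "\<alpha> \<odot>\<^bsub>M\<^esub> s \<in> idl_mult P W \<boxplus> N" using insert.prems(3)[of s] sW unfolding W_def by simp
  ultimately have "\<beta> \<odot>\<^bsub>M\<^esub> (\<alpha> \<odot>\<^bsub>M\<^esub> s) \<in> Ps \<boxplus> N" using colonD(1) by blast
  then obtain p n where pn: "p \<in> P" "n \<in> N" "\<beta> \<odot>\<^bsub>M\<^esub> (\<alpha> \<odot>\<^bsub>M\<^esub> s) = p \<odot>\<^bsub>M\<^esub> s \<oplus>\<^bsub>M\<^esub> n"
    unfolding Ps_def by (auto elim!: msumE)
  have pc: "p \<in> carrier R" using pn P.Icarr by auto
  have nc: "n \<in> carrier M" using pn sub sub_carrier by auto
  \<comment> \<open>This is the factor 1 - p of the usual argument with the denominators \<alpha>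
    and \<beta> cleared. It is outside P because \<beta> \<alpha> is, and it sends \<open>s\<close>
    into N.\<close>
  define \<gamma> where "\<gamma> = \<beta> \<otimes> \<alpha> \<ominus> p"
  have \<gamma>c: "\<gamma> \<in> carrier R" unfolding \<gamma>_def using \<beta> \<alpha> pc by auto
  have "\<gamma> \<notin> P"
  proof
    assume "\<gamma> \<in> P"
    then have "\<gamma> \<oplus> p \<in> P" using pn by auto
    moreover have "\<gamma> \<oplus> p = \<beta> \<otimes> \<alpha>" unfolding \<gamma>_def using \<beta>(1) \<alpha>(1) pc by algebra
    ultimately show False using P.I_prime[OF \<beta>(1) \<alpha>(1)] \<beta> \<alpha> by auto
  qed
  then have \<gamma>\<beta>: "\<gamma> \<otimes> \<beta> \<notin> P" using P.I_prime[OF \<gamma>c \<beta>(1)] \<beta> by auto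
  have "\<gamma> \<odot>\<^bsub>M\<^esub> s = (\<beta> \<otimes> \<alpha>) \<odot>\<^bsub>M\<^esub> s \<ominus>\<^bsub>M\<^esub> p \<odot>\<^bsub>M\<^esub> s"
    unfolding \<gamma>_def a_minus_def using \<beta> \<alpha> pc s by (simp add: smult_l_distr smult_l_minus)
  also have "\<dots> = (p \<odot>\<^bsub>M\<^esub> s \<oplus>\<^bsub>M\<^esub> n) \<ominus>\<^bsub>M\<^esub> p \<odot>\<^bsub>M\<^esub> s" using pn \<beta> \<alpha> s by (simp add: smult_assoc1)
  also have "\<dots> = n" using pc s nc by (intro add_diff_cancel) auto
  finally have \<gamma>s: "\<gamma> \<odot>\<^bsub>M\<^esub> s \<in> N" using pn by simp
  have "(\<gamma> \<otimes> \<beta>) \<odot>\<^bsub>M\<^esub> w \<in> N" if w: "w \<in> W" for w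
  proof -
    obtain r m where rm: "r \<in> carrier R" "m \<in> N" "\<beta> \<odot>\<^bsub>M\<^esub> w = r \<odot>\<^bsub>M\<^esub> s \<oplus>\<^bsub>M\<^esub> m" using \<beta>W[OF w] by auto
    have "(\<gamma> \<otimes> \<beta>) \<odot>\<^bsub>M\<^esub> w = \<gamma> \<odot>\<^bsub>M\<^esub> (r \<odot>\<^bsub>M\<^esub> s \<oplus>\<^bsub>M\<^esub> m)"
      using rm \<gamma>c \<beta> w sub sub_carrier by (simp add: smult_assoc1)
    also have "\<dots> = r \<odot>\<^bsub>M\<^esub> (\<gamma> \<odot>\<^bsub>M\<^esub> s) \<oplus>\<^bsub>M\<^esub> \<gamma> \<odot>\<^bsub>M\<^esub> m"
      using rm \<gamma>c s sub sub_carrier by (simp add: smult_r_distr smult_comm)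
    also have "\<dots> \<in> N"
      by (rule sub_add[OF sub(5) sub_smult[OF sub(5) rm(1) \<gamma>s] sub_smult[OF sub(5) \<gamma>c rm(2)]])
    finally show ?thesis .
  qed
  then show ?case using \<gamma>\<beta> \<gamma>c \<beta> unfolding W_def by (intro bexI[of _ "\<gamma> \<otimes> \<beta>"]) auto
qed

definition ann where "ann N u = {r \<in> carrier R. r \<odot>\<^bsub>M\<^esub> u \<in> N}"

lemma ideal_ann:
  assumes "sub N" "u \<in> carrier M"
  shows "ideal (ann N u) R"
proof (rule idealI)
  show "ring R" by (rule R.ring_axioms)
  show "subgroup (ann N u) (add_monoid R)"
  proof
    show "ann N u \<subseteq> carrier (add_monoid R)" by (auto simp: ann_def)
    show "\<one>\<^bsub>add_monoid R\<^esub> \<in> ann N u" using assms(2) sub_zero[OF assms(1)] by (simp add: ann_def)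
  next
    fix x y assume "x \<in> ann N u" "y \<in> ann N u"
    then show "x \<otimes>\<^bsub>add_monoid R\<^esub> y \<in> ann N u"
      using assms(2) sub_add[OF assms(1)] by (simp add: ann_def smult_l_distr)
  next
    fix x assume "x \<in> ann N u"
    then show "inv\<^bsub>add_monoid R\<^esub> x \<in> ann N u"
      using assms(2) sub_neg[OF assms(1)] by (simp add: ann_def smult_l_minus a_inv_def[symmetric])
  qed
next
  fix a x assume ax: "a \<in> ann N u" "x \<in> carrier R"
  then show "x \<otimes> a \<in> ann N u" using assms(2) sub_smult[OF assms(1)] by (simp add: ann_def smult_assoc1)
  then show "a \<otimes> x \<in> ann N u" using ax m_comm[of x a] by (simp add: ann_def)
qed

text \<open>Only injectivity of \<open>z\<close> on M/N is meant: N + zM = M is allowed, and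
  properness is added at the end by Nakayama's lemma.\<close>

definition reg where "reg z N \<longleftrightarrow> (\<forall>u\<in>carrier M. z \<odot>\<^bsub>M\<^esub> u \<in> N \<longrightarrow> u \<in> N)"

end

section \<open>Noetherian modules\<close>

locale noetherian_module = module +
  assumes fg: "submodule N R M \<Longrightarrow> \<exists>S. finite S \<and> S \<subseteq> N \<and> gen_submodule R M S = N"
begin

lemma acc:
  assumes "\<And>k. sub (C k)" "\<And>k. C k \<subseteq> C (Suc k)"
  shows "\<exists>K. \<forall>k\<ge>K. C k = C K"
proof -
  have mono: "C i \<subseteq> C j" if "i \<le> j" for i j
    using lift_Suc_mono_le[of C, OF assms(2) that] .
  let ?U = "\<Union>k. C k"
  have "sub ?U"
  proof (rule submoduleI)
    show "?U \<subseteq> carrier M" using assms sub_carrier by blast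
    show "\<zero>\<^bsub>M\<^esub> \<in> ?U" using assms sub_zero by blast
  next
    fix a assume "a \<in> ?U"
    then obtain i where "a \<in> C i" by blast
    then have "\<ominus>\<^bsub>M\<^esub> a \<in> C i" by (rule sub_neg[OF assms(1)])
    then show "\<ominus>\<^bsub>M\<^esub> a \<in> ?U" by blast
  next
    fix a b assume "a \<in> ?U" "b \<in> ?U"
    then obtain i j where "a \<in> C i" "b \<in> C j" by blast
    then have "a \<in> C (max i j)" "b \<in> C (max i j)" using mono[of i "max i j"] mono[of j "max i j"] by auto
    then have "a \<oplus>\<^bsub>M\<^esub> b \<in> C (max i j)" by (rule sub_add[OF assms(1)])
    then show "a \<oplus>\<^bsub>M\<^esub> b \<in> ?U" by blast
  next
    fix r a assume r: "r \<in> carrier R" and "a \<in> ?U"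
    then obtain i where "a \<in> C i" by blast
    then have "r \<odot>\<^bsub>M\<^esub> a \<in> C i" by (rule sub_smult[OF assms(1) r])
    then show "r \<odot>\<^bsub>M\<^esub> a \<in> ?U" by blast
  qed
  from fg[OF this] obtain S where S: "finite S" "S \<subseteq> ?U" "gen_submodule R M S = ?U"
    by (elim exE conjE)
  have "\<exists>K. S \<subseteq> C K"
    using S(1,2)
  proof (induction rule: finite_induct)
    case (insert s S)
    then obtain K L where "S \<subseteq> C K" "s \<in> C L" by auto
    then have "insert s S \<subseteq> C (max K L)" using mono[of K "max K L"] mono[of L "max K L"] by auto
    then show ?case by blast
  qed auto
  then obtain K where "S \<subseteq> C K" by blast
  then have "?U \<subseteq> C K" using gen_least[OF assms(1)] S(3) by metis
  then show ?thesis using mono by blast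
qed

end

text \<open>Induction on the number of generators, with W generated by the old ones and
  \<open>s\<close> new. The coefficients of \<open>s\<close> in members of N form an ideal. Members
  of N realizing its finitely many generators, together with generators of N \<inter> W, generate
  N.\<close>

lemma (in module) noetherian_moduleI:
  assumes "noetherian_ring R" "fin_gen_module R M"
  shows "noetherian_module R M"
proof -
  interpret noetherian_ring R by fact
  have key: "\<exists>T. finite T \<and> T \<subseteq> N \<and> gen_submodule R M T = N"
    if "finite S" "S \<subseteq> carrier M" "sub N" "N \<subseteq> gen_submodule R M S" for S N
    using that
  proof (induction S arbitrary: N rule: finite_induct)
    case empty
    have "gen_submodule R M {} \<subseteq> {\<zero>\<^bsub>M\<^esub>}" by (intro gen_least sub_zero_set) auto
    then have N: "N = {\<zero>\<^bsub>M\<^esub>}" using empty sub_zero by blast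
    have "gen_submodule R M {\<zero>\<^bsub>M\<^esub>} = {\<zero>\<^bsub>M\<^esub>}"
      using gen_least[OF sub_zero_set] gen_superset by blast
    then show ?case unfolding N by (intro exI[of _ "{\<zero>\<^bsub>M\<^esub>}"]) simp
  next
    case (insert s S)
    define Rs where "Rs = (\<lambda>r. r \<odot>\<^bsub>M\<^esub> s) ` carrier R"
    define W where "W = gen_submodule R M S"
    have s: "s \<in> carrier M" using insert by auto
    have sub: "sub Rs" "sub W" "sub N"
      unfolding Rs_def W_def using insert s by (auto intro: sub_gen sub_ideal_multiples oneideal)
    have NW: "N \<subseteq> Rs \<boxplus> W"
      using insert gen_insert_subset[of s S] unfolding Rs_def W_def by auto
    have "\<exists>T. finite T \<and> T \<subseteq> N \<inter> W \<and> gen_submodule R M T = N \<inter> W"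
      by (rule insert.IH) (use insert.prems(1) sub_Int[OF sub(3,2)] in \<open>auto simp: W_def\<close>)
    then obtain T where T: "finite T" "T \<subseteq> N \<inter> W" "gen_submodule R M T = N \<inter> W"
      by (elim exE conjE)
    have sNW: "sub (N \<boxplus> W)" by (intro sub_msum sub)
    \<comment> \<open>A scalar r lies in \<open>ann (N \<boxplus> W) s\<close> exactly if r s agrees
      with a member of N up to an element of W.\<close>
    obtain A where A: "A \<subseteq> carrier R" "finite A" "ann (N \<boxplus> W) s = Idl A"
      using finetely_gen[OF ideal_ann[OF sNW s]] by blast
    have "\<exists>n\<in>N. \<exists>w\<in>W. a \<odot>\<^bsub>M\<^esub> s = n \<oplus>\<^bsub>M\<^esub> w" if "a \<in> A" for a
    proof -
      have "a \<in> ann (N \<boxplus> W) s" using that genideal_self[OF A(1)] A(3) by auto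
      then show ?thesis by (auto simp: ann_def elim!: msumE)
    qed
    then obtain f g where fg: "\<And>a. a \<in> A \<Longrightarrow> f a \<in> N \<and> g a \<in> W \<and> a \<odot>\<^bsub>M\<^esub> s = f a \<oplus>\<^bsub>M\<^esub> g a"
      by metis
    define G where "G = gen_submodule R M (T \<union> f ` A)"
    have TA: "T \<union> f ` A \<subseteq> N" using T fg by auto
    have sG: "sub G" unfolding G_def using TA sub sub_carrier by (intro sub_gen) auto
    have GN: "G \<subseteq> N" unfolding G_def by (intro gen_least sub TA)
    have NWG: "N \<inter> W \<subseteq> G" unfolding G_def using T(3) gen_mono[of T "T \<union> f ` A"] by auto
    have sGW: "sub (G \<boxplus> W)" by (intro sub_msum sG sub)
    have "Idl A \<subseteq> ann (G \<boxplus> W) s"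
    proof (rule genideal_minimal[OF ideal_ann[OF sGW s]], rule subsetI)
      fix a assume a: "a \<in> A"
      have "f a \<in> G" unfolding G_def using a gen_superset[of "T \<union> f ` A"] by auto
      then show "a \<in> ann (G \<boxplus> W) s" using fg[OF a] a A(1) by (auto simp: ann_def intro: msumI)
    qed
    then have annsub: "ann (N \<boxplus> W) s \<subseteq> ann (G \<boxplus> W) s" using A(3) by simp
    have "N \<subseteq> G"
    proof
      fix n assume n: "n \<in> N"
      then obtain r w where rw: "r \<in> carrier R" "w \<in> W" "n = r \<odot>\<^bsub>M\<^esub> s \<oplus>\<^bsub>M\<^esub> w"
        using NW by (auto simp: Rs_def elim!: msumE)
      have c: "w \<in> carrier M" "r \<odot>\<^bsub>M\<^esub> s \<in> carrier M" using rw sub sub_carrier s by auto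
      have "n \<in> N \<boxplus> W" "w \<in> N \<boxplus> W"
        using n rw msum_upper1[OF sub(3,2)] msum_upper2[OF sub(3,2)] by auto
      then have "r \<odot>\<^bsub>M\<^esub> s \<in> N \<boxplus> W"
        using sub_add_cancel[OF sNW, of w "r \<odot>\<^bsub>M\<^esub> s"] rw c M.a_comm by auto
      then have "r \<odot>\<^bsub>M\<^esub> s \<in> G \<boxplus> W" using annsub rw by (auto simp: ann_def)
      moreover have "w \<in> G \<boxplus> W" using rw msum_upper2[OF sG sub(2)] by auto
      ultimately have "n \<in> G \<boxplus> W" using rw sub_add[OF sGW] by simp
      then obtain x y where xy: "x \<in> G" "y \<in> W" "n = x \<oplus>\<^bsub>M\<^esub> y" by (auto elim: msumE)
      have "y \<in> N" using sub_add_cancel[OF sub(3), of x y] xy n GN sub sub_carrier by auto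
      then have "y \<in> G" using xy NWG by auto
      then show "n \<in> G" using xy sub_add[OF sG] by simp
    qed
    then have "G = N" using GN by auto
    then show ?case using TA T(1) A(2) unfolding G_def by (intro exI[of _ "T \<union> f ` A"]) auto
  qed
  obtain S where S: "finite S" "S \<subseteq> carrier M" "gen_submodule R M S = carrier M"
    using assms(2) unfolding fin_gen_module_def by blast
  show ?thesis
  proof
    fix N assume N: "submodule N R M"
    show "\<exists>S. finite S \<and> S \<subseteq> N \<and> gen_submodule R M S = N"
      by (rule key[OF S(1,2) N]) (use S(3) sub_subset[OF N] in simp)
  qed
qed

section \<open>Zero divisors and exchange of regular elements\<close>

lemma (in module) gen_finite_subset:
  assumes "G \<subseteq> carrier M" "s \<in> gen_submodule R M G"
  shows "\<exists>F\<subseteq>G. finite F \<and> s \<in> gen_submodule R M F"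
proof -
  let ?K = "{s. \<exists>F\<subseteq>G. finite F \<and> s \<in> gen_submodule R M F}"
  have subF: "sub (gen_submodule R M F)" if "F \<subseteq> G" for F
    using that assms(1) by (intro sub_gen) auto
  have "sub ?K"
  proof (rule submoduleI)
    show "?K \<subseteq> carrier M" using sub_carrier[OF subF] by auto
    show "\<zero>\<^bsub>M\<^esub> \<in> ?K" using sub_zero[OF subF[of "{}"]] by auto
  next
    fix a assume "a \<in> ?K"
    then obtain F where F: "F \<subseteq> G" "finite F" "a \<in> gen_submodule R M F" by auto
    then show "\<ominus>\<^bsub>M\<^esub> a \<in> ?K" using sub_neg[OF subF[OF F(1)] F(3)] by auto
  next
    fix a b assume "a \<in> ?K" "b \<in> ?K"
    then obtain F F' where F: "F \<subseteq> G" "finite F" "a \<in> gen_submodule R M F"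
      "F' \<subseteq> G" "finite F'" "b \<in> gen_submodule R M F'" by auto
    then have "a \<in> gen_submodule R M (F \<union> F')" "b \<in> gen_submodule R M (F \<union> F')"
      using gen_mono[of F "F \<union> F'"] gen_mono[of F' "F \<union> F'"] by auto
    then have "a \<oplus>\<^bsub>M\<^esub> b \<in> gen_submodule R M (F \<union> F')"
      using F by (intro sub_add subF) auto
    then show "a \<oplus>\<^bsub>M\<^esub> b \<in> ?K" using F by (auto intro!: exI[of _ "F \<union> F'"])
  next
    fix r a assume r: "r \<in> carrier R" and "a \<in> ?K"
    then obtain F where F: "F \<subseteq> G" "finite F" "a \<in> gen_submodule R M F" by auto
    then show "r \<odot>\<^bsub>M\<^esub> a \<in> ?K" using sub_smult[OF subF[OF F(1)] r F(3)] by auto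
  qed
  moreover have "G \<subseteq> ?K"
  proof
    fix g assume g: "g \<in> G"
    then show "g \<in> ?K" using gen_superset[of "{g}"] by (auto intro!: exI[of _ "{g}"])
  qed
  ultimately have "gen_submodule R M G \<subseteq> ?K" by (rule gen_least)
  then show ?thesis using assms(2) by auto
qed

lemma (in noetherian_module) gen_by_finite_subset:
  assumes "G \<subseteq> carrier M"
  shows "\<exists>F\<subseteq>G. finite F \<and> gen_submodule R M F = gen_submodule R M G"
proof -
  from fg[OF sub_gen[OF assms]] obtain S where
    S: "finite S" "S \<subseteq> gen_submodule R M G" "gen_submodule R M S = gen_submodule R M G"
    by (elim exE conjE)
  from S(1,2) have "\<exists>F\<subseteq>G. finite F \<and> S \<subseteq> gen_submodule R M F"
  proof (induction rule: finite_induct)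
    case empty
    then show ?case by auto
  next
    case (insert s S)
    then obtain F where F: "F \<subseteq> G" "finite F" "S \<subseteq> gen_submodule R M F" by auto
    obtain F' where F': "F' \<subseteq> G" "finite F'" "s \<in> gen_submodule R M F'"
      using gen_finite_subset[OF assms, of s] insert.prems by auto
    have "insert s S \<subseteq> gen_submodule R M (F \<union> F')"
      using F F' gen_mono[of F "F \<union> F'"] gen_mono[of F' "F \<union> F'"] by auto
    then show ?case using F F' by (auto intro!: exI[of _ "F \<union> F'"])
  qed
  then obtain F where F: "F \<subseteq> G" "finite F" "S \<subseteq> gen_submodule R M F" by auto
  have "gen_submodule R M S \<subseteq> gen_submodule R M F"
    using F assms by (intro gen_least sub_gen) auto
  then have "gen_submodule R M F = gen_submodule R M G"
    using S(3) gen_mono[OF F(1)] by auto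
  then show ?thesis using F by auto
qed

locale noetherian_local_module = noetherian_module R M + noetherian_local_ring R \<mm>
  for R (structure) and M (structure) and \<mm>
begin

lemma \<mm>_carrier: "a \<in> \<mm> \<Longrightarrow> a \<in> carrier R"
  by (rule Icarr)

lemma \<mm>_prime: "primeideal \<mm> R"
  using maximalideal_prime maximalideal_axioms by blast

text \<open>The primes \<open>(N : u)\<close> that are maximal among all \<open>(N : v)\<close> with \<open>v \<notin> N\<close>.\<close>
lemma finite_primes_of_zero_divisors:
  assumes N: "sub N"
  shows "\<exists>U. finite U \<and> U \<subseteq> carrier M - N \<and> (\<forall>u\<in>U. primeideal (ann N u) R) \<and>
    (\<forall>r\<in>carrier R. reg r N \<or> (\<exists>u\<in>U. r \<in> ann N u))"
proof -
  define A where "A = carrier M - N"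
  define G where "G = {u \<in> A. \<forall>v\<in>A. ann N u \<subseteq> ann N v \<longrightarrow> ann N v = ann N u}"
  have idA: "ideal (ann N u) R" if "u \<in> A" for u using that N by (auto simp: A_def intro: ideal_ann)
  have prime: "primeideal (ann N u) R" if u: "u \<in> G" for u
  proof (rule primeidealI)
    have uA: "u \<in> A" using u G_def by auto
    show "ideal (ann N u) R" using idA uA by auto
    show "cring R" by (rule R.is_cring)
    have "\<one> \<notin> ann N u" using uA by (auto simp: ann_def A_def)
    then show "carrier R \<noteq> ann N u" by auto
    fix a b assume ab: "a \<in> carrier R" "b \<in> carrier R" "a \<otimes> b \<in> ann N u"
    have uc: "u \<in> carrier M" using uA by (auto simp: A_def)
    show "a \<in> ann N u \<or> b \<in> ann N u"
    proof (cases "b \<in> ann N u")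
      case False
      then have bA: "b \<odot>\<^bsub>M\<^esub> u \<in> A" using ab uc by (auto simp: A_def ann_def)
      \<comment> \<open>As (N : u) is maximal among these annihilators, passing from u to b u cannot
        enlarge it.\<close>
      have "ann N u \<subseteq> ann N (b \<odot>\<^bsub>M\<^esub> u)"
      proof
        fix r assume "r \<in> ann N u"
        then show "r \<in> ann N (b \<odot>\<^bsub>M\<^esub> u)"
          using ab uc sub_smult[OF N ab(2)] by (auto simp: ann_def smult_comm[of r b])
      qed
      then have "ann N (b \<odot>\<^bsub>M\<^esub> u) = ann N u" using u bA unfolding G_def by auto
      moreover have "a \<in> ann N (b \<odot>\<^bsub>M\<^esub> u)" using ab uc by (auto simp: ann_def smult_assoc1)
      ultimately show ?thesis by auto
    qed auto
  qed
  have above: "\<exists>u\<in>G. ann N w \<subseteq> ann N u" if w: "w \<in> A" for w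
  proof -
    let ?F = "ann N ` {v \<in> A. ann N w \<subseteq> ann N v}"
    have "\<exists>I\<in>?F. \<forall>K\<in>?F. I \<subseteq> K \<longrightarrow> K = I"
      by (rule ex_maximal_ideal_in) (use w idA in auto)
    then obtain u where u: "u \<in> A" "ann N w \<subseteq> ann N u"
      "\<forall>v\<in>A. ann N w \<subseteq> ann N v \<longrightarrow> ann N u \<subseteq> ann N v \<longrightarrow> ann N v = ann N u" by auto
    then have "u \<in> G" unfolding G_def by auto
    then show ?thesis using u by auto
  qed
  have GM: "G \<subseteq> carrier M" by (auto simp: G_def A_def)
  then obtain U where U: "U \<subseteq> G" "finite U" "gen_submodule R M U = gen_submodule R M G"
    using gen_by_finite_subset by blast
  \<comment> \<open>Finiteness: if (N : u) differed from (N : v) for all v in the finite set U,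
    maximality would give an r in all of the latter but not in (N : u). Such an r maps the span of U
    into N, and u belongs to that span.\<close>
  have same: "\<exists>v\<in>U. ann N v = ann N u" if u: "u \<in> G" for u
  proof (rule ccontr)
    assume no: "\<not> (\<exists>v\<in>U. ann N v = ann N u)"
    have "\<exists>r\<in>carrier R. r \<notin> ann N u \<and> (\<forall>I\<in>ann N ` U. r \<in> I)"
    proof (rule ex_Inter_not_prime[OF _ _ prime[OF u]])
      show "finite (ann N ` U)" using U by simp
      fix I assume "I \<in> ann N ` U"
      then obtain v where v: "v \<in> U" "I = ann N v" by auto
      then have "v \<in> A" "u \<in> A" "v \<in> G" using U u by (auto simp: G_def)
      moreover have "ann N u \<noteq> ann N v" using no v by auto
      ultimately have "\<not> ann N v \<subseteq> ann N u" unfolding G_def by auto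
      then show "ideal I R \<and> \<not> I \<subseteq> ann N u" using v idA \<open>v \<in> A\<close> by auto
    qed
    then obtain r where r: "r \<in> carrier R" "r \<notin> ann N u" "\<forall>v\<in>U. r \<in> ann N v" by auto
    have "gen_submodule R M U \<subseteq> colon N r"
      using r U GM by (intro gen_least sub_colon N) (auto simp: ann_def colon_def)
    moreover have "u \<in> gen_submodule R M U" using U(3) gen_superset[of G] u by auto
    ultimately show False using r by (auto simp: ann_def colon_def)
  qed
  have "reg r N \<or> (\<exists>u\<in>U. r \<in> ann N u)" if r: "r \<in> carrier R" for r
  proof (cases "reg r N")
    case False
    then obtain w where w: "w \<in> A" "r \<in> ann N w" using r by (auto simp: reg_def A_def ann_def)
    obtain u where "u \<in> G" "ann N w \<subseteq> ann N u" using above[OF w(1)] by auto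
    then show ?thesis using same w by blast
  qed auto
  then show ?thesis using U prime by (intro exI[of _ U]) (auto simp: G_def A_def)
qed

text \<open>The finitely many maximal primes of zero divisors of all the M/N are avoided at once.
  Several N are needed to exchange regular elements; the coset form is needed to change generators
  of J without changing J.\<close>

lemma common_regular:
  assumes "finite \<N>" "\<And>N. N \<in> \<N> \<Longrightarrow> sub N" "ideal I R" "a \<in> carrier R"
    and "\<And>N u. N \<in> \<N> \<Longrightarrow> u \<in> carrier M - N \<Longrightarrow> primeideal (ann N u) R \<Longrightarrow>
      a \<in> ann N u \<Longrightarrow> \<not> I \<subseteq> ann N u"
  shows "\<exists>b\<in>I. \<forall>N\<in>\<N>. reg (a \<oplus> b) N"
proof -
  have "\<forall>N\<in>\<N>. \<exists>U. finite U \<and> U \<subseteq> carrier M - N \<and> (\<forall>u\<in>U. primeideal (ann N u) R) \<and>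
    (\<forall>r\<in>carrier R. reg r N \<or> (\<exists>u\<in>U. r \<in> ann N u))"
    using finite_primes_of_zero_divisors[OF assms(2)] by blast
  then obtain U where U: "\<forall>N\<in>\<N>. finite (U N) \<and> U N \<subseteq> carrier M - N \<and>
      (\<forall>u\<in>U N. primeideal (ann N u) R) \<and>
      (\<forall>r\<in>carrier R. reg r N \<or> (\<exists>u\<in>U N. r \<in> ann N u))"
    by (rule bchoice[THEN exE])
  have "\<exists>b\<in>I. \<forall>P\<in>(\<Union>N\<in>\<N>. ann N ` U N). a \<oplus> b \<notin> P"
  proof (rule prime_avoidance_coset[OF _ _ assms(3,4)])
    show "finite (\<Union>N\<in>\<N>. ann N ` U N)" using U assms(1) by auto
  next
    fix P assume "P \<in> (\<Union>N\<in>\<N>. ann N ` U N)"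
    then obtain N u where "N \<in> \<N>" "u \<in> U N" "P = ann N u" by auto
    then show "primeideal P R" using U by auto
  next
    fix P assume "P \<in> (\<Union>N\<in>\<N>. ann N ` U N)" and aP: "a \<in> P"
    then obtain N u where Nu: "N \<in> \<N>" "u \<in> U N" "P = ann N u" by auto
    then have "u \<in> carrier M - N" "primeideal (ann N u) R" using U by auto
    then show "\<not> I \<subseteq> P" using assms(5)[OF Nu(1), of u] aP Nu(3) by auto
  qed
  then obtain b where b: "b \<in> I" "\<forall>N\<in>\<N>. \<forall>u\<in>U N. a \<oplus> b \<notin> ann N u" by auto
  have "a \<oplus> b \<in> carrier R" using assms(4) ideal.Icarr[OF assms(3) b(1)] by simp
  moreover have "\<forall>N\<in>\<N>. \<forall>r\<in>carrier R. reg r N \<or> (\<exists>u\<in>U N. r \<in> ann N u)"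
    using U by simp
  ultimately have "\<forall>N\<in>\<N>. reg (a \<oplus> b) N" using b(2) by blast
  then show ?thesis using b(1) by auto
qed

text \<open>Take P = \<open>\<mm>\<close> and \<alpha> = 1 in the localized version: an element
  outside \<open>\<mm>\<close> is a unit and can be cancelled.\<close>

lemma nakayama:
  assumes K: "sub K" and N: "sub N" and "\<And>w. w \<in> K \<Longrightarrow> w \<in> idl_mult \<mm> K \<boxplus> N"
  shows "K \<subseteq> N"
proof -
  from fg[OF K] obtain S where S: "finite S" "S \<subseteq> K" "gen_submodule R M S = K"
    by (elim exE conjE)
  have "\<one> \<notin> \<mm>" using one_imp_carrier I_notcarr by blast
  have "\<exists>\<beta>\<in>carrier R. \<beta> \<notin> \<mm> \<and> (\<forall>w\<in>gen_submodule R M S. \<beta> \<odot>\<^bsub>M\<^esub> w \<in> N)"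
  proof (rule localized_nakayama[OF \<mm>_prime one_closed \<open>\<one> \<notin> \<mm>\<close> S(1) _ N])
    show "S \<subseteq> carrier M" using S(2) sub_subset[OF K] by auto
    fix w assume "w \<in> gen_submodule R M S"
    then show "\<one> \<odot>\<^bsub>M\<^esub> w \<in> idl_mult \<mm> (gen_submodule R M S) \<boxplus> N"
      using assms(3)[of w] S(3) sub_carrier[OF K] by simp
  qed
  then obtain \<beta> where \<beta>: "\<beta> \<in> carrier R" "\<beta> \<notin> \<mm>" "\<forall>w\<in>K. \<beta> \<odot>\<^bsub>M\<^esub> w \<in> N" using S(3) by auto
  have unit: "\<beta> \<in> Units R" using \<beta> by (intro unit_outside_maximal)
  show ?thesis
  proof
    fix w assume w: "w \<in> K"
    have wc: "w \<in> carrier M" using w sub_carrier[OF K] by auto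
    have "inv \<beta> \<odot>\<^bsub>M\<^esub> (\<beta> \<odot>\<^bsub>M\<^esub> w) \<in> N" 
      by (rule sub_smult[OF N Units_inv_closed[OF unit]]) (rule bspec[OF \<beta>(3) w])
    also have "inv \<beta> \<odot>\<^bsub>M\<^esub> (\<beta> \<odot>\<^bsub>M\<^esub> w) = w"
      using \<beta>(1) unit wc Units_inv_closed[OF unit] Units_l_inv[OF unit]
      by (simp add: smult_assoc1[symmetric])
    finally show "w \<in> N" .
  qed
qed

lemma nakayama_scale:
  assumes K: "sub K" and N: "sub N" and "a \<in> \<mm>" "K \<subseteq> scale a K \<boxplus> N"
  shows "K \<subseteq> N"
proof (rule nakayama[OF K N])
  fix w assume "w \<in> K"
  moreover have "scale a K \<subseteq> idl_mult \<mm> K" using assms(3) by (auto simp: scale_def intro: idl_multI)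
  ultimately show "w \<in> idl_mult \<mm> K \<boxplus> N" using assms(4) msum_mono[of "scale a K" "idl_mult \<mm> K" N N] by auto
qed

section \<open>Permuting and exchanging regular elements; depth\<close>

abbreviation adj where "adj N a \<equiv> N \<boxplus> scale a (carrier M)"

lemma sub_adj: "sub N \<Longrightarrow> a \<in> carrier R \<Longrightarrow> sub (adj N a)"
  by (intro sub_intros)

lemma adj_commute:
  assumes "sub N" "a \<in> carrier R" "b \<in> carrier R"
  shows "adj (adj N a) b = adj (adj N b) a"
  using assms by (simp add: msum_assoc sub_scale carrier_is_submodule
      msum_commute[of "scale a (carrier M)" "scale b (carrier M)"])

lemma adjI: "n \<in> N \<Longrightarrow> u \<in> carrier M \<Longrightarrow> n \<oplus>\<^bsub>M\<^esub> a \<odot>\<^bsub>M\<^esub> u \<in> adj N a"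
  by (intro msumI scaleI)

lemma adjE:
  assumes "w \<in> adj N a"
  obtains n u where "n \<in> N" "u \<in> carrier M" "w = n \<oplus>\<^bsub>M\<^esub> a \<odot>\<^bsub>M\<^esub> u"
  using assms by (auto elim!: msumE scaleE)

lemma regD: "reg a N \<Longrightarrow> u \<in> carrier M \<Longrightarrow> a \<odot>\<^bsub>M\<^esub> u \<in> N \<Longrightarrow> u \<in> N"
  by (simp add: reg_def)

text \<open>The half of permutability that does not use Nakayama's lemma. From a u = n + c v,
  regularity of \<open>c\<close> modulo \<open>adj N a\<close> gives v = n' + a w, and then a (u - c
  w) lies in N.\<close>

lemma reg_swap2:
  assumes N: "sub N" and a: "a \<in> carrier R" and c: "c \<in> carrier R"
    and reg: "reg a N" "reg c (adj N a)"
  shows "reg a (adj N c)"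
  unfolding reg_def
proof (intro ballI impI)
  fix u assume u: "u \<in> carrier M" "a \<odot>\<^bsub>M\<^esub> u \<in> adj N c"
  then obtain n v where nv: "n \<in> N" "v \<in> carrier M" "a \<odot>\<^bsub>M\<^esub> u = n \<oplus>\<^bsub>M\<^esub> c \<odot>\<^bsub>M\<^esub> v" by (rule_tac adjE)
  have nc: "n \<in> carrier M" using nv N sub_carrier by auto
  have sa: "sub (adj N a)" using N a by (rule sub_adj)
  have "a \<odot>\<^bsub>M\<^esub> u \<in> adj N a" "n \<in> adj N a"
    using adjI[OF sub_zero[OF N] u(1), of a] adjI[OF nv(1) M.zero_closed, of a] u a nc by auto
  then have "c \<odot>\<^bsub>M\<^esub> v \<in> adj N a" using sub_add_cancel[OF sa, of n "c \<odot>\<^bsub>M\<^esub> v"] nv c by auto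
  then have "v \<in> adj N a" using regD[OF reg(2)] nv by auto
  then obtain n' w where w: "n' \<in> N" "w \<in> carrier M" "v = n' \<oplus>\<^bsub>M\<^esub> a \<odot>\<^bsub>M\<^esub> w" by (rule adjE)
  have n'c: "n' \<in> carrier M" using w N sub_carrier by auto
  have "a \<odot>\<^bsub>M\<^esub> u = n \<oplus>\<^bsub>M\<^esub> (c \<odot>\<^bsub>M\<^esub> n' \<oplus>\<^bsub>M\<^esub> a \<odot>\<^bsub>M\<^esub> (c \<odot>\<^bsub>M\<^esub> w))"
    using nv w n'c a c by (simp add: smult_r_distr smult_comm)
  also have "\<dots> = a \<odot>\<^bsub>M\<^esub> (c \<odot>\<^bsub>M\<^esub> w) \<oplus>\<^bsub>M\<^esub> (n \<oplus>\<^bsub>M\<^esub> c \<odot>\<^bsub>M\<^esub> n')"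
    using nc n'c w a c by (simp add: M.a_ac)
  finally have "a \<odot>\<^bsub>M\<^esub> (u \<ominus>\<^bsub>M\<^esub> c \<odot>\<^bsub>M\<^esub> w) = n \<oplus>\<^bsub>M\<^esub> c \<odot>\<^bsub>M\<^esub> n'"
    using u w nc n'c a c by (simp add: smult_diff add_diff_cancel)
  then have "a \<odot>\<^bsub>M\<^esub> (u \<ominus>\<^bsub>M\<^esub> c \<odot>\<^bsub>M\<^esub> w) \<in> N" using nv w N c by (simp add: sub_add sub_smult)
  from regD[OF reg(1) _ this] have "u \<ominus>\<^bsub>M\<^esub> c \<odot>\<^bsub>M\<^esub> w \<in> N" using u(1) w(2) c by simp
  then have "(u \<ominus>\<^bsub>M\<^esub> c \<odot>\<^bsub>M\<^esub> w) \<oplus>\<^bsub>M\<^esub> c \<odot>\<^bsub>M\<^esub> w \<in> adj N c" using w by (intro adjI)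
  then show "u \<in> adj N c" using u w c by (simp add: add_diff_cancel)
qed

text \<open>The half that uses locality: K = (N : c) satisfies K \<subseteq> aK + N, and
  \<open>a\<close> lies in the maximal ideal.\<close>

lemma reg_swap1:
  assumes N: "sub N" and a: "a \<in> \<mm>" and c: "c \<in> carrier R"
    and reg: "reg a N" "reg c (adj N a)"
  shows "reg c N"
proof -
  have ac: "a \<in> carrier R" using a by (rule \<mm>_carrier)
  have sK: "sub (colon N c)" using c N by (rule sub_colon)
  have "colon N c \<subseteq> N"
  proof (rule nakayama_scale[OF sK N a], rule subsetI)
    fix u assume "u \<in> colon N c"
    then have u: "u \<in> carrier M" "c \<odot>\<^bsub>M\<^esub> u \<in> N" by (auto simp: colon_def)
    have "c \<odot>\<^bsub>M\<^esub> u \<in> adj N a" using u msum_upper1[OF N sub_scale[OF ac carrier_is_submodule]] by auto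
    then have "u \<in> adj N a" using regD[OF reg(2)] u by auto
    then obtain n v where nv: "n \<in> N" "v \<in> carrier M" "u = n \<oplus>\<^bsub>M\<^esub> a \<odot>\<^bsub>M\<^esub> v" by (rule adjE)
    have nc: "n \<in> carrier M" using nv N sub_carrier by auto
    have "c \<odot>\<^bsub>M\<^esub> u = c \<odot>\<^bsub>M\<^esub> n \<oplus>\<^bsub>M\<^esub> a \<odot>\<^bsub>M\<^esub> (c \<odot>\<^bsub>M\<^esub> v)"
      using nv nc ac c by (simp add: smult_r_distr smult_comm)
    then have "a \<odot>\<^bsub>M\<^esub> (c \<odot>\<^bsub>M\<^esub> v) \<in> N"
      using sub_add_cancel[OF N sub_smult[OF N c nv(1)], of "a \<odot>\<^bsub>M\<^esub> (c \<odot>\<^bsub>M\<^esub> v)"] u nv c ac by simp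
    then have "c \<odot>\<^bsub>M\<^esub> v \<in> N" using regD[OF reg(1)] nv c by auto
    then have "v \<in> colon N c" using nv by (auto simp: colon_def)
    then have "a \<odot>\<^bsub>M\<^esub> v \<oplus>\<^bsub>M\<^esub> n \<in> scale a (colon N c) \<boxplus> N" using nv(1) by (intro msumI scaleI)
    also have "a \<odot>\<^bsub>M\<^esub> v \<oplus>\<^bsub>M\<^esub> n = u" using nv(2,3) nc ac by (simp add: M.a_comm)
    finally show "u \<in> scale a (colon N c) \<boxplus> N" .
  qed
  then show ?thesis by (auto simp: reg_def colon_def)
qed

text \<open>Up to isomorphism, \<open>(0 : I)\<close> in \<open>M/(N + aM)\<close> does not depend on the regular element \<open>a\<close>:
  \<open>u\<close> modulo \<open>bM\<close> corresponds to \<open>v\<close> modulo \<open>aM\<close> when \<open>au = bv\<close> modulo \<open>N\<close>.\<close>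
lemma socle_exchange:
  assumes N: "sub N" and I: "I \<subseteq> carrier R" and a: "a \<in> I" and b: "b \<in> carrier R"
    and reg: "reg a N" "reg b N"
    and soc: "\<And>u. u \<in> carrier M \<Longrightarrow> (\<And>i. i \<in> I \<Longrightarrow> i \<odot>\<^bsub>M\<^esub> u \<in> adj N a) \<Longrightarrow> u \<in> adj N a"
    and u: "u \<in> carrier M" "\<And>i. i \<in> I \<Longrightarrow> i \<odot>\<^bsub>M\<^esub> u \<in> adj N b"
  shows "u \<in> adj N b"
proof -
  have ac: "a \<in> carrier R" using a I by auto
  obtain n v where nv: "n \<in> N" "v \<in> carrier M" "a \<odot>\<^bsub>M\<^esub> u = n \<oplus>\<^bsub>M\<^esub> b \<odot>\<^bsub>M\<^esub> v"
    using u(2)[OF a] by (rule adjE)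
  have nc: "n \<in> carrier M" using nv N sub_carrier by auto
  \<comment> \<open>Let i be in I and i u = m + b w. Comparing i (a u) with a (i u) puts b (i v - a
    w) into N, and \<open>b\<close> is regular, so i v lies in N + aM.\<close>
  have "v \<in> adj N a"
  proof (rule soc[OF nv(2)])
    fix i assume i: "i \<in> I"
    have ic: "i \<in> carrier R" using i I by auto
    obtain m w where mw: "m \<in> N" "w \<in> carrier M" "i \<odot>\<^bsub>M\<^esub> u = m \<oplus>\<^bsub>M\<^esub> b \<odot>\<^bsub>M\<^esub> w"
      using u(2)[OF i] by (rule adjE)
    have mc: "m \<in> carrier M" using mw N sub_carrier by auto
    have "i \<odot>\<^bsub>M\<^esub> n \<oplus>\<^bsub>M\<^esub> b \<odot>\<^bsub>M\<^esub> (i \<odot>\<^bsub>M\<^esub> v) = i \<odot>\<^bsub>M\<^esub> (a \<odot>\<^bsub>M\<^esub> u)"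
      using nv nc ic b by (simp add: smult_r_distr smult_comm)
    also have "\<dots> = a \<odot>\<^bsub>M\<^esub> (i \<odot>\<^bsub>M\<^esub> u)" using ic ac u by (rule_tac smult_comm)
    also have "\<dots> = a \<odot>\<^bsub>M\<^esub> m \<oplus>\<^bsub>M\<^esub> b \<odot>\<^bsub>M\<^esub> (a \<odot>\<^bsub>M\<^esub> w)"
      using mw mc ac b by (simp add: smult_r_distr smult_comm)
    finally have eq: "i \<odot>\<^bsub>M\<^esub> n \<oplus>\<^bsub>M\<^esub> b \<odot>\<^bsub>M\<^esub> (i \<odot>\<^bsub>M\<^esub> v) = a \<odot>\<^bsub>M\<^esub> m \<oplus>\<^bsub>M\<^esub> b \<odot>\<^bsub>M\<^esub> (a \<odot>\<^bsub>M\<^esub> w)" .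
    have "i \<odot>\<^bsub>M\<^esub> n \<oplus>\<^bsub>M\<^esub> (b \<odot>\<^bsub>M\<^esub> (i \<odot>\<^bsub>M\<^esub> v) \<ominus>\<^bsub>M\<^esub> b \<odot>\<^bsub>M\<^esub> (a \<odot>\<^bsub>M\<^esub> w)) =
        (a \<odot>\<^bsub>M\<^esub> m \<oplus>\<^bsub>M\<^esub> b \<odot>\<^bsub>M\<^esub> (a \<odot>\<^bsub>M\<^esub> w)) \<ominus>\<^bsub>M\<^esub> b \<odot>\<^bsub>M\<^esub> (a \<odot>\<^bsub>M\<^esub> w)"
      unfolding eq[symmetric] a_minus_def using nc nv ic b ac mw by (simp add: M.a_assoc)
    also have "\<dots> = a \<odot>\<^bsub>M\<^esub> m" 
      using mc mw(2) ac b by (simp add: M.a_comm[of "a \<odot>\<^bsub>M\<^esub> m"] add_diff_cancel)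
    finally have "i \<odot>\<^bsub>M\<^esub> n \<oplus>\<^bsub>M\<^esub> b \<odot>\<^bsub>M\<^esub> (i \<odot>\<^bsub>M\<^esub> v \<ominus>\<^bsub>M\<^esub> a \<odot>\<^bsub>M\<^esub> w) \<in> N"
      using b ic nv(2) ac mw(2) sub_smult[OF N ac mw(1)] by (simp add: smult_diff)
    then have "b \<odot>\<^bsub>M\<^esub> (i \<odot>\<^bsub>M\<^esub> v \<ominus>\<^bsub>M\<^esub> a \<odot>\<^bsub>M\<^esub> w) \<in> N"
      using sub_add_cancel[OF N sub_smult[OF N ic nv(1)]] b ic nv(2) ac mw(2) by simp
    from regD[OF reg(2) _ this] have "i \<odot>\<^bsub>M\<^esub> v \<ominus>\<^bsub>M\<^esub> a \<odot>\<^bsub>M\<^esub> w \<in> N"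
      using ic nv(2) ac mw(2) by simp
    then have "(i \<odot>\<^bsub>M\<^esub> v \<ominus>\<^bsub>M\<^esub> a \<odot>\<^bsub>M\<^esub> w) \<oplus>\<^bsub>M\<^esub> a \<odot>\<^bsub>M\<^esub> w \<in> adj N a" using mw by (intro adjI)
    then show "i \<odot>\<^bsub>M\<^esub> v \<in> adj N a" using ic nv ac mw by (simp add: add_diff_cancel)
  qed
  then obtain n' w where w: "n' \<in> N" "w \<in> carrier M" "v = n' \<oplus>\<^bsub>M\<^esub> a \<odot>\<^bsub>M\<^esub> w" by (rule adjE)
  have n'c: "n' \<in> carrier M" using w N sub_carrier by auto
  have "a \<odot>\<^bsub>M\<^esub> u = n \<oplus>\<^bsub>M\<^esub> (b \<odot>\<^bsub>M\<^esub> n' \<oplus>\<^bsub>M\<^esub> a \<odot>\<^bsub>M\<^esub> (b \<odot>\<^bsub>M\<^esub> w))"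
    using nv w n'c ac b by (simp add: smult_r_distr smult_comm)
  also have "\<dots> = a \<odot>\<^bsub>M\<^esub> (b \<odot>\<^bsub>M\<^esub> w) \<oplus>\<^bsub>M\<^esub> (n \<oplus>\<^bsub>M\<^esub> b \<odot>\<^bsub>M\<^esub> n')"
    using nc n'c w ac b by (simp add: M.a_ac)
  finally have "a \<odot>\<^bsub>M\<^esub> (u \<ominus>\<^bsub>M\<^esub> b \<odot>\<^bsub>M\<^esub> w) = n \<oplus>\<^bsub>M\<^esub> b \<odot>\<^bsub>M\<^esub> n'"
    using u w nc n'c ac b by (simp add: smult_diff add_diff_cancel)
  then have "a \<odot>\<^bsub>M\<^esub> (u \<ominus>\<^bsub>M\<^esub> b \<odot>\<^bsub>M\<^esub> w) \<in> N" using nv w N b by (simp add: sub_add sub_smult)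
  from regD[OF reg(1) _ this] have "u \<ominus>\<^bsub>M\<^esub> b \<odot>\<^bsub>M\<^esub> w \<in> N" using u(1) w(2) b by simp
  then have "(u \<ominus>\<^bsub>M\<^esub> b \<odot>\<^bsub>M\<^esub> w) \<oplus>\<^bsub>M\<^esub> b \<odot>\<^bsub>M\<^esub> w \<in> adj N b" using w by (intro adjI)
  then show "u \<in> adj N b" using u w b by (simp add: add_diff_cancel)
qed

text \<open>States that \<mm> contains a sequence of length \<open>t\<close> that is regular on M/N
  in the weak sense of \<open>reg\<close>. The elements are left existential, which
  \<open>has_depth_adj\<close> justifies.\<close>

primrec has_depth where
  "has_depth 0 N \<longleftrightarrow> True"
| "has_depth (Suc t) N \<longleftrightarrow> (\<exists>a\<in>\<mm>. reg a N \<and> has_depth t (adj N a))"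

text \<open>Depth drops by one whichever regular element is divided out. The given sequence starts
  with some a, not with y, so both are compared with a third element c that is regular on M/N, M/(N
  + aM) and M/(N + yM).\<close>

lemma has_depth_adj:
  assumes "sub N" "has_depth (Suc t) N" "y \<in> \<mm>" "reg y N"
  shows "has_depth t (adj N y)"
  using assms
proof (induction t arbitrary: N y)
  case (Suc t)
  have yc: "y \<in> carrier R" using Suc.prems \<mm>_carrier by auto
  obtain a where a: "a \<in> \<mm>" "reg a N" "has_depth (Suc t) (adj N a)" using Suc.prems(2) by auto
  then obtain a' where a': "a' \<in> \<mm>" "reg a' (adj N a)" by auto
  have ac: "a \<in> carrier R" using a \<mm>_carrier by auto
  have soc: "u \<in> adj N a" if "u \<in> carrier M" "\<And>i. i \<in> \<mm> \<Longrightarrow> i \<odot>\<^bsub>M\<^esub> u \<in> adj N a" for u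
    using regD[OF a'(2) that(1) that(2)[OF a'(1)]] .
  have socy: "u \<in> adj N y" if "u \<in> carrier M" "\<And>i. i \<in> \<mm> \<Longrightarrow> i \<odot>\<^bsub>M\<^esub> u \<in> adj N y" for u
    by (rule socle_exchange[OF Suc.prems(1) _ a(1) yc a(2) Suc.prems(4) soc that])
      (auto intro: \<mm>_carrier)
  \<comment> \<open>Such a c exists unless \<mm> annihilates a nonzero element of one of the three
    quotients. For M/(N + aM) this is excluded by the second element a' of the sequence, for M/(N +
    yM) by \<open>socle_exchange\<close>.\<close>
  have "\<exists>c\<in>\<mm>. \<forall>K\<in>{N, adj N a, adj N y}. reg (\<zero> \<oplus> c) K"
  proof (rule common_regular)
    show "finite {N, adj N a, adj N y}" by simp
    show "\<And>K. K \<in> {N, adj N a, adj N y} \<Longrightarrow> sub K" using Suc.prems sub_adj ac yc by auto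
    show "ideal \<mm> R" by (rule is_ideal)
    show "\<zero> \<in> carrier R" by simp
    fix K u assume K: "K \<in> {N, adj N a, adj N y}" "u \<in> carrier M - K"
    have ann: "i \<odot>\<^bsub>M\<^esub> u \<in> K" if "\<mm> \<subseteq> ann K u" "i \<in> \<mm>" for i using that by (auto simp: ann_def)
    show "\<not> \<mm> \<subseteq> ann K u"
    proof
      assume sub: "\<mm> \<subseteq> ann K u"
      consider "K = N" | "K = adj N a" | "K = adj N y" using K(1) by auto
      then have "u \<in> K"
      proof cases
        case 1
        then show ?thesis using regD[OF a(2), of u] ann[OF sub a(1)] K(2) by auto
      next
        case 2
        then show ?thesis using soc[of u] ann[OF sub] K(2) by auto
      next
        case 3
        then show ?thesis using socy[of u] ann[OF sub] K(2) by auto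
      qed
      then show False using K(2) by auto
    qed
  qed
  then obtain c where c: "c \<in> \<mm>" "reg c N" "reg c (adj N a)" "reg c (adj N y)"
    using \<mm>_carrier by auto
  have cc: "c \<in> carrier R" using c \<mm>_carrier by auto
  \<comment> \<open>First replace the second element of the sequence by c, then swap a and c, so
    that M/(N + cM) has depth at least t + 1 with a in front. There y may be divided out by the
    induction hypothesis.\<close>
  have "has_depth t (adj (adj N a) c)" using Suc.IH[OF sub_adj[OF Suc.prems(1) ac] a(3) c(1,3)] .
  then have "has_depth (Suc t) (adj N c)"
    using a(1) reg_swap2[OF Suc.prems(1) ac cc a(2) c(3)] adj_commute[OF Suc.prems(1) ac cc] by auto
  moreover have "reg y (adj N c)" using reg_swap2[OF Suc.prems(1) yc cc Suc.prems(4) c(4)] .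
  ultimately have "has_depth t (adj (adj N c) y)"
    using Suc.IH[OF sub_adj[OF Suc.prems(1) cc] _ Suc.prems(3)] by blast
  then show ?case using c adj_commute[OF Suc.prems(1) cc yc] by auto
qed simp

end

section \<open>Powers of an ideal generated by a regular sequence\<close>

context module
begin

text \<open>The product of the ideal generated by \<open>xs\<close> with K, in a form that allows
  induction on the generators; \<open>pw\<close> is the product with a power of that ideal.\<close>

primrec lmul where
  "lmul [] K = {\<zero>\<^bsub>M\<^esub>}"
| "lmul (x # xs) K = scale x K \<boxplus> lmul xs K"

definition pw where "pw xs i K = (lmul xs ^^ i) K"

lemma sub_lmul: "set xs \<subseteq> carrier R \<Longrightarrow> sub K \<Longrightarrow> sub (lmul xs K)"
  by (induction xs) (auto intro!: sub_intros)

lemma lmul_mono: "A \<subseteq> B \<Longrightarrow> lmul xs A \<subseteq> lmul xs B"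
  by (induction xs) (auto intro!: msum_mono scale_mono del: subsetI)

lemma lmul_subset: "set xs \<subseteq> carrier R \<Longrightarrow> sub K \<Longrightarrow> lmul xs K \<subseteq> K"
  by (induction xs) (auto intro!: msum_least scale_subset sub_zero del: subsetI)

lemma msum_interchange:
  assumes "sub A" "sub B" "sub C" "sub D"
  shows "(A \<boxplus> B) \<boxplus> (C \<boxplus> D) = (A \<boxplus> C) \<boxplus> (B \<boxplus> D)"
proof -
  have "(A \<boxplus> B) \<boxplus> (C \<boxplus> D) = A \<boxplus> ((B \<boxplus> C) \<boxplus> D)"
    using assms by (simp add: msum_assoc sub_msum)
  also have "\<dots> = A \<boxplus> ((C \<boxplus> B) \<boxplus> D)" using assms by (simp add: msum_commute[of B C])
  also have "\<dots> = (A \<boxplus> C) \<boxplus> (B \<boxplus> D)" using assms by (simp add: msum_assoc sub_msum)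
  finally show ?thesis .
qed

lemma lmul_msum:
  "set xs \<subseteq> carrier R \<Longrightarrow> sub A \<Longrightarrow> sub B \<Longrightarrow> lmul xs (A \<boxplus> B) = lmul xs A \<boxplus> lmul xs B"
proof (induction xs)
  case Nil
  then show ?case using msum_absorb1[OF sub_zero_set sub_zero_set] by simp
next
  case (Cons x xs)
  then show ?case
    by (simp add: scale_msum msum_interchange sub_scale sub_lmul)
qed

lemma lmul_scale:
  "set xs \<subseteq> carrier R \<Longrightarrow> a \<in> carrier R \<Longrightarrow> sub K \<Longrightarrow> lmul xs (scale a K) = scale a (lmul xs K)"
proof (induction xs)
  case Nil
  then show ?case by (simp add: scale_def)
next
  case (Cons x xs)
  then show ?case
    by (simp add: scale_msum sub_scale sub_lmul scale_comm[of x a K] sub_subset)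
qed

text \<open>Frees \<open>lmul\<close> from the order and the choice of the generators, and connects
  it with the ideal products of the definitions.\<close>

lemma idl_mult_genideal:
  assumes xs: "set xs \<subseteq> carrier R" and K: "sub K"
  shows "idl_mult (Idl (set xs)) K = lmul xs K"
proof
  have id: "ideal (Idl (set xs)) R" using xs by (rule genideal_ideal)
  have sI: "sub (idl_mult (Idl (set xs)) K)"
    using ideal.Icarr[OF id] K by (intro sub_idl_mult sub_subset) auto
  have sL: "sub (lmul xs K)" using xs K by (rule sub_lmul)
  have "scale x K \<subseteq> lmul xs K" if "x \<in> set xs" for x
    using that xs
  proof (induction xs)
    case (Cons y xs)
    then have s: "sub (scale y K)" "sub (lmul xs K)" using K by (auto intro: sub_scale sub_lmul)
    show ?case
    proof (cases "x = y")
      case True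
      then show ?thesis using msum_upper1[OF s] by simp
    next
      case False
      then have "scale x K \<subseteq> lmul xs K" using Cons by simp
      then show ?thesis using msum_upper2[OF s] by simp
    qed
  qed simp
  then have gen: "x \<odot>\<^bsub>M\<^esub> u \<in> lmul xs K" if "x \<in> set xs" "u \<in> K" for x u
    using that scaleI[of u K x] by auto
  show "idl_mult (Idl (set xs)) K \<subseteq> lmul xs K"
  proof (rule idl_mult_least[OF sL])
    fix a u assume a: "a \<in> Idl (set xs)" and u: "u \<in> K"
    have "Idl (set xs) \<subseteq> ann (lmul xs K) u"
      using gen u xs sub_carrier[OF K u]
      by (intro genideal_minimal ideal_ann sL) (auto simp: ann_def)
    then show "a \<odot>\<^bsub>M\<^esub> u \<in> lmul xs K" using a by (auto simp: ann_def)
  qed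
  have *: "lmul zs K \<subseteq> idl_mult (Idl (set xs)) K" if "set zs \<subseteq> set xs" for zs
    using that
  proof (induction zs)
    case Nil
    then show ?case using sub_zero[OF sI] by simp
  next
    case (Cons z zs)
    have "z \<in> Idl (set xs)" using Cons.prems genideal_self[OF xs] by auto
    then have "scale z K \<subseteq> idl_mult (Idl (set xs)) K" by (auto simp: scale_def intro: idl_multI)
    then show ?case using Cons by (simp add: msum_least[OF sI])
  qed
  then show "lmul xs K \<subseteq> idl_mult (Idl (set xs)) K" by simp
qed

lemma pw_0 [simp]: "pw xs 0 K = K"
  by (simp add: pw_def)

lemma pw_Suc: "pw xs (Suc i) K = lmul xs (pw xs i K)"
  by (simp add: pw_def)

lemma pw_Suc': "pw xs (Suc i) K = pw xs i (lmul xs K)"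
  by (simp add: pw_def funpow_swap1)

lemma sub_pw: "set xs \<subseteq> carrier R \<Longrightarrow> sub K \<Longrightarrow> sub (pw xs i K)"
  by (induction i) (auto simp: pw_Suc intro: sub_lmul)

lemma pw_mono: "A \<subseteq> B \<Longrightarrow> pw xs i A \<subseteq> pw xs i B"
  by (induction i) (auto simp: pw_Suc intro!: lmul_mono del: subsetI)

lemma pw_subset: "set xs \<subseteq> carrier R \<Longrightarrow> sub K \<Longrightarrow> pw xs i K \<subseteq> K"
proof (induction i)
  case (Suc i)
  have "lmul xs (pw xs i K) \<subseteq> pw xs i K" by (intro lmul_subset sub_pw Suc.prems)
  also have "\<dots> \<subseteq> K" by (rule Suc.IH[OF Suc.prems])
  finally show ?case by (simp only: pw_Suc)
qed simp

lemma pw_antimono: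
  assumes "set xs \<subseteq> carrier R" "sub K" "i \<le> j"
  shows "pw xs j K \<subseteq> pw xs i K"
  using assms(3)
proof (induction j rule: dec_induct)
  case (step n)
  have "lmul xs (pw xs n K) \<subseteq> pw xs n K" by (intro lmul_subset sub_pw assms)
  also have "\<dots> \<subseteq> pw xs i K" by (rule step.IH)
  finally show ?case by (simp only: pw_Suc)
qed simp

lemma pw_msum:
  "set xs \<subseteq> carrier R \<Longrightarrow> sub A \<Longrightarrow> sub B \<Longrightarrow> pw xs i (A \<boxplus> B) = pw xs i A \<boxplus> pw xs i B"
  by (induction i) (auto simp: pw_Suc lmul_msum sub_pw)

lemma pw_scale:
  "set xs \<subseteq> carrier R \<Longrightarrow> a \<in> carrier R \<Longrightarrow> sub K \<Longrightarrow> pw xs i (scale a K) = scale a (pw xs i K)"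
  by (induction i) (auto simp: pw_Suc lmul_scale sub_pw)

lemma pw_Cons_superset:
  assumes "z \<in> carrier R" "set ys \<subseteq> carrier R" "sub K"
  shows "pw ys i K \<subseteq> pw (z # ys) i K"
proof (induction i)
  case (Suc i)
  have s: "sub (pw (z # ys) i K)" using assms by (intro sub_pw) auto
  have "lmul ys (pw ys i K) \<subseteq> lmul ys (pw (z # ys) i K)" by (rule lmul_mono[OF Suc])
  also have "\<dots> \<subseteq> lmul (z # ys) (pw (z # ys) i K)"
    unfolding lmul.simps using assms s by (intro msum_upper2 sub_scale sub_lmul)
  finally show ?case by (simp only: pw_Suc)
qed simp

text \<open>Monomials of degree i + 1 are sorted by whether they contain z. This recursion takes the
  place of explicit monomials throughout.\<close>

lemma pw_Cons:
  assumes z: "z \<in> carrier R" and ys: "set ys \<subseteq> carrier R" and K: "sub K"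
  shows "pw (z # ys) (Suc i) K = scale z (pw (z # ys) i K) \<boxplus> pw ys (Suc i) K"
proof (induction i)
  case 0
  then show ?case by (simp add: pw_Suc)
next
  case (Suc i)
  define A where "A = pw (z # ys) i K"
  define B where "B = pw ys (Suc i) K"
  define C where "C = pw (z # ys) (Suc i) K"
  have zys: "set (z # ys) \<subseteq> carrier R" using z ys by simp
  have s: "sub A" "sub B" "sub C" unfolding A_def B_def C_def by (rule sub_pw[OF _ K], use zys in simp)+
  have C: "C = scale z A \<boxplus> B" unfolding A_def B_def C_def by (rule Suc)
  have sl: "sub (lmul ys A)" "sub (lmul ys B)" by (intro sub_lmul ys s)+
  have "lmul ys A \<subseteq> C"
    unfolding C_def pw_Suc A_def[symmetric] lmul.simps by (intro msum_upper2 sub_scale sub_lmul z ys s)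
  then have AC: "scale z (lmul ys A) \<subseteq> scale z C" by (rule scale_mono)
  have "lmul ys C = scale z (lmul ys A) \<boxplus> lmul ys B"
    unfolding C using ys z s by (simp add: lmul_msum lmul_scale sub_scale)
  then have "pw (z # ys) (Suc (Suc i)) K = scale z C \<boxplus> (scale z (lmul ys A) \<boxplus> lmul ys B)"
    unfolding pw_Suc[of _ "Suc i"] C_def[symmetric] by simp
  also have "\<dots> = (scale z C \<boxplus> scale z (lmul ys A)) \<boxplus> lmul ys B"
    by (intro msum_assoc[symmetric] sub_scale sl z s)
  also have "scale z C \<boxplus> scale z (lmul ys A) = scale z C"
    by (intro msum_absorb1 sub_scale sl z s AC)
  finally show ?case unfolding B_def C_def by (simp only: pw_Suc[of ys "Suc i"])
qed

lemma scale_pw_subset: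
  assumes "z \<in> carrier R" "set ys \<subseteq> carrier R" "sub K"
  shows "scale z (pw (z # ys) i K) \<subseteq> pw (z # ys) (Suc i) K"
  unfolding pw_Cons[OF assms] using assms by (intro msum_upper1 sub_scale sub_pw) auto

end

section \<open>Regular sequences are quasi-regular\<close>

context noetherian_local_module
begin

text \<open>The head of the list is the last element of the regular sequence.\<close>
primrec reg_seq where
  "reg_seq N [] \<longleftrightarrow> True"
| "reg_seq N (z # ys) \<longleftrightarrow> reg_seq N ys \<and> reg z (N \<boxplus> lmul ys (carrier M))"

lemma adj_lmul:
  assumes N: "sub N" and z: "z \<in> carrier R" and ys: "set ys \<subseteq> carrier R"
  shows "adj N z \<boxplus> lmul ys (carrier M) = N \<boxplus> lmul (z # ys) (carrier M)"
    and "adj (N \<boxplus> lmul ys (carrier M)) z = N \<boxplus> lmul (z # ys) (carrier M)"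
proof -
  note s = N sub_scale[OF z carrier_is_submodule] sub_lmul[OF ys carrier_is_submodule]
  show "adj N z \<boxplus> lmul ys (carrier M) = N \<boxplus> lmul (z # ys) (carrier M)"
    unfolding lmul.simps by (rule msum_assoc[OF s])
  show "adj (N \<boxplus> lmul ys (carrier M)) z = N \<boxplus> lmul (z # ys) (carrier M)"
    unfolding lmul.simps msum_commute[OF s(2,3)] by (rule msum_assoc[OF s(1,3,2)])
qed

text \<open>Moves the last element of the sequence to the front: \<open>z\<close> passes its
  neighbour \<open>w\<close> by the two halves of permutability, and the induction hypothesis
  carries it further.\<close>

lemma reg_seq_swap:
  "sub N \<Longrightarrow> set (z # ys) \<subseteq> \<mm> \<Longrightarrow> reg_seq N (z # ys) \<Longrightarrow> reg_seq (adj N z) ys \<and> reg z N"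
proof (induction ys)
  case Nil
  then show ?case using msum_absorb1[OF Nil(1) sub_zero_set] sub_zero by auto
next
  case (Cons w ys)
  define L where "L = N \<boxplus> lmul ys (carrier M)"
  have c: "w \<in> \<mm>" "z \<in> carrier R" "w \<in> carrier R" "set ys \<subseteq> carrier R"
    using Cons.prems \<mm>_carrier by auto
  have sL: "sub L" unfolding L_def using c Cons.prems by (intro sub_msum sub_lmul carrier_is_submodule) auto
  have r: "reg_seq N ys" "reg w L" using Cons.prems L_def by auto
  have "reg z (N \<boxplus> lmul (w # ys) (carrier M))" using Cons.prems by simp
  then have rz: "reg z (adj L w)" unfolding L_def adj_lmul(2)[OF Cons.prems(1) c(3,4)] .
  have "reg z L" by (rule reg_swap1[OF sL c(1,2) r(2) rz])
  then have IH: "reg_seq (adj N z) ys" "reg z N" using Cons r unfolding L_def by auto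
  have "reg w (adj L z)" by (rule reg_swap2[OF sL c(3,2) r(2) rz])
  then have "reg w (adj N z \<boxplus> lmul ys (carrier M))"
    unfolding L_def adj_lmul[OF Cons.prems(1) c(2,4)] .
  then show ?case using IH by simp
qed

text \<open>If the associated graded module of M/N along \<open>ys\<close> is a polynomial module
  over M/(N + yM), then the kernel of any scalar on its degree i part comes from the kernel in
  degree 0. That consequence is taken as the definition, since it avoids polynomials.\<close>

definition quasi_reg where
  "quasi_reg N ys \<longleftrightarrow> (\<forall>a\<in>carrier R. \<forall>i. \<forall>u \<in> N \<boxplus> pw ys i (carrier M).
     a \<odot>\<^bsub>M\<^esub> u \<in> N \<boxplus> pw ys (Suc i) (carrier M) \<longrightarrow>
     u \<in> N \<boxplus> pw ys i (colon (N \<boxplus> lmul ys (carrier M)) a))"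

lemma pw_base:
  assumes N: "sub N" and ys: "set ys \<subseteq> carrier R"
  shows "N \<boxplus> pw ys i (N \<boxplus> lmul ys (carrier M)) \<subseteq> N \<boxplus> pw ys (Suc i) (carrier M)"
proof -
  note M = carrier_is_submodule
  have s: "sub (pw ys (Suc i) (carrier M))" using ys M by (rule sub_pw)
  have "pw ys i (N \<boxplus> lmul ys (carrier M)) = pw ys i N \<boxplus> pw ys (Suc i) (carrier M)"
    unfolding pw_Suc' by (rule pw_msum[OF ys N sub_lmul[OF ys M]])
  also have "\<dots> \<subseteq> N \<boxplus> pw ys (Suc i) (carrier M)"
    by (intro msum_mono pw_subset ys N order_refl)
  finally show ?thesis by (intro msum_least sub_msum N s msum_upper1)
qed

text \<open>Climb from one power to the next: \<open>z\<close> has no kernel on M/(N + yM), so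
  quasi-regularity pushes u from y^i M into y^(i+1) M, modulo N, as long as i < j.\<close>

lemma colon_regular_pw:
  assumes N: "sub N" and ys: "set ys \<subseteq> carrier R" and z: "z \<in> carrier R"
    and q: "quasi_reg N ys" and rz: "reg z (N \<boxplus> lmul ys (carrier M))"
    and u: "u \<in> carrier M" "z \<odot>\<^bsub>M\<^esub> u \<in> N \<boxplus> pw ys j (carrier M)"
  shows "u \<in> N \<boxplus> pw ys j (carrier M)"
proof -
  note M = carrier_is_submodule
  have "i \<le> j \<Longrightarrow> u \<in> N \<boxplus> pw ys i (carrier M)" for i
  proof (induction i)
    case 0
    then show ?case using u(1) msum_upper2[OF N M] by auto
  next
    case (Suc i)
    have "pw ys j (carrier M) \<subseteq> pw ys (Suc i) (carrier M)" using Suc.prems by (rule pw_antimono[OF ys M])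
    then have "N \<boxplus> pw ys j (carrier M) \<subseteq> N \<boxplus> pw ys (Suc i) (carrier M)" by (intro msum_mono order_refl)
    then have zu: "z \<odot>\<^bsub>M\<^esub> u \<in> N \<boxplus> pw ys (Suc i) (carrier M)" using u(2) by blast
    have ui: "u \<in> N \<boxplus> pw ys i (carrier M)" using Suc by simp
    have "u \<in> N \<boxplus> pw ys i (colon (N \<boxplus> lmul ys (carrier M)) z)"
      using q[unfolded quasi_reg_def, rule_format, OF z ui zu] .
    moreover have "colon (N \<boxplus> lmul ys (carrier M)) z \<subseteq> N \<boxplus> lmul ys (carrier M)"
      using rz by (auto simp: colon_def reg_def)
    then have "N \<boxplus> pw ys i (colon (N \<boxplus> lmul ys (carrier M)) z) \<subseteq> N \<boxplus> pw ys i (N \<boxplus> lmul ys (carrier M))"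
      by (intro msum_mono pw_mono order_refl)
    ultimately show ?case using pw_base[OF N ys, of i] by blast
  qed
  then show ?thesis by simp
qed

text \<open>The leading form of z can be cancelled. By \<open>pw_Cons\<close>, z u = n + z v + w
  with v already of the desired form and w in y^(i+1) K. Then z (u - v) lies in N + y^(i+1) M, where
  z cancels, and yM \<subseteq> K turns y^(i+1) M into a part of y^i K.\<close>

lemma colon_pw_Cons:
  assumes N: "sub N" and ys: "set ys \<subseteq> carrier R" and z: "z \<in> carrier R"
    and q: "quasi_reg N ys" and rz: "reg z (N \<boxplus> lmul ys (carrier M))"
    and K: "sub K" "N \<boxplus> lmul (z # ys) (carrier M) \<subseteq> K"
    and u: "u \<in> carrier M" "z \<odot>\<^bsub>M\<^esub> u \<in> N \<boxplus> pw (z # ys) (Suc i) K"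
  shows "u \<in> N \<boxplus> pw (z # ys) i K"
proof -
  note M = carrier_is_submodule
  have zys: "set (z # ys) \<subseteq> carrier R" using z ys by simp
  have sp: "sub (pw (z # ys) i K)" using zys K(1) by (rule sub_pw)
  obtain n t where nt: "n \<in> N" "t \<in> pw (z # ys) (Suc i) K" "z \<odot>\<^bsub>M\<^esub> u = n \<oplus>\<^bsub>M\<^esub> t"
    using u(2) by (rule msumE)
  obtain s w where sw: "s \<in> scale z (pw (z # ys) i K)" "w \<in> pw ys (Suc i) K" "t = s \<oplus>\<^bsub>M\<^esub> w"
    using nt(2) unfolding pw_Cons[OF z ys K(1)] by (rule msumE)
  obtain v where v: "v \<in> pw (z # ys) i K" "s = z \<odot>\<^bsub>M\<^esub> v" using sw(1) by (rule scaleE)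
  have c: "n \<in> carrier M" "v \<in> carrier M" "w \<in> carrier M"
    using sub_carrier N nt(1) sp v(1) sub_pw[OF ys K(1)] sw(2) by blast+
  have "z \<odot>\<^bsub>M\<^esub> (u \<ominus>\<^bsub>M\<^esub> v) = z \<odot>\<^bsub>M\<^esub> u \<ominus>\<^bsub>M\<^esub> z \<odot>\<^bsub>M\<^esub> v" by (rule smult_diff[OF z u(1) c(2)])
  also have "z \<odot>\<^bsub>M\<^esub> u = z \<odot>\<^bsub>M\<^esub> v \<oplus>\<^bsub>M\<^esub> (n \<oplus>\<^bsub>M\<^esub> w)"
    unfolding nt(3) sw(3) v(2) using c z by (simp add: M.a_ac)
  also have "\<dots> \<ominus>\<^bsub>M\<^esub> z \<odot>\<^bsub>M\<^esub> v = n \<oplus>\<^bsub>M\<^esub> w" using c z by (simp add: add_diff_cancel)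
  also have "n \<oplus>\<^bsub>M\<^esub> w \<in> N \<boxplus> pw ys (Suc i) (carrier M)"
    using nt(1) sw(2) pw_mono[OF sub_subset[OF K(1)]] by (blast intro: msumI)
  finally have "z \<odot>\<^bsub>M\<^esub> (u \<ominus>\<^bsub>M\<^esub> v) \<in> N \<boxplus> pw ys (Suc i) (carrier M)" .
  from colon_regular_pw[OF N ys z q rz _ this]
  have "u \<ominus>\<^bsub>M\<^esub> v \<in> N \<boxplus> pw ys (Suc i) (carrier M)"
    using u(1) c(2) by simp
  moreover have "pw ys (Suc i) (carrier M) \<subseteq> pw (z # ys) i K"
  proof -
    have "lmul ys (carrier M) \<subseteq> lmul (z # ys) (carrier M)"
      unfolding lmul.simps by (intro msum_upper2 sub_scale sub_lmul z ys M)
    also have "\<dots> \<subseteq> N \<boxplus> lmul (z # ys) (carrier M)" by (intro msum_upper2 N sub_lmul zys M)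
    finally have "lmul ys (carrier M) \<subseteq> K" using K(2) by blast
    then have "pw ys i (lmul ys (carrier M)) \<subseteq> pw ys i K" by (rule pw_mono)
    then show ?thesis using pw_Cons_superset[OF z ys K(1), of i] unfolding pw_Suc' by blast
  qed
  ultimately have "u \<ominus>\<^bsub>M\<^esub> v \<in> N \<boxplus> pw (z # ys) i K" using msum_mono[OF order_refl] by blast
  moreover have "v \<in> N \<boxplus> pw (z # ys) i K" using v(1) msum_upper2[OF N sp] by blast
  ultimately have "(u \<ominus>\<^bsub>M\<^esub> v) \<oplus>\<^bsub>M\<^esub> v \<in> N \<boxplus> pw (z # ys) i K" by (intro sub_add sub_msum N sp)
  then show ?thesis using u(1) c(2) by (simp add: add_diff_cancel)
qed

text \<open>Regular sequences may be permuted here (\<open>reg_seq_swap\<close>), so the induction can pass to \<open>M/zM\<close>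
  and avoids monomials.\<close>
lemma quasi_reg_if_reg_seq:
  "sub N \<Longrightarrow> set ys \<subseteq> \<mm> \<Longrightarrow> reg_seq N ys \<Longrightarrow> quasi_reg N ys"
proof (induction ys arbitrary: N)
  case Nil
  note M = carrier_is_submodule
  show ?case unfolding quasi_reg_def
  proof (intro ballI allI impI)
    fix a i u assume a: "a \<in> carrier R" and u: "u \<in> N \<boxplus> pw [] i (carrier M)"
      "a \<odot>\<^bsub>M\<^esub> u \<in> N \<boxplus> pw [] (Suc i) (carrier M)"
    let ?K = "colon (N \<boxplus> lmul [] (carrier M)) a"
    have sK: "sub ?K" using Nil a by (auto intro!: sub_intros)
    show "u \<in> N \<boxplus> pw [] i ?K"
    proof (cases i)
      case 0
      then have "u \<in> carrier M" using u(1) sub_carrier[OF sub_msum[OF Nil(1) M]] by simp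
      then have "u \<in> ?K" using u(2) 0 by (simp add: colon_def pw_Suc)
      then show ?thesis using 0 msum_upper2[OF Nil(1) sK] by auto
    next
      case (Suc j)
      then show ?thesis using u(1) by (simp add: pw_Suc)
    qed
  qed
next
  case (Cons z ys)
  note M = carrier_is_submodule and N = Cons.prems(1)
  have z: "z \<in> carrier R" and ys: "set ys \<subseteq> carrier R" using Cons.prems \<mm>_carrier by auto
  have zys: "set (z # ys) \<subseteq> carrier R" using z ys by simp
  have ysm: "set ys \<subseteq> \<mm>" using Cons.prems by simp
  have swap: "reg_seq (adj N z) ys" using reg_seq_swap[OF Cons.prems] by simp
  have sA: "sub (adj N z)" using N z by (rule sub_adj)
  have qA: "quasi_reg (adj N z) ys" by (rule Cons.IH[OF sA ysm swap])
  have qN: "quasi_reg N ys" using Cons.prems by (intro Cons.IH[OF N ysm]) simp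
  have rz: "reg z (N \<boxplus> lmul ys (carrier M))" using Cons.prems by simp
  note star = colon_pw_Cons[OF N ys z qN rz]
  have NM: "N \<boxplus> lmul (z # ys) (carrier M) \<subseteq> carrier M"
    by (intro sub_subset sub_msum N sub_lmul zys M)
  show ?case unfolding quasi_reg_def
  proof (intro ballI)
    fix a assume a: "a \<in> carrier R"
    define K where "K = colon (N \<boxplus> lmul (z # ys) (carrier M)) a"
    have sK: "sub K" unfolding K_def by (intro sub_intros sub_lmul a N zys M)
    have Y1: "sub (N \<boxplus> lmul (z # ys) (carrier M))" by (intro sub_msum N sub_lmul zys M)
    have sY: "sub (N \<boxplus> pw (z # ys) j (carrier M))" for j by (intro sub_msum N sub_pw zys M)
    \<comment> \<open>Inner induction on the degree: the error made by working modulo zM is a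
      multiple of z, and cancelling z lowers the degree by one.\<close>
    have "u \<in> N \<boxplus> pw (z # ys) i (carrier M) \<Longrightarrow>
       a \<odot>\<^bsub>M\<^esub> u \<in> N \<boxplus> pw (z # ys) (Suc i) (carrier M) \<Longrightarrow> u \<in> N \<boxplus> pw (z # ys) i K" for i u
    proof (induction i arbitrary: u)
      case 0
      then have "u \<in> K" using sub_carrier[OF sub_msum[OF N M]] by (simp add: K_def colon_def pw_Suc)
      then show ?case using msum_upper2[OF N sK] by auto
    next
      case (Suc i)
      have sub1: "N \<boxplus> pw (z # ys) (Suc j) (carrier M) \<subseteq> adj N z \<boxplus> pw ys (Suc j) (carrier M)" for j
      proof -
        have sp: "sub (pw ys (Suc j) (carrier M))" by (intro sub_pw ys M)
        have "scale z (pw (z # ys) j (carrier M)) \<subseteq> scale z (carrier M)"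
          by (intro scale_mono pw_subset zys M)
        then have "N \<boxplus> pw (z # ys) (Suc j) (carrier M) \<subseteq>
            N \<boxplus> (scale z (carrier M) \<boxplus> pw ys (Suc j) (carrier M))"
          unfolding pw_Cons[OF z ys M] by (intro msum_mono order_refl)
        also have "\<dots> = adj N z \<boxplus> pw ys (Suc j) (carrier M)"
          by (rule msum_assoc[symmetric, OF N sub_scale[OF z M] sp])
        finally show ?thesis .
      qed
      have u1: "u \<in> adj N z \<boxplus> pw ys (Suc i) (carrier M)"
        and u2: "a \<odot>\<^bsub>M\<^esub> u \<in> adj N z \<boxplus> pw ys (Suc (Suc i)) (carrier M)"
        using Suc.prems sub1 by blast+
      \<comment> \<open>Quasi-regularity of \<open>ys\<close> on M/(N + zM) gives u = t + z v, where
        t = n + s has the desired form.\<close>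
      have "u \<in> adj N z \<boxplus> pw ys (Suc i) (colon (adj N z \<boxplus> lmul ys (carrier M)) a)"
        using qA[unfolded quasi_reg_def, rule_format, OF a u1 u2] .
      then have "u \<in> adj N z \<boxplus> pw ys (Suc i) K" unfolding K_def adj_lmul(1)[OF N z ys] .
      then obtain m s where ms: "m \<in> adj N z" "s \<in> pw ys (Suc i) K" "u = m \<oplus>\<^bsub>M\<^esub> s" by (rule msumE)
      obtain n v where nv: "n \<in> N" "v \<in> carrier M" "m = n \<oplus>\<^bsub>M\<^esub> z \<odot>\<^bsub>M\<^esub> v" using ms(1) by (rule adjE)
      have s': "s \<in> pw (z # ys) (Suc i) K" using ms(2) pw_Cons_superset[OF z ys sK] by blast
      have c: "n \<in> carrier M" "s \<in> carrier M" "u \<in> carrier M"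
        using sub_carrier N nv(1) sub_pw[OF zys sK] s' sY Suc.prems(1) by blast+
      define t where "t = n \<oplus>\<^bsub>M\<^esub> s"
      have tc: "t \<in> carrier M" using c by (simp add: t_def)
      have tK: "t \<in> N \<boxplus> pw (z # ys) (Suc i) K" unfolding t_def using nv(1) s' by (rule msumI)
      have u: "u = t \<oplus>\<^bsub>M\<^esub> z \<odot>\<^bsub>M\<^esub> v" unfolding t_def ms(3) nv(3) using c nv(2) z by (simp add: M.a_ac)
      have "N \<boxplus> pw (z # ys) (Suc i) K \<subseteq> N \<boxplus> pw (z # ys) (Suc i) (carrier M)"
        by (intro msum_mono pw_mono order_refl sub_subset sK)
      then have tY: "t \<in> N \<boxplus> pw (z # ys) (Suc i) (carrier M)" using tK by blast
      have "a \<odot>\<^bsub>M\<^esub> s \<in> scale a (pw (z # ys) (Suc i) K)" using s' by (rule scaleI)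
      also have "\<dots> = pw (z # ys) (Suc i) (scale a K)" by (rule pw_scale[symmetric, OF zys a sK])
      also have "\<dots> \<subseteq> pw (z # ys) (Suc i) (N \<boxplus> lmul (z # ys) (carrier M))"
        by (intro pw_mono) (auto simp: K_def scale_def colon_def)
      finally have "a \<odot>\<^bsub>M\<^esub> n \<oplus>\<^bsub>M\<^esub> a \<odot>\<^bsub>M\<^esub> s \<in> N \<boxplus> pw (z # ys) (Suc i) (N \<boxplus> lmul (z # ys) (carrier M))"
        using sub_smult[OF N a nv(1)] by (intro msumI)
      then have "a \<odot>\<^bsub>M\<^esub> n \<oplus>\<^bsub>M\<^esub> a \<odot>\<^bsub>M\<^esub> s \<in> N \<boxplus> pw (z # ys) (Suc (Suc i)) (carrier M)"
        using pw_base[OF N zys] by blast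
      then have atY: "a \<odot>\<^bsub>M\<^esub> t \<in> N \<boxplus> pw (z # ys) (Suc (Suc i)) (carrier M)"
        unfolding t_def using c a by (simp add: smult_r_distr)
      have "z \<odot>\<^bsub>M\<^esub> v \<in> N \<boxplus> pw (z # ys) (Suc i) (carrier M)"
        using sub_add_cancel[OF sY tY, of "z \<odot>\<^bsub>M\<^esub> v"] Suc.prems(1) u nv(2) z by simp
      \<comment> \<open>Both z v and z (a v) have known degree, so cancelling z shows that v
        satisfies the hypotheses in degree i.\<close>
      then have v1: "v \<in> N \<boxplus> pw (z # ys) i (carrier M)" by (rule star[OF M NM nv(2)])
      have "a \<odot>\<^bsub>M\<^esub> u = a \<odot>\<^bsub>M\<^esub> t \<oplus>\<^bsub>M\<^esub> z \<odot>\<^bsub>M\<^esub> (a \<odot>\<^bsub>M\<^esub> v)"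
        unfolding u using tc nv(2) z a by (simp add: smult_r_distr smult_comm)
      then have "z \<odot>\<^bsub>M\<^esub> (a \<odot>\<^bsub>M\<^esub> v) \<in> N \<boxplus> pw (z # ys) (Suc (Suc i)) (carrier M)"
        using sub_add_cancel[OF sY atY, of "z \<odot>\<^bsub>M\<^esub> (a \<odot>\<^bsub>M\<^esub> v)"] Suc.prems(2) nv(2) z a by simp
      then have v2: "a \<odot>\<^bsub>M\<^esub> v \<in> N \<boxplus> pw (z # ys) (Suc i) (carrier M)"
        using star[OF M NM, of "a \<odot>\<^bsub>M\<^esub> v"] a nv(2) by simp
      have "v \<in> N \<boxplus> pw (z # ys) i K" by (rule Suc.IH[OF v1 v2])
      then obtain n' w where w: "n' \<in> N" "w \<in> pw (z # ys) i K" "v = n' \<oplus>\<^bsub>M\<^esub> w" by (rule msumE)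
      have wc: "n' \<in> carrier M" "w \<in> carrier M" using sub_carrier[OF N w(1)] sub_carrier[OF sub_pw[OF zys sK] w(2)] .
      have "z \<odot>\<^bsub>M\<^esub> v = z \<odot>\<^bsub>M\<^esub> n' \<oplus>\<^bsub>M\<^esub> z \<odot>\<^bsub>M\<^esub> w" unfolding w(3) using wc z by (simp add: smult_r_distr)
      also have "\<dots> \<in> N \<boxplus> pw (z # ys) (Suc i) K"
        using sub_smult[OF N z w(1)] scale_pw_subset[OF z ys sK, of i] scaleI[OF w(2), of z]
        by (blast intro: msumI)
      finally show ?case unfolding u using tK by (intro sub_add sub_msum N sub_pw zys sK)
    qed
    then show "\<forall>i. \<forall>u\<in>N \<boxplus> pw (z # ys) i (carrier M).
        a \<odot>\<^bsub>M\<^esub> u \<in> N \<boxplus> pw (z # ys) (Suc i) (carrier M) \<longrightarrow>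
        u \<in> N \<boxplus> pw (z # ys) i (colon (N \<boxplus> lmul (z # ys) (carrier M)) a)"
      unfolding K_def by blast
  qed
qed

text \<open>The binomial coefficient counts monomials of degree i in as many variables as
  \<open>ys\<close> has elements. Pascal's rule enters by dividing with z: multiples of z come from
  degree i - 1 in all variables, the rest is degree i in the remaining ones modulo zM.\<close>

lemma rlen_pw:
  assumes "sub N" "set ys \<subseteq> \<mm>" "reg_seq N ys" "sub K" "sub L" "N \<boxplus> lmul ys (carrier M) \<subseteq> K" "K \<subseteq> L"
  shows "rlen (N \<boxplus> pw ys i K) (N \<boxplus> pw ys i L) = enat ((i + length ys - 1) choose i) * rlen K L"
  using assms
proof (induction ys arbitrary: N i)
  case Nil
  have NK: "N \<subseteq> K" using Nil msum_upper1[OF Nil(1) sub_zero_set] by auto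
  show ?case
  proof (cases i)
    case 0
    have "N \<subseteq> L" using NK Nil(7) by (rule order_trans)
    then have "N \<boxplus> K = K" "N \<boxplus> L = L"
      using NK msum_absorb2[OF Nil(1,4)] msum_absorb2[OF Nil(1,5)] by simp_all
    then show ?thesis using 0 by (simp only: pw_0 binomial_n_0 enat_1 mult_1)
  next
    case (Suc j)
    \<comment> \<open>With no generators the truncated subtraction still gives the right count: 1 in
      degree 0, and 0 in every other degree.\<close>
    have "(i + length ([] :: 'a list) - 1) choose i = 0" using Suc by simp
    moreover have "pw [] i K = pw [] i L" using Suc by (simp add: pw_Suc)
    ultimately show ?thesis by (simp only: rlen_refl enat_0 mult_zero_left)
  qed
next
  case (Cons z ys)
  note M = carrier_is_submodule and N = Cons.prems(1) and K = Cons.prems(4) and L = Cons.prems(5)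
  have z: "z \<in> carrier R" and ys: "set ys \<subseteq> carrier R" using Cons.prems \<mm>_carrier by auto
  have zys: "set (z # ys) \<subseteq> carrier R" using z ys by simp
  have ysm: "set ys \<subseteq> \<mm>" using Cons.prems by simp
  have swap: "reg_seq (adj N z) ys" using reg_seq_swap[OF Cons.prems(1-3)] by simp
  have sA: "sub (adj N z)" using N z by (rule sub_adj)
  have qN: "quasi_reg N ys" using Cons.prems by (intro quasi_reg_if_reg_seq[OF N ysm]) simp
  have rz: "reg z (N \<boxplus> lmul ys (carrier M))" using Cons.prems by simp
  note star = colon_pw_Cons[OF N ys z qN rz]
  have bL: "N \<boxplus> lmul (z # ys) (carrier M) \<subseteq> L" using Cons.prems by blast
  show ?case
  proof (induction i)
    case 0
    have "N \<subseteq> K" "N \<subseteq> L"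
      using msum_upper1[OF N sub_lmul[OF zys M]] Cons.prems(6) bL by blast+
    then have "N \<boxplus> K = K" "N \<boxplus> L = L"
      using msum_absorb2[OF N K] msum_absorb2[OF N L] by simp_all
    then show ?case by (simp only: pw_0 binomial_n_0 enat_1 mult_1)
  next
    case (Suc i)
    define P where "P j A = N \<boxplus> pw (z # ys) j A" for j A
    have sP: "sub (P j K)" "sub (P j L)" for j
      unfolding P_def by (intro sub_msum N sub_pw zys K L)+
    have PKL: "P j K \<subseteq> P j L" for j
      unfolding P_def by (intro msum_mono order_refl pw_mono Cons.prems)
    have zP: "scale z (P i A) \<subseteq> P (Suc i) A" if A: "sub A" for A
    proof -
      have "scale z (P i A) = scale z N \<boxplus> scale z (pw (z # ys) i A)"
        unfolding P_def by (intro scale_msum z N sub_pw zys A)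
      also have "\<dots> \<subseteq> P (Suc i) A"
        unfolding P_def by (intro msum_mono scale_subset z N scale_pw_subset ys A)
      finally show ?thesis .
    qed
    define zM where "zM = scale z (carrier M)"
    have szM: "sub zM" unfolding zM_def using z M by (rule sub_scale)
    \<comment> \<open>D separates the two terms of Pascal's rule: below it lies what z contributes
      from degree i, above it what survives modulo zM.\<close>
    define D where "D = P (Suc i) K \<boxplus> zM"
    have sD: "sub D" unfolding D_def by (intro sub_msum sP szM)
    have P_zM: "P (Suc i) A \<boxplus> zM = adj N z \<boxplus> pw ys (Suc i) A" if A: "sub A" for A
    proof -
      define B C where "B = scale z (pw (z # ys) i A)" and "C = pw ys (Suc i) A"
      have s: "sub B" "sub C" unfolding B_def C_def by (intro sub_scale z sub_pw zys ys A)+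
      have "B \<subseteq> zM" unfolding B_def zM_def by (intro scale_mono sub_subset sub_pw zys A)
      then have "B \<boxplus> zM = zM" by (intro msum_absorb2 s szM)
      have "P (Suc i) A \<boxplus> zM = N \<boxplus> ((B \<boxplus> C) \<boxplus> zM)"
        unfolding P_def pw_Cons[OF z ys A] B_def[symmetric] C_def[symmetric]
        by (intro msum_assoc N sub_msum s szM)
      also have "(B \<boxplus> C) \<boxplus> zM = (B \<boxplus> zM) \<boxplus> C"
        using s szM by (simp add: msum_assoc msum_commute[of C zM])
      also have "N \<boxplus> \<dots> = (N \<boxplus> zM) \<boxplus> C" unfolding \<open>B \<boxplus> zM = zM\<close> by (rule msum_assoc[symmetric, OF N szM s(2)])
      finally show ?thesis unfolding zM_def C_def .
    qed
    have mid: "P (Suc i) L \<inter> D = scale z (P i L) \<boxplus> P (Suc i) K"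
    proof -
      have "P (Suc i) L \<inter> D = P (Suc i) K \<boxplus> (P (Suc i) L \<inter> zM)"
        unfolding D_def by (intro modular_law sP szM PKL)
      also have "P (Suc i) L \<inter> zM = scale z (P i L)"
      proof
        show "scale z (P i L) \<subseteq> P (Suc i) L \<inter> zM"
          using zP[OF L] scale_mono[OF sub_subset[OF sP(2)]] unfolding zM_def by blast
        show "P (Suc i) L \<inter> zM \<subseteq> scale z (P i L)"
        proof
          fix w assume w: "w \<in> P (Suc i) L \<inter> zM"
          then have "w \<in> zM" by simp
          then obtain u where u: "u \<in> carrier M" "w = z \<odot>\<^bsub>M\<^esub> u" unfolding zM_def by (rule scaleE)
          then have "u \<in> P i L" using star[OF L bL u(1), of i] w unfolding P_def by simp
          then show "w \<in> scale z (P i L)" unfolding u(2) by (rule scaleI)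
        qed
      qed
      finally show ?thesis using msum_commute[OF sP(1) sub_scale[OF z sP(2)]] by simp
    qed
    have "rlen (P (Suc i) K) (P (Suc i) L) =
        rlen (P (Suc i) K) (P (Suc i) L \<inter> D) + rlen (P (Suc i) L \<inter> D) (P (Suc i) L)"
    proof (rule rlen_additive)
      show "P (Suc i) K \<subseteq> P (Suc i) L \<inter> D"
        unfolding D_def using PKL msum_upper1[OF sP(1) szM] by blast
    qed (intro sub_Int sP sD Int_lower1)+
    also have "rlen (P (Suc i) L \<inter> D) (P (Suc i) L) = rlen D (P (Suc i) L \<boxplus> D)"
      by (rule rlen_second_iso[OF sP(2) sD])
    also have "P (Suc i) L \<boxplus> D = P (Suc i) L \<boxplus> zM"
    proof -
      have "P (Suc i) L \<boxplus> D = (P (Suc i) L \<boxplus> P (Suc i) K) \<boxplus> zM"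
        unfolding D_def by (rule msum_assoc[symmetric, OF sP(2,1) szM])
      then show ?thesis using msum_absorb1[OF sP(2,1) PKL] by simp
    qed
    also have "rlen D (P (Suc i) L \<boxplus> zM) = enat ((Suc i + length ys - 1) choose (Suc i)) * rlen K L"
      unfolding D_def P_zM[OF K] P_zM[OF L]
      by (rule Cons.IH[OF sA ysm swap K L _ Cons.prems(7)])
        (use Cons.prems(6) adj_lmul(1)[OF N z ys] in simp)
    also have "rlen (P (Suc i) K) (P (Suc i) L \<inter> D) = rlen (P i K) (P i L)"
    proof -
      have "rlen (scale z (P i K) \<boxplus> P (Suc i) K) (scale z (P i L) \<boxplus> P (Suc i) K) = rlen (P i K) (P i L)"
      proof (rule rlen_image_eq[OF z sP(2,1) sP(1) PKL], rule subsetI)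
        fix u assume "u \<in> P i L \<inter> colon (P (Suc i) K) z"
        then show "u \<in> P i K"
          using star[OF K Cons.prems(6), of u i] unfolding P_def by (auto simp: colon_def)
      qed
      moreover have "scale z (P i K) \<boxplus> P (Suc i) K = P (Suc i) K"
        by (intro msum_absorb2 sub_scale z sP zP K)
      ultimately show ?thesis unfolding mid by simp
    qed
    also have "rlen (P i K) (P i L) = enat ((i + length (z # ys) - 1) choose i) * rlen K L"
      using Suc unfolding P_def .
    also have "enat ((i + length (z # ys) - 1) choose i) * rlen K L +
        enat ((Suc i + length ys - 1) choose (Suc i)) * rlen K L =
        enat (((i + length (z # ys) - 1) choose i) + ((Suc i + length ys - 1) choose (Suc i))) * rlen K L"
      by (simp only: distrib_right plus_enat_simps(1)[symmetric])
    also have "((i + length (z # ys) - 1) choose i) + ((Suc i + length ys - 1) choose (Suc i)) =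
        (Suc i + length (z # ys) - 1) choose (Suc i)" by simp
    finally show ?case unfolding P_def .
  qed
qed

end

section \<open>Bounds for the Hilbert--Samuel function\<close>

context module
begin

lemma msum_left_commute:
  assumes "sub A" "sub B" "sub C"
  shows "A \<boxplus> (B \<boxplus> C) = B \<boxplus> (A \<boxplus> C)"
  unfolding msum_assoc[OF assms, symmetric] msum_commute[OF assms(1,2)]
  by (rule msum_assoc[OF assms(2,1,3)])

text \<open>The Euler characteristic \<open>rlen (xA + B) A - rlen B (A \<inter> (B : x))\<close> of multiplication by \<open>x\<close>
  on \<open>A/B\<close> is additive; both sides are moved so that no subtraction occurs.\<close>
lemma euler_additive:
  assumes s: "sub A" "sub B" "sub C" and le: "B \<subseteq> A" "A \<subseteq> C" and x: "x \<in> carrier R"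
  shows "rlen (scale x C \<boxplus> B) C + rlen A (C \<inter> colon A x) + rlen B (A \<inter> colon B x) =
      rlen (scale x C \<boxplus> A) C + rlen (scale x A \<boxplus> B) A + rlen B (C \<inter> colon B x)" (is ?eq)
    and "rlen B (C \<inter> colon B x) \<le> rlen B (A \<inter> colon B x) + rlen A (C \<inter> colon A x)" (is ?le)
proof -
  define E where "E = C \<inter> colon B x"
  have sx: "sub (scale x C)" "sub (scale x A)" "sub (colon A x)" "sub (colon B x)"
    by (intro sub_intros s x)+
  have sE: "sub E" unfolding E_def by (intro sub_Int s sx)
  have xC: "scale x C \<subseteq> C" by (intro scale_subset x s)
  have BC: "B \<subseteq> C" using le by blast
  have BE: "B \<subseteq> E" unfolding E_def using BC colon_upper[OF x s(2)] by blast
  \<comment> \<open>The snake lemma in terms of lengths: p belongs to the image of the cokernel on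
    A/B in that on C/B, q to the image of the connecting map, t to the image of the kernel on C/B in
    that on C/A.\<close>
  define p where "p = rlen (A \<inter> (scale x C \<boxplus> B)) A"
  define q where "q = rlen (scale x A \<boxplus> B) (A \<inter> (scale x C \<boxplus> B))"
  define t where "t = rlen (A \<inter> E) E"
  have 1: "rlen (scale x C \<boxplus> B) C = p + rlen (scale x C \<boxplus> A) C"
  proof -
    have "rlen (scale x C \<boxplus> B) C = rlen (scale x C \<boxplus> B) (scale x C \<boxplus> A) + rlen (scale x C \<boxplus> A) C"
      using le xC by (intro rlen_additive sub_msum s sx msum_mono msum_least order_refl)
    moreover have "rlen (scale x C \<boxplus> B) (scale x C \<boxplus> A) = p"
    proof -
      have "A \<boxplus> (scale x C \<boxplus> B) = scale x C \<boxplus> (A \<boxplus> B)" by (intro msum_left_commute s sx)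
      also have "A \<boxplus> B = A" by (intro msum_absorb1 s le)
      finally show ?thesis
        unfolding p_def using rlen_second_iso[OF s(1) sub_msum[OF sx(1) s(2)]] by simp
    qed
    ultimately show ?thesis by simp
  qed
  have 2: "rlen (scale x A \<boxplus> B) A = q + p"
    unfolding p_def q_def
  proof (rule rlen_additive)
    have "scale x A \<boxplus> B \<subseteq> scale x C \<boxplus> B" by (intro msum_mono scale_mono le order_refl)
    moreover have "scale x A \<boxplus> B \<subseteq> A" by (intro msum_least scale_subset s x le)
    ultimately show "scale x A \<boxplus> B \<subseteq> A \<inter> (scale x C \<boxplus> B)" by blast
  qed (intro sub_Int sub_msum s sx Int_lower1)+
  have AE: "A \<inter> E = A \<inter> colon B x" unfolding E_def using le by blast
  have 3: "rlen B E = rlen B (A \<inter> colon B x) + t"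
    unfolding t_def AE[symmetric]
    by (rule rlen_additive) (use le BE in \<open>auto intro: sub_Int s sE\<close>)
  have 4: "rlen A (C \<inter> colon A x) = t + q"
  proof -
    have EA: "E \<boxplus> A \<subseteq> C \<inter> colon A x"
      using le colon_mono[OF le(1), of x] colon_upper[OF x s(1)] unfolding E_def
      by (intro msum_least sub_Int s sx) blast+
    have "rlen A (C \<inter> colon A x) = rlen A (E \<boxplus> A) + rlen (E \<boxplus> A) (C \<inter> colon A x)"
      by (intro rlen_additive sub_Int sub_msum s sx sE msum_upper2 EA)
    also have "rlen A (E \<boxplus> A) = t"
      unfolding t_def using rlen_second_iso[OF sE s(1)] by (simp add: Int_commute)
    also have "rlen (E \<boxplus> A) (C \<inter> colon A x) =
        rlen (scale x (E \<boxplus> A) \<boxplus> B) (scale x (C \<inter> colon A x) \<boxplus> B)"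
    proof (rule rlen_image_eq[symmetric])
      show "C \<inter> colon A x \<inter> colon B x \<subseteq> E \<boxplus> A"
        using msum_upper1[OF sE s(1)] unfolding E_def by blast
    qed (intro x sub_Int sub_msum s sx sE EA)+
    also have "scale x (E \<boxplus> A) \<boxplus> B = scale x A \<boxplus> B"
    proof -
      have xE: "scale x E \<subseteq> B" unfolding E_def by (auto simp: scale_def colon_def)
      have sxE: "sub (scale x E)" by (intro sub_scale x sE)
      have "scale x (E \<boxplus> A) \<boxplus> B = (scale x A \<boxplus> scale x E) \<boxplus> B"
        using scale_msum[OF x sE s(1)] msum_commute[OF sxE sx(2)] by simp
      also have "\<dots> = scale x A \<boxplus> (scale x E \<boxplus> B)" by (intro msum_assoc sx sxE s)
      also have "scale x E \<boxplus> B = B" by (intro msum_absorb2 sxE s xE)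
      finally show ?thesis .
    qed
    also have "scale x (C \<inter> colon A x) \<boxplus> B = A \<inter> (scale x C \<boxplus> B)"
    proof -
      have "scale x (C \<inter> colon A x) = A \<inter> scale x C"
        using sub_subset[OF s(3)] by (auto simp: scale_def colon_def)
      then have "scale x (C \<inter> colon A x) \<boxplus> B = B \<boxplus> (A \<inter> scale x C)"
        using msum_commute[OF s(2) sub_Int[OF s(1) sx(1)]] by simp
      also have "\<dots> = A \<inter> (B \<boxplus> scale x C)" by (intro modular_law[symmetric] s sx le)
      finally show ?thesis using msum_commute[OF s(2) sx(1)] by simp
    qed
    finally show ?thesis unfolding q_def .
  qed
  show ?eq unfolding 1 2 4 3[unfolded E_def] by (simp add: ac_simps)
  show ?le unfolding 4 3[unfolded E_def] by (simp add: add_left_mono)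
qed

lemma rlen_filtration:
  assumes "\<And>i. sub (D i)" "\<And>i. D (Suc i) \<subseteq> D i"
  shows "rlen (D n) (D 0) = (\<Sum>i<n. rlen (D (Suc i)) (D i))"
proof (induction n)
  case 0
  then show ?case by (simp add: rlen_refl)
next
  case (Suc n)
  have "D n \<subseteq> D 0" using lift_Suc_antimono_le[of D 0 n, OF assms(2)] by simp
  then have "rlen (D (Suc n)) (D 0) = rlen (D (Suc n)) (D n) + rlen (D n) (D 0)"
    by (intro rlen_additive assms)
  then show ?case using Suc by (simp add: add.commute)
qed

end

text \<open>Counts monomials of degree at most n in r variables. For r = 0 the summand is 1 at i = 0
  and 0 afterwards, so the case d = 1 is included.\<close>

lemma sum_choose_diag: "(\<Sum>i<Suc n. (i + r - 1) choose i) = (n + r) choose r"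
proof (induction n)
  case 0
  then show ?case by simp
next
  case (Suc n)
  have "(\<Sum>i<Suc (Suc n). (i + r - 1) choose i) = ((n + r) choose r) + ((n + r) choose (Suc n))"
    using Suc by simp
  also have "(n + r) choose r = (n + r) choose n"
    using binomial_symmetric[of r "n + r"] by simp
  also have "((n + r) choose n) + ((n + r) choose (Suc n)) = Suc (n + r) choose Suc n" by simp
  also have "\<dots> = (Suc n + r) choose r" using binomial_symmetric[of "Suc n" "Suc n + r"] by simp
  finally show ?case .
qed

lemma sum_choose_diag2:
  "(\<Sum>j\<le>Suc n. \<Sum>i<j. (i + r - 1) choose i) = (n + Suc r) choose Suc r"
proof (induction n)
  case 0
  then show ?case by simp
next
  case (Suc n)
  have "(\<Sum>j\<le>Suc (Suc n). \<Sum>i<j. (i + r - 1) choose i) =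
      ((n + Suc r) choose Suc r) + (\<Sum>i<Suc (Suc n). (i + r - 1) choose i)"
    unfolding sum.atMost_Suc[of _ "Suc n"] Suc ..
  also have "\<dots> = (Suc n + Suc r) choose Suc r"
    unfolding sum_choose_diag by simp
  finally show ?case .
qed

text \<open>Summation by parts: \<open>c i\<close> is counted once for each j with i < j \<le>
  n.\<close>

lemma sum_weighted:
  fixes c :: "nat \<Rightarrow> nat"
  shows "(\<Sum>i<n. c i * (n - i)) = (\<Sum>j\<le>n. \<Sum>i<j. c i)"
proof (induction n)
  case (Suc n)
  have "(\<Sum>i<Suc n. c i * (Suc n - i)) = (\<Sum>i<Suc n. c i * (n - i) + c i)"
    by (rule sum.cong) (auto simp: Suc_diff_le)
  also have "\<dots> = (\<Sum>i<n. c i * (n - i)) + (\<Sum>i<Suc n. c i)"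
    by (simp add: sum.distrib)
  finally show ?case using Suc by simp
qed simp

context noetherian_local_module
begin

lemma zero_msum [simp]: "sub A \<Longrightarrow> {\<zero>\<^bsub>M\<^esub>} \<boxplus> A = A"
  using msum_absorb2[OF sub_zero_set] sub_zero by auto

section \<open>Multiplication by x modulo powers of y and of J\<close>

context
  fixes x ys
  assumes x: "x \<in> \<mm>" and ys: "set ys \<subseteq> \<mm>" and rs: "reg_seq {\<zero>\<^bsub>M\<^esub>} ys"
    and fin: "rlen (lmul (x # ys) (carrier M)) (carrier M) < \<infinity>"
begin

lemma x_carrier: "x \<in> carrier R" and ys_carrier: "set ys \<subseteq> carrier R" and x_ys_carrier: "set (x # ys) \<subseteq> carrier R"
  using x ys \<mm>_carrier by auto

abbreviation (input) "ysM \<equiv> \<lambda>i. pw ys i (carrier M)"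
abbreviation (input) "JM \<equiv> \<lambda>i. pw (x # ys) i (carrier M)"

lemma sub_ysM: "sub (ysM i)" and sub_JM: "sub (JM i)"
  by (intro sub_pw ys_carrier x_ys_carrier carrier_is_submodule)+

lemma ysM_Suc_le: "ysM (Suc i) \<subseteq> ysM i" and JM_Suc_le: "JM (Suc i) \<subseteq> JM i"
  by (intro pw_antimono ys_carrier x_ys_carrier carrier_is_submodule le_SucI order_refl)+

lemma ysM_le_JM: "ysM i \<subseteq> JM i"
  by (intro pw_Cons_superset x_carrier ys_carrier carrier_is_submodule)

lemma JM_Suc: "JM (Suc i) = scale x (JM i) \<boxplus> ysM (Suc i)"
  by (intro pw_Cons x_carrier ys_carrier carrier_is_submodule)

lemma ysM_1: "ysM (Suc 0) = lmul ys (carrier M)"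
  by (simp add: pw_Suc)

lemma pw_ysM_1: "pw ys i (ysM (Suc 0)) = ysM (Suc i)"
  unfolding ysM_1 by (rule pw_Suc'[symmetric])

lemma rlen_pw0:
  assumes "sub K" "sub L" "ysM (Suc 0) \<subseteq> K" "K \<subseteq> L"
  shows "rlen (pw ys i K) (pw ys i L) = enat ((i + length ys - 1) choose i) * rlen K L"
proof -
  have "{\<zero>\<^bsub>M\<^esub>} \<boxplus> lmul ys (carrier M) \<subseteq> K"
    using assms(3) sub_ysM[of "Suc 0"] by (simp add: ysM_1)
  from rlen_pw[OF sub_zero_set ys rs assms(1,2) this assms(4)] show ?thesis
    using assms(1,2) by (simp add: sub_pw ys_carrier)
qed

text \<open>The module U of the kernel U/yM of \<open>x\<close> on M/yM; its length over yM is the h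
  of the overview.\<close>

definition "xtors = colon (ysM (Suc 0)) x"

lemma sub_xtors: "sub xtors"
  unfolding xtors_def by (intro sub_colon x_carrier sub_ysM)

lemma ysM_1_le_xtors: "ysM (Suc 0) \<subseteq> xtors"
  unfolding xtors_def by (intro colon_upper x_carrier sub_ysM)

text \<open>On the degree n part of the associated graded module along y, the kernel of
  \<open>x\<close> is generated by its kernel in degree 0. One inclusion is linearity, the other
  quasi-regularity.\<close>

lemma pw_xtors: "pw ys n xtors = ysM n \<inter> colon (ysM (Suc n)) x"
proof
  have "scale x (pw ys n xtors) = pw ys n (scale x xtors)" by (rule pw_scale[symmetric, OF ys_carrier x_carrier sub_xtors])
  also have "\<dots> \<subseteq> pw ys n (ysM (Suc 0))" by (intro pw_mono) (auto simp: xtors_def scale_def colon_def)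
  finally have "scale x (pw ys n xtors) \<subseteq> ysM (Suc n)" unfolding pw_ysM_1 .
  then have "pw ys n xtors \<subseteq> colon (ysM (Suc n)) x"
    using sub_carrier[OF sub_pw[OF ys_carrier sub_xtors]] by (auto simp: scale_def colon_def)
  moreover have "pw ys n xtors \<subseteq> ysM n" by (intro pw_mono sub_subset sub_xtors)
  ultimately show "pw ys n xtors \<subseteq> ysM n \<inter> colon (ysM (Suc n)) x" by blast
  show "ysM n \<inter> colon (ysM (Suc n)) x \<subseteq> pw ys n xtors"
  proof
    fix u assume u: "u \<in> ysM n \<inter> colon (ysM (Suc n)) x"
    have "quasi_reg {\<zero>\<^bsub>M\<^esub>} ys" by (rule quasi_reg_if_reg_seq[OF sub_zero_set ys rs])
    moreover have "u \<in> {\<zero>\<^bsub>M\<^esub>} \<boxplus> ysM n" "x \<odot>\<^bsub>M\<^esub> u \<in> {\<zero>\<^bsub>M\<^esub>} \<boxplus> ysM (Suc n)"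
      using u sub_ysM by (auto simp: colon_def)
    ultimately have "u \<in> {\<zero>\<^bsub>M\<^esub>} \<boxplus> pw ys n (colon ({\<zero>\<^bsub>M\<^esub>} \<boxplus> lmul ys (carrier M)) x)"
      unfolding quasi_reg_def using x_carrier by blast
    then show "u \<in> pw ys n xtors"
      using sub_ysM[of "Suc 0"] sub_pw[OF ys_carrier sub_xtors] by (simp add: xtors_def ysM_1)
  qed
qed

text \<open>This is x^k M + yM, the preimage of the image of x^k on M/yM.\<close>

primrec xpow where
  "xpow 0 = carrier M"
| "xpow (Suc k) = scale x (xpow k) \<boxplus> ysM (Suc 0)"

lemma sub_xpow: "sub (xpow k)"
  by (induction k) (auto intro!: sub_intros sub_ysM x_carrier)

lemma ysM_1_le_xpow: "ysM (Suc 0) \<subseteq> xpow k"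
proof (cases k)
  case 0
  then show ?thesis using sub_subset[OF sub_ysM] by simp
next
  case (Suc j)
  then show ?thesis using msum_upper2[OF sub_scale[OF x_carrier sub_xpow] sub_ysM] by simp
qed

lemma xpow_1: "xpow (Suc 0) = lmul (x # ys) (carrier M)"
  by (simp add: ysM_1)

lemma xpow_Suc_le_xpow_1: "xpow (Suc k) \<subseteq> xpow (Suc 0)"
  by (simp add: msum_mono scale_mono sub_subset[OF sub_xpow])

text \<open>Multiplication by \<open>x\<close> maps M/(x^k M + yM) onto (xM + yM)/(x^(k+1) M + yM),
  and its kernel is isomorphic to U/(U \<inter> (x^k M + yM)).\<close>

lemma rlen_xpow_Suc:
  "rlen (xpow (Suc k)) (carrier M) + rlen (xtors \<inter> xpow k) xtors = rlen (xpow (Suc 0)) (carrier M) + rlen (xpow k) (carrier M)"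
proof -
  note M = carrier_is_submodule
  have sAU: "sub (xpow k \<boxplus> xtors)" by (intro sub_msum sub_xpow sub_xtors)
  have xU: "scale x xtors \<subseteq> ysM (Suc 0)" by (auto simp: xtors_def scale_def colon_def)
  have "scale x (xpow k \<boxplus> xtors) \<boxplus> ysM (Suc 0) = scale x (xpow k) \<boxplus> (scale x xtors \<boxplus> ysM (Suc 0))"
    using scale_msum[OF x_carrier sub_xpow sub_xtors] by (simp add: msum_assoc sub_scale x_carrier sub_xpow sub_xtors sub_ysM)
  also have "scale x xtors \<boxplus> ysM (Suc 0) = ysM (Suc 0)"
    by (intro msum_absorb2 sub_scale x_carrier sub_xtors sub_ysM xU)
  finally have AU: "scale x (xpow k \<boxplus> xtors) \<boxplus> ysM (Suc 0) = xpow (Suc k)" by simp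
  have "rlen (xpow (Suc k)) (carrier M) = rlen (xpow (Suc k)) (xpow (Suc 0)) + rlen (xpow (Suc 0)) (carrier M)"
    by (intro rlen_additive sub_xpow M xpow_Suc_le_xpow_1 sub_subset)
  also have "rlen (xpow (Suc k)) (xpow (Suc 0)) = rlen (xpow k \<boxplus> xtors) (carrier M)"
  proof -
    have "rlen (scale x (xpow k \<boxplus> xtors) \<boxplus> ysM (Suc 0)) (scale x (carrier M) \<boxplus> ysM (Suc 0)) =
        rlen (xpow k \<boxplus> xtors) (carrier M)"
    proof (rule rlen_image_eq[OF x_carrier M sAU sub_ysM sub_subset[OF sAU]])
      show "carrier M \<inter> colon (ysM (Suc 0)) x \<subseteq> xpow k \<boxplus> xtors"
        using msum_upper2[OF sub_xpow sub_xtors] by (auto simp: xtors_def)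
    qed
    then show ?thesis unfolding AU by simp
  qed
  finally have 1: "rlen (xpow (Suc k)) (carrier M) = rlen (xpow k \<boxplus> xtors) (carrier M) + rlen (xpow (Suc 0)) (carrier M)" .
  have 2: "rlen (xpow k) (carrier M) = rlen (xpow k) (xpow k \<boxplus> xtors) + rlen (xpow k \<boxplus> xtors) (carrier M)"
    by (intro rlen_additive sub_xpow sAU M msum_upper1 sub_xtors sub_subset)
  have 3: "rlen (xtors \<inter> xpow k) xtors = rlen (xpow k) (xpow k \<boxplus> xtors)"
    using rlen_second_iso[OF sub_xtors sub_xpow] msum_commute[OF sub_xtors sub_xpow] by simp
  show ?thesis unfolding 1 2 3 by (simp add: ac_simps)
qed

text \<open>Fitting's argument: let the chain (yM : x^j) be stationary from k on. If x^k v is killed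
  by \<open>x\<close> modulo yM, then v lies in (yM : x^(k+1)) = (yM : x^k), so x^k v is in
  yM.\<close>

lemma xtors_inter_xpow: "\<exists>c. \<forall>k\<ge>c. xtors \<inter> xpow k = ysM (Suc 0)"
proof -
  define V where "V j = ((\<lambda>K. colon K x) ^^ j) (ysM (Suc 0))" for j
  have V_Suc: "V (Suc j) = colon (V j) x" for j by (simp add: V_def)
  have sV: "sub (V j)" for j
  proof (induction j)
    case 0
    then show ?case using sub_ysM[of "Suc 0"] by (simp add: V_def)
  next
    case (Suc j)
    then show ?case unfolding V_Suc by (rule sub_colon[OF x_carrier])
  qed
  have mono: "V j \<subseteq> V (Suc j)" for j unfolding V_Suc by (intro colon_upper x_carrier sV)
  obtain c where c: "\<forall>k\<ge>c. V k = V c" using acc[of V, OF sV mono] by blast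
  have YV: "ysM (Suc 0) \<subseteq> V j" for j
  proof (induction j)
    case 0
    then show ?case by (simp add: V_def)
  next
    case (Suc j)
    then show ?case using mono[of j] by blast
  qed
  \<comment> \<open>The offset j makes the induction work: dividing by \<open>x\<close> lowers k by
    one and raises j by one, leaving k + j fixed.\<close>
  have key: "V (k + j) = V (Suc (k + j)) \<Longrightarrow> xpow k \<inter> V (Suc j) \<subseteq> V j" for k j
  proof (induction k arbitrary: j)
    case 0
    then show ?case by simp
  next
    case (Suc k)
    show ?case
    proof
      fix w assume w: "w \<in> xpow (Suc k) \<inter> V (Suc j)"
      then obtain v y where vy: "v \<in> xpow k" "y \<in> ysM (Suc 0)" "w = x \<odot>\<^bsub>M\<^esub> v \<oplus>\<^bsub>M\<^esub> y"
        by (auto elim!: msumE scaleE)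
      have c: "v \<in> carrier M" "y \<in> carrier M" using vy sub_carrier sub_xpow sub_ysM by blast+
      have y: "y \<in> V j" "y \<in> V (Suc j)" using vy(2) YV by blast+
      have "y \<oplus>\<^bsub>M\<^esub> x \<odot>\<^bsub>M\<^esub> v \<in> V (Suc j)" using w vy(3) c x_carrier by (simp add: M.a_comm)
      then have "x \<odot>\<^bsub>M\<^esub> v \<in> V (Suc j)" using sub_add_cancel[OF sV y(2)] c x_carrier by simp
      then have "v \<in> xpow k \<inter> V (Suc (Suc j))" unfolding V_Suc[of "Suc j"] using c vy by (simp add: colon_def)
      moreover have "xpow k \<inter> V (Suc (Suc j)) \<subseteq> V (Suc j)" by (rule Suc.IH) (use Suc.prems in simp)
      ultimately have "v \<in> V (Suc j)" by blast
      then have "x \<odot>\<^bsub>M\<^esub> v \<in> V j" by (simp add: V_Suc colon_def)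
      then show "w \<in> V j" unfolding vy(3) using y(1) by (rule sub_add[OF sV])
    qed
  qed
  have "xtors \<inter> xpow k = ysM (Suc 0)" if k: "k \<ge> c" for k
  proof -
    have "V k = V (Suc k)" using c k by (metis le_SucI)
    then have "xpow k \<inter> V (Suc 0) \<subseteq> V 0" using key[of k 0] by simp
    then have "xtors \<inter> xpow k \<subseteq> ysM (Suc 0)" by (auto simp: V_def xtors_def)
    then show ?thesis using ysM_1_le_xtors ysM_1_le_xpow by blast
  qed
  then show ?thesis by blast
qed

text \<open>From the index c on at which U \<inter> (x^k M + yM) has become yM, each step adds
  exactly l - h to the length; before, it adds at most l. The excess from the first c steps is at
  most h * c, which serves as e.\<close>

lemma length_xpow_bound:
  "\<exists>l h e m. rlen (xpow (Suc 0)) (carrier M) = enat l \<and> rlen (ysM (Suc 0)) xtors = enat h \<and>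
     (\<forall>k. rlen (xpow k) (carrier M) = enat (m k) \<and> m k + h * k \<le> l * k + e)"
proof -
  obtain l where l: "rlen (xpow (Suc 0)) (carrier M) = enat l"
    using fin unfolding xpow_1 by (cases "rlen (lmul (x # ys) (carrier M)) (carrier M)") auto
  have "\<exists>m. rlen (xpow k) (carrier M) = enat m \<and> m \<le> l * k" for k
  proof (induction k)
    case 0
    then show ?case by (simp add: rlen_refl enat_0)
  next
    case (Suc k)
    then obtain m where m: "rlen (xpow k) (carrier M) = enat m" "m \<le> l * k" by blast
    have eq: "rlen (xpow (Suc k)) (carrier M) + rlen (xtors \<inter> xpow k) xtors = enat (l + m)"
      unfolding rlen_xpow_Suc l m(1) by simp
    then obtain m' where m': "rlen (xpow (Suc k)) (carrier M) = enat m'"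
      by (cases "rlen (xpow (Suc k)) (carrier M)") auto
    have "enat m' \<le> enat (l + m)" unfolding m'[symmetric] eq[symmetric] by simp
    then show ?case using m' m(2) by auto
  qed
  then obtain m where m: "\<And>k. rlen (xpow k) (carrier M) = enat (m k)" "\<And>k. m k \<le> l * k" by metis
  have lm: "m (Suc 0) = l" using l m(1)[of "Suc 0"] by simp
  obtain c where c: "\<forall>k\<ge>c. xtors \<inter> xpow k = ysM (Suc 0)" using xtors_inter_xpow by blast
  have Uc: "xtors \<inter> xpow k = ysM (Suc 0)" if "k \<ge> c" for k using c that by blast
  \<comment> \<open>At k = c the recursion contains the full length of U/yM next to a finite total,
    so h is finite.\<close>
  have "enat (m (Suc c)) + rlen (ysM (Suc 0)) xtors = enat (l + m c)"
    using rlen_xpow_Suc[of c] unfolding m(1) Uc[OF order_refl] plus_enat_simps lm .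
  then obtain h where h: "rlen (ysM (Suc 0)) xtors = enat h" by (cases "rlen (ysM (Suc 0)) xtors") auto
  have rec: "m (Suc k) + h = l + m k" if "k \<ge> c" for k
    using rlen_xpow_Suc[of k] unfolding m(1) Uc[OF that] h plus_enat_simps enat.inject lm .
  have "m k + h * k \<le> l * k + h * c" for k
  proof (cases "k \<le> c")
    case True
    then show ?thesis using m(2)[of k] by (intro add_mono mult_le_mono) auto
  next
    case False
    then have "c \<le> k" by simp
    then show ?thesis
    proof (induction k rule: dec_induct)
      case base
      then show ?case using m(2)[of c] by simp
    next
      case (step k)
      then show ?case using rec[of k] by simp
    qed
  qed
  then show ?thesis using l h m(1) by blast
qed

text \<open>Up to y^(i+1) M only x^k matters in the inner factor, and y^i x^k lies in J^(i+k). This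
  controls the layers of M/J^n M filtered by powers of y.\<close>

lemma pw_xpow_le: "pw ys i (xpow k) \<subseteq> JM (i + k) \<boxplus> ysM (Suc i)"
proof (induction k)
  case 0
  show ?case using ysM_le_JM msum_upper1[OF sub_JM sub_ysM] by fastforce
next
  case (Suc k)
  have "pw ys i (xpow (Suc k)) = scale x (pw ys i (xpow k)) \<boxplus> ysM (Suc i)"
    unfolding xpow.simps pw_msum[OF ys_carrier sub_scale[OF x_carrier sub_xpow] sub_ysM] pw_scale[OF ys_carrier x_carrier sub_xpow] pw_ysM_1 ..
  also have "\<dots> \<subseteq> JM (i + Suc k) \<boxplus> ysM (Suc i)"
  proof (intro msum_least sub_msum sub_JM sub_ysM msum_upper2)
    have "scale x (pw ys i (xpow k)) \<subseteq> scale x (JM (i + k) \<boxplus> ysM (Suc i))" by (rule scale_mono[OF Suc])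
    also have "\<dots> = scale x (JM (i + k)) \<boxplus> scale x (ysM (Suc i))"
      by (intro scale_msum x_carrier sub_JM sub_ysM)
    also have "\<dots> \<subseteq> JM (i + Suc k) \<boxplus> ysM (Suc i)"
    proof (intro msum_mono scale_subset x_carrier sub_ysM)
      show "scale x (JM (i + k)) \<subseteq> JM (i + Suc k)"
        using scale_pw_subset[OF x_carrier ys_carrier carrier_is_submodule, of "i + k"] by simp
    qed
    finally show "scale x (pw ys i (xpow k)) \<subseteq> JM (i + Suc k) \<boxplus> ysM (Suc i)" .
  qed
  finally show ?case .
qed

text \<open>Filter M/J^n M by J^n M + y^i M, which reaches J^n M at i = n. The layer at i is a
  quotient of y^i M/y^i (x^(n-i) M + yM), whose length is known from the count of monomials.\<close>

lemma rlen_JM_le: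
  "rlen (JM n) (carrier M) \<le> (\<Sum>i<n. enat ((i + length ys - 1) choose i) * rlen (xpow (n - i)) (carrier M))"
proof -
  note M = carrier_is_submodule
  define D where "D i = JM n \<boxplus> ysM i" for i
  have sD: "sub (D i)" for i unfolding D_def by (intro sub_msum sub_JM sub_ysM)
  have D_le: "D (Suc i) \<subseteq> D i" for i unfolding D_def by (intro msum_mono order_refl ysM_Suc_le)
  have D0: "D 0 = carrier M" unfolding D_def using msum_absorb2[OF sub_JM M sub_subset[OF sub_JM]] by simp
  have Dn: "D n = JM n" unfolding D_def by (intro msum_absorb1 sub_JM sub_ysM ysM_le_JM)
  have "rlen (JM n) (carrier M) = (\<Sum>i<n. rlen (D (Suc i)) (D i))"
    using rlen_filtration[of D n, OF sD D_le] unfolding D0 Dn .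
  also have "\<dots> \<le> (\<Sum>i<n. enat ((i + length ys - 1) choose i) * rlen (xpow (n - i)) (carrier M))"
  proof (rule sum_mono)
    fix i assume "i \<in> {..<n}"
    then have i: "i + (n - i) = n" by simp
    define B where "B = pw ys i (xpow (n - i))"
    have sB: "sub B" unfolding B_def by (intro sub_pw ys_carrier sub_xpow)
    have "B \<subseteq> D (Suc i)" using pw_xpow_le[of i "n - i"] unfolding i B_def D_def .
    then have 1: "B \<boxplus> D (Suc i) = D (Suc i)" by (intro msum_absorb2 sB sD)
    have "ysM i \<boxplus> D (Suc i) = JM n \<boxplus> (ysM i \<boxplus> ysM (Suc i))"
      unfolding D_def by (intro msum_left_commute sub_JM sub_ysM)
    also have "ysM i \<boxplus> ysM (Suc i) = ysM i" by (intro msum_absorb1 sub_ysM ysM_Suc_le)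
    finally have 2: "ysM i \<boxplus> D (Suc i) = D i" unfolding D_def .
    have "rlen (D (Suc i)) (D i) \<le> rlen B (ysM i)"
    proof -
      have "B \<subseteq> ysM i" unfolding B_def by (intro pw_mono sub_subset sub_xpow)
      from rlen_msum_le[OF sub_ysM sB sD this, of "Suc i"] show ?thesis unfolding 1 2 .
    qed
    also have "\<dots> = enat ((i + length ys - 1) choose i) * rlen (xpow (n - i)) (carrier M)"
      unfolding B_def by (intro rlen_pw0 sub_xpow M ysM_1_le_xpow sub_subset)
    finally show "rlen (D (Suc i)) (D i) \<le> enat ((i + length ys - 1) choose i) * rlen (xpow (n - i)) (carrier M)" .
  qed
  finally show ?thesis .
qed

text \<open>The Euler characteristic of \<open>x\<close> on M/y^n M, with cokernel length a and
  kernel length b. Each layer y^i M/y^(i+1) M contributes l - h times the number of monomials of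
  degree i.\<close>

lemma rlen_ysM_euler:
  assumes l: "rlen (xpow (Suc 0)) (carrier M) = enat l" and h: "rlen (ysM (Suc 0)) xtors = enat h"
  shows "\<exists>a b. rlen (scale x (carrier M) \<boxplus> ysM n) (carrier M) = enat a \<and>
    rlen (ysM n) (colon (ysM n) x) = enat b \<and>
    a + h * (\<Sum>i<n. (i + length ys - 1) choose i) = l * (\<Sum>i<n. (i + length ys - 1) choose i) + b"
proof (induction n)
  case 0
  have "scale x (carrier M) \<boxplus> carrier M = carrier M"
    by (intro msum_absorb2 sub_scale carrier_is_submodule scale_subset x_carrier)
  moreover have "colon (carrier M) x = carrier M" using x_carrier by (auto simp: colon_def)
  ultimately show ?case by (simp add: rlen_refl zero_enat_def)
next
  case (Suc n)
  note M = carrier_is_submodule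
  let ?c = "(n + length ys - 1) choose n"
  obtain a b where ab: "rlen (scale x (carrier M) \<boxplus> ysM n) (carrier M) = enat a"
    "rlen (ysM n) (colon (ysM n) x) = enat b"
    "a + h * (\<Sum>i<n. (i + length ys - 1) choose i) = l * (\<Sum>i<n. (i + length ys - 1) choose i) + b"
    using Suc by blast
  have CM: "carrier M \<inter> colon K x = colon K x" for K by (auto simp: colon_def)
  have ker: "rlen (ysM (Suc n)) (ysM n \<inter> colon (ysM (Suc n)) x) = enat (?c * h)"
    using rlen_pw0[OF sub_ysM sub_xtors order_refl ysM_1_le_xtors, of n] unfolding pw_xtors pw_ysM_1 h by simp
  have cok: "rlen (scale x (ysM n) \<boxplus> ysM (Suc n)) (ysM n) = enat (?c * l)"
  proof -
    have "pw ys n (xpow (Suc 0)) = scale x (ysM n) \<boxplus> ysM (Suc n)"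
      unfolding xpow.simps pw_msum[OF ys_carrier sub_scale[OF x_carrier M] sub_ysM] pw_scale[OF ys_carrier x_carrier M] pw_ysM_1 ..
    then show ?thesis
      using rlen_pw0[OF sub_xpow M ysM_1_le_xpow sub_subset[OF sub_xpow], of n "Suc 0"] unfolding l by simp
  qed
  note e = euler_additive[OF sub_ysM sub_ysM M ysM_Suc_le sub_subset[OF sub_ysM] x_carrier, of n, unfolded CM ab ker cok]
  \<comment> \<open>The kernel is bounded first, by the subadditivity in
    \<open>euler_additive\<close>; only then does its equation show that the cokernel is
    finite.\<close>
  obtain b' where b': "rlen (ysM (Suc n)) (colon (ysM (Suc n)) x) = enat b'"
    using e(2) by (cases "rlen (ysM (Suc n)) (colon (ysM (Suc n)) x)") auto
  obtain a' where a': "rlen (scale x (carrier M) \<boxplus> ysM (Suc n)) (carrier M) = enat a'"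
    using e(1) unfolding b' by (cases "rlen (scale x (carrier M) \<boxplus> ysM (Suc n)) (carrier M)") auto
  have "a' + b + ?c * h = a + ?c * l + b'" using e(1) unfolding a' b' by simp
  then have "a' + h * (\<Sum>i<Suc n. (i + length ys - 1) choose i) =
      l * (\<Sum>i<Suc n. (i + length ys - 1) choose i) + b'"
    using ab(3) by (simp add: algebra_simps)
  then show ?case using a' b' by blast
qed

text \<open>For \<open>x\<close> from M/J^n M to M/J^(n+1) M, f is the length of the kernel and r
  that of the image. The kernel of \<open>x\<close> on M/y^(n+1) M splits into f and the part w
  inside J^n M. The lower bound on w is the source of the strict sign of e_1: y^n U is contained in
  that part. Named summands replace subtraction.\<close>

lemma rlen_JM_Suc:
  "\<exists>f r w. rlen (JM (Suc n)) (carrier M) = r + rlen (scale x (carrier M) \<boxplus> ysM (Suc n)) (carrier M) \<and>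
     rlen (JM n) (carrier M) = f + r \<and> rlen (ysM (Suc n)) (colon (ysM (Suc n)) x) = w + f \<and>
     enat ((n + length ys - 1) choose n) * rlen (ysM (Suc 0)) xtors \<le> w"
proof -
  note M = carrier_is_submodule
  define V where "V = colon (ysM (Suc n)) x"
  have sV: "sub V" unfolding V_def by (intro sub_colon x_carrier sub_ysM)
  have sxM: "sub (scale x (carrier M))" by (intro sub_scale x_carrier M)
  define W where "W = colon (JM (Suc n)) x"
  have sW: "sub W" unfolding W_def by (intro sub_colon x_carrier sub_JM)
  \<comment> \<open>As J^(n+1) M = x J^n M + y^(n+1) M, dividing by \<open>x\<close> gives J^n M
    back, plus (y^(n+1) M : x).\<close>
  have W: "W = JM n \<boxplus> V" unfolding W_def V_def JM_Suc by (intro colon_scale_msum x_carrier sub_JM sub_ysM)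
  have YF: "ysM (Suc n) \<subseteq> JM n" using ysM_Suc_le ysM_le_JM by blast
  have YV: "ysM (Suc n) \<subseteq> V" unfolding V_def by (intro colon_upper x_carrier sub_ysM)
  have "rlen (JM (Suc n)) (carrier M) =
      rlen (JM (Suc n)) (scale x (carrier M) \<boxplus> JM (Suc n)) + rlen (scale x (carrier M) \<boxplus> JM (Suc n)) (carrier M)"
    by (intro rlen_additive sub_JM sub_msum sxM M msum_upper2 sub_subset)
  moreover have "rlen (JM (Suc n)) (scale x (carrier M) \<boxplus> JM (Suc n)) = rlen W (carrier M)"
  proof -
    have "rlen (scale x W \<boxplus> JM (Suc n)) (scale x (carrier M) \<boxplus> JM (Suc n)) = rlen W (carrier M)"
      by (rule rlen_image_eq[OF x_carrier M sW sub_JM sub_subset[OF sW]]) (simp add: W_def)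
    moreover have "scale x W \<boxplus> JM (Suc n) = JM (Suc n)"
      by (intro msum_absorb2 sub_scale x_carrier sW sub_JM) (auto simp: W_def scale_def colon_def)
    ultimately show ?thesis by simp
  qed
  moreover have "scale x (carrier M) \<boxplus> JM (Suc n) = scale x (carrier M) \<boxplus> ysM (Suc n)"
  proof -
    have "scale x (carrier M) \<boxplus> JM (Suc n) = (scale x (carrier M) \<boxplus> scale x (JM n)) \<boxplus> ysM (Suc n)"
      unfolding JM_Suc by (intro msum_assoc[symmetric] sxM sub_scale x_carrier sub_JM sub_ysM)
    also have "scale x (carrier M) \<boxplus> scale x (JM n) = scale x (carrier M)"
      by (intro msum_absorb1 sxM sub_scale x_carrier sub_JM scale_mono sub_subset)
    finally show ?thesis .
  qed
  ultimately have 1: "rlen (JM (Suc n)) (carrier M) =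
      rlen W (carrier M) + rlen (scale x (carrier M) \<boxplus> ysM (Suc n)) (carrier M)" by simp
  have 2: "rlen (JM n) (carrier M) = rlen (JM n) W + rlen W (carrier M)"
    unfolding W by (intro rlen_additive sub_JM sub_msum sV M msum_upper1 sub_subset)
  have "rlen (ysM (Suc n)) V = rlen (ysM (Suc n)) (V \<inter> JM n) + rlen (V \<inter> JM n) V"
    using YF YV by (intro rlen_additive sub_Int sV sub_JM sub_ysM) auto
  also have "rlen (V \<inter> JM n) V = rlen (JM n) W"
    unfolding W using rlen_second_iso[OF sV sub_JM] msum_commute[OF sV sub_JM] by simp
  finally have 3: "rlen (ysM (Suc n)) V = rlen (ysM (Suc n)) (V \<inter> JM n) + rlen (JM n) W" .
  have "enat ((n + length ys - 1) choose n) * rlen (ysM (Suc 0)) xtors = rlen (ysM (Suc n)) (pw ys n xtors)"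
    using rlen_pw0[OF sub_ysM sub_xtors order_refl ysM_1_le_xtors, of n] unfolding pw_ysM_1 by simp
  also have "\<dots> \<le> rlen (ysM (Suc n)) (V \<inter> JM n)"
  proof (rule rlen_mono_top[OF sub_pw[OF ys_carrier sub_xtors] sub_ysM])
    show "sub (V \<inter> JM n)" by (intro sub_Int sV sub_JM)
    show "ysM (Suc n) \<subseteq> pw ys n xtors" using pw_mono[OF ysM_1_le_xtors, of ys n] unfolding pw_ysM_1 .
    show "pw ys n xtors \<subseteq> V \<inter> JM n" unfolding pw_xtors V_def using ysM_le_JM[of n] by blast
  qed
  finally have 4: "enat ((n + length ys - 1) choose n) * rlen (ysM (Suc 0)) xtors \<le> rlen (ysM (Suc n)) (V \<inter> JM n)" .
  show ?thesis using 1 2 3 4 unfolding V_def by blast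
qed

text \<open>The lower bound adds up the surplus of \<open>rlen_JM_Suc\<close>; the upper bound
  inserts the linear growth of \<open>length_xpow_bound\<close> into the filtration of
  \<open>rlen_JM_le\<close>.\<close>

proposition hilbert_samuel_bounds:
  assumes "\<not> reg x (ysM (Suc 0))"
  shows "\<exists>l h e :: nat. \<exists>g :: nat \<Rightarrow> nat. h > 0 \<and> (\<forall>n. rlen (JM (Suc n)) (carrier M) = enat (g n) \<and>
    l * ((n + Suc (length ys)) choose Suc (length ys)) + h * ((n + length ys) choose length ys)
      \<le> g n + h * ((n + Suc (length ys)) choose Suc (length ys)) \<and>
    g n + h * ((n + Suc (length ys)) choose Suc (length ys))
      \<le> l * ((n + Suc (length ys)) choose Suc (length ys)) + e * ((n + length ys) choose length ys))"
proof -
  obtain l h e m where l: "rlen (xpow (Suc 0)) (carrier M) = enat l" and h: "rlen (ysM (Suc 0)) xtors = enat h"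
    and m: "\<And>k. rlen (xpow k) (carrier M) = enat (m k)" "\<And>k. m k + h * k \<le> l * k + e"
    using length_xpow_bound by metis
  \<comment> \<open>\<open>c i\<close> counts monomials of degree i in the elements of
    \<open>ys\<close>, \<open>C n\<close> those of degree below n. Summing \<open>C\<close> once
    more gives the binomial coefficients with lower index d.\<close>
  define c where "c i = (i + length ys - 1) choose i" for i
  define C where "C n = (\<Sum>i<n. c i)" for n
  have h0: "h > 0"
  proof -
    have "xtors \<noteq> ysM (Suc 0)" using assms by (auto simp: xtors_def reg_def colon_def)
    then have "ysM (Suc 0) \<subset> xtors" using ysM_1_le_xtors by blast
    then have "1 \<le> rlen (ysM (Suc 0)) xtors" by (rule rlen_pos[OF sub_ysM])
    then show ?thesis unfolding h by (simp add: one_enat_def)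
  qed
  have upper: "rlen (JM n) (carrier M) \<le> enat (\<Sum>i<n. c i * m (n - i))" for n
  proof -
    have "(\<Sum>i<n. enat ((i + length ys - 1) choose i) * rlen (xpow (n - i)) (carrier M)) =
        (\<Sum>i<n. enat (c i * m (n - i)))" unfolding m(1) c_def by simp
    also have "\<dots> = enat (\<Sum>i<n. c i * m (n - i))"
      by (simp only: of_nat_eq_enat[symmetric] of_nat_sum)
    finally show ?thesis using rlen_JM_le[of n] by simp
  qed
  then have "\<exists>g. rlen (JM n) (carrier M) = enat g" for n
    by (metis enat_ile)
  then obtain g where g: "\<And>n. rlen (JM n) (carrier M) = enat (g n)" by metis
  \<comment> \<open>The kernel length f occurs in both Euler characteristics and cancels.\<close>
  have low: "g n + (l * C (Suc n) + c n * h) \<le> g (Suc n) + h * C (Suc n)" for n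
  proof -
    obtain a b where ab: "rlen (scale x (carrier M) \<boxplus> ysM (Suc n)) (carrier M) = enat a"
      "rlen (ysM (Suc n)) (colon (ysM (Suc n)) x) = enat b" "a + h * C (Suc n) = l * C (Suc n) + b"
      using rlen_ysM_euler[OF l h, of "Suc n"] unfolding C_def c_def by (elim exE conjE)
    obtain f r w where frw: "enat (g (Suc n)) = r + enat a" "enat (g n) = f + r" "enat b = w + f"
      "enat (c n) * enat h \<le> w"
      using rlen_JM_Suc[of n] unfolding g ab(1,2) h c_def[symmetric] by (elim exE conjE)
    obtain f' r' w' where "f = enat f'" "r = enat r'" "w = enat w'"
      using frw(2,3) by (cases f; cases r; cases w) auto
    then show ?thesis using frw ab(3) by simp
  qed
  have g0: "g 0 = 0" using g[of 0] by (simp add: rlen_refl zero_enat_def)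
  have lower: "l * (\<Sum>j\<le>n. C j) + h * C n \<le> g n + h * (\<Sum>j\<le>n. C j)" for n
  proof (induction n)
    case 0
    then show ?case by (simp add: C_def)
  next
    case (Suc n)
    have "C (Suc n) = C n + c n" by (simp add: C_def)
    then show ?case using Suc low[of n] by (simp add: algebra_simps)
  qed
  have upper': "g n + h * (\<Sum>j\<le>n. C j) \<le> l * (\<Sum>j\<le>n. C j) + e * C n" for n
  proof -
    have w: "(\<Sum>j\<le>n. C j) = (\<Sum>i<n. c i * (n - i))" unfolding C_def by (rule sum_weighted[symmetric])
    have "g n \<le> (\<Sum>i<n. c i * m (n - i))" using upper[of n] unfolding g by simp
    then have "g n + h * (\<Sum>j\<le>n. C j) \<le> (\<Sum>i<n. c i * m (n - i)) + h * (\<Sum>i<n. c i * (n - i))"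
      unfolding w by simp
    also have "\<dots> = (\<Sum>i<n. c i * (m (n - i) + h * (n - i)))"
      by (simp add: sum_distrib_left sum.distrib distrib_left mult_ac)
    also have "\<dots> \<le> (\<Sum>i<n. c i * (l * (n - i) + e))"
      by (intro sum_mono mult_le_mono order_refl m)
    also have "\<dots> = l * (\<Sum>j\<le>n. C j) + e * C n"
      unfolding w by (simp add: C_def sum_distrib_left sum.distrib distrib_left mult_ac)
    finally show ?thesis .
  qed
  have C1: "C (Suc n) = (n + length ys) choose length ys" for n
    unfolding C_def c_def by (rule sum_choose_diag)
  have C2: "(\<Sum>j\<le>Suc n. C j) = (n + Suc (length ys)) choose Suc (length ys)" for n
    unfolding C_def c_def by (rule sum_choose_diag2)
  show ?thesis
  \<comment> \<open>So far \<open>g n\<close> belonged to J^n M; the shift by one matches the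
    exponent n + 1 of the Hilbert-Samuel function.\<close>
  proof (intro exI conjI allI)
    show "h > 0" by (rule h0)
    fix n
    show "rlen (JM (Suc n)) (carrier M) = enat (g (Suc n))" by (rule g)
    show "l * ((n + Suc (length ys)) choose Suc (length ys)) + h * ((n + length ys) choose length ys)
      \<le> g (Suc n) + h * ((n + Suc (length ys)) choose Suc (length ys))"
      using lower[of "Suc n"] unfolding C1 C2 .
    show "g (Suc n) + h * ((n + Suc (length ys)) choose Suc (length ys))
      \<le> l * ((n + Suc (length ys)) choose Suc (length ys)) + e * ((n + length ys) choose length ys)"
      using upper'[of "Suc n"] unfolding C1 C2 .
  qed
qed

end

end

section \<open>Generators containing a regular sequence\<close>

lemma (in module) rlen_infinite:
  assumes "\<And>k. sub (C k)" "\<And>k. C (Suc k) \<subset> C k" "\<And>k. B \<subseteq> C k"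
  shows "rlen B (C 0) = \<infinity>"
proof -
  have ch: "has_chain n B (C k)" for n k
  proof (induction n arbitrary: k)
    case (Suc n)
    then have "has_chain n B (C (Suc k))" .
    then show ?case unfolding has_chain.simps by (intro exI[of _ "C (Suc k)"] conjI assms)
  qed (use assms(3) in simp)
  have le: "enat n \<le> rlen B (C 0)" for n
    using enat_le_rlen[OF assms(3), of n 0] ch by simp
  show ?thesis
  proof (cases "rlen B (C 0)")
    case (enat m)
    then show ?thesis using le[of "Suc m"] by simp
  qed simp
qed

context noetherian_local_module
begin

text \<open>A module of finite length is supported at the maximal ideal only. The chain a^k M + IM
  becomes stationary, whence a^k M \<subseteq> IM by Nakayama's lemma, and this is impossible at a
  prime containing I but not a.\<close>

lemma assoc_prime_finite_colength:
  assumes I: "ideal I R" and fin: "rlen (idl_mult I (carrier M)) (carrier M) < \<infinity>"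
    and N: "sub N" and u: "u \<in> carrier M - N" and P: "primeideal (ann N u) R"
    and IP: "I \<subseteq> ann N u" and a: "a \<in> \<mm>"
  shows "a \<in> ann N u"
proof (rule ccontr)
  assume na: "a \<notin> ann N u"
  note M = carrier_is_submodule
  interpret P: primeideal "ann N u" R by fact
  have ac: "a \<in> carrier R" using a by (rule \<mm>_carrier)
  define IM where "IM = idl_mult I (carrier M)"
  have sIM: "sub IM" unfolding IM_def using ideal.Icarr[OF I] by (intro sub_idl_mult) auto
  define W where "W k = scale (a [^] k) (carrier M)" for k :: nat
  have sW: "sub (W k)" for k unfolding W_def using ac by (intro sub_scale M) auto
  have W_Suc: "W (Suc k) = scale a (W k)" for k
  proof -
    have "W (Suc k) = scale (a [^] k) (scale a (carrier M))"
      unfolding W_def nat_pow_Suc using ac by (intro scale_mult) auto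
    also have "\<dots> = scale a (W k)" unfolding W_def using ac by (intro scale_comm) auto
    finally show ?thesis .
  qed
  define C where "C k = W k \<boxplus> IM" for k
  have sC: "sub (C k)" for k unfolding C_def by (intro sub_msum sW sIM)
  have C0: "C 0 = carrier M"
    unfolding C_def W_def using msum_absorb1[OF M sIM sub_subset[OF sIM]] by (simp add: scale_one)
  have Cle: "C (Suc k) \<subseteq> C k" for k
    unfolding C_def W_Suc by (intro msum_mono scale_subset ac sW order_refl)
  have "\<exists>k. C (Suc k) = C k"
  proof (rule ccontr)
    assume "\<nexists>k. C (Suc k) = C k"
    then have "C (Suc k) \<subset> C k" for k using Cle by blast
    moreover have "IM \<subseteq> C k" for k unfolding C_def by (intro msum_upper2 sW sIM)
    ultimately have "rlen IM (C 0) = \<infinity>" using sC by (intro rlen_infinite)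
    then show False using fin unfolding C0 IM_def by simp
  qed
  then obtain k where k: "C (Suc k) = C k" by blast
  have "W k \<subseteq> IM"
  proof (rule nakayama_scale[OF sW sIM a])
    have "W k \<subseteq> C k" unfolding C_def by (intro msum_upper1 sW sIM)
    then show "W k \<subseteq> scale a (W k) \<boxplus> IM" unfolding k[symmetric] unfolding C_def W_Suc .
  qed
  have "a [^] k \<notin> ann N u"
  proof (induction k)
    case 0
    then show ?case using P.one_imp_carrier P.I_notcarr by auto
  next
    case (Suc k)
    then show ?case using P.I_prime[of "a [^] k" a] na ac by auto
  qed
  from fg[OF M] obtain S where S: "finite S" "S \<subseteq> carrier M" "gen_submodule R M S = carrier M"
    by (elim exE conjE)
  \<comment> \<open>For P = (N : u), a^k M lies in IM \<subseteq> PM while a^k is outside P. So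
    Nakayama's lemma at P gives \<beta> outside P with \<beta> M \<subseteq> N, and u contradicts
    this.\<close>
  have "\<exists>\<beta>\<in>carrier R. \<beta> \<notin> ann N u \<and> (\<forall>w\<in>gen_submodule R M S. \<beta> \<odot>\<^bsub>M\<^esub> w \<in> N)"
  proof (rule localized_nakayama[OF P _ \<open>a [^] k \<notin> ann N u\<close> S(1,2) N])
    show "a [^] k \<in> carrier R" using ac by simp
    fix w assume "w \<in> gen_submodule R M S"
    then have "a [^] k \<odot>\<^bsub>M\<^esub> w \<in> W k" unfolding S(3) W_def by (rule scaleI)
    then have "a [^] k \<odot>\<^bsub>M\<^esub> w \<in> IM" using \<open>W k \<subseteq> IM\<close> by blast
    moreover have "IM \<subseteq> idl_mult (ann N u) (carrier M)"
      unfolding IM_def using IP P.Icarr by (intro idl_mult_least sub_idl_mult) (auto intro: idl_multI)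
    moreover have "idl_mult (ann N u) (carrier M) \<subseteq> idl_mult (ann N u) (carrier M) \<boxplus> N"
      using P.Icarr by (intro msum_upper1 N sub_idl_mult) auto
    ultimately show "a [^] k \<odot>\<^bsub>M\<^esub> w \<in> idl_mult (ann N u) (gen_submodule R M S) \<boxplus> N"
      unfolding S(3) by blast
  qed
  then obtain \<beta> where \<beta>: "\<beta> \<in> carrier R" "\<beta> \<notin> ann N u" "\<forall>w\<in>carrier M. \<beta> \<odot>\<^bsub>M\<^esub> w \<in> N"
    unfolding S(3) by blast
  have "\<beta> \<odot>\<^bsub>M\<^esub> u \<in> N" by (rule bspec[OF \<beta>(3)]) (use u in simp)
  then show False using \<beta>(1,2) unfolding ann_def by blast
qed

text \<open>Put N' = N + (ys)M. A prime (N' : u) containing z and the later generators contains J,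
  hence \<mm>; but \<mm> contains an element regular on M/N'. So the coset of z modulo the later
  generators contains a regular element, and replacing z by it does not change J. There is one
  generator more than regular elements to be found; it is left over as x.\<close>

lemma regular_generators:
  assumes "sub N" "set ys \<subseteq> \<mm>" "set zs \<subseteq> \<mm>" "length zs = Suc t"
    and "J = Idl (set ys \<union> set zs)" "rlen (idl_mult J (carrier M)) (carrier M) < \<infinity>"
    and "reg_seq N ys" "has_depth t (N \<boxplus> lmul ys (carrier M))"
  shows "\<exists>ys' x. set ys' \<subseteq> \<mm> \<and> x \<in> \<mm> \<and> length ys' = length ys + t \<and> reg_seq N ys' \<and>
    J = Idl (insert x (set ys'))"
  using assms
proof (induction t arbitrary: ys zs)
  case 0
  then obtain x where "zs = [x]" by (cases zs) auto
  then show ?case using 0 by (intro exI[of _ ys] exI[of _ x]) auto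
next
  case (Suc t)
  note M = carrier_is_submodule and N = Suc.prems(1)
  obtain z zs' where zs: "zs = z # zs'" "length zs' = Suc t" using Suc.prems(4) by (cases zs) auto
  have c: "set ys \<subseteq> carrier R" "z \<in> carrier R" "set zs' \<subseteq> carrier R"
    using Suc.prems(2,3) zs \<mm>_carrier by auto
  define N' where "N' = N \<boxplus> lmul ys (carrier M)"
  have sN': "sub N'" unfolding N'_def by (intro sub_msum N sub_lmul c M)
  have idJ: "ideal J R" unfolding Suc.prems(5) zs using c by (intro genideal_ideal) auto
  have idI: "ideal (Idl (set zs')) R" using c by (intro genideal_ideal)
  obtain a where a: "a \<in> \<mm>" "reg a N'" using Suc.prems(8) unfolding N'_def by auto
  have "\<exists>b\<in>Idl (set zs'). \<forall>K\<in>{N'}. reg (z \<oplus> b) K"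
  proof (rule common_regular[OF _ _ idI c(2)])
    show "finite {N'}" "\<And>K. K \<in> {N'} \<Longrightarrow> sub K" using sN' by auto
    fix K u assume K: "K \<in> {N'}" and u: "u \<in> carrier M - K" and P: "primeideal (ann K u) R"
      and z: "z \<in> ann K u"
    have K: "K = N'" using K by simp
    show "\<not> Idl (set zs') \<subseteq> ann K u"
    proof
      assume le: "Idl (set zs') \<subseteq> ann K u"
      have "J \<subseteq> ann K u"
        unfolding Suc.prems(5)
      proof (rule genideal_minimal)
        show "ideal (ann K u) R" using P by (rule primeideal.axioms(1))
        have "set zs' \<subseteq> ann K u" using genideal_self[OF c(3)] le by blast
        moreover have "set ys \<subseteq> ann K u"
        proof
          fix y assume y: "y \<in> set ys"
          have "y \<in> Idl (set ys)" using genideal_self[OF c(1)] y by blast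
          then have "y \<odot>\<^bsub>M\<^esub> u \<in> idl_mult (Idl (set ys)) (carrier M)" using u by (intro idl_multI) auto
          then have "y \<odot>\<^bsub>M\<^esub> u \<in> lmul ys (carrier M)" unfolding idl_mult_genideal[OF c(1) M] .
          then have "y \<odot>\<^bsub>M\<^esub> u \<in> N'"
            unfolding N'_def using msum_upper2[OF N sub_lmul[OF c(1) M]] by blast
          then show "y \<in> ann K u" using y c(1) by (auto simp: K ann_def)
        qed
        ultimately show "set ys \<union> set zs \<subseteq> ann K u" using z zs by auto
      qed
      then have "a \<in> ann K u"
        using assoc_prime_finite_colength[OF idJ Suc.prems(6) _ u P _ a(1)] sN' K by blast
      then have "u \<in> N'" using regD[OF a(2), of u] u by (auto simp: ann_def K)
      then show False using u K by auto
    qed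
  qed
  then obtain b where b: "b \<in> Idl (set zs')" "reg (z \<oplus> b) N'" by auto
  have bc: "b \<in> carrier R" using b(1) ideal.Icarr[OF idI] by auto
  define y where "y = z \<oplus> b"
  have "Idl (set zs') \<subseteq> \<mm>" using Suc.prems(3) zs by (intro genideal_minimal is_ideal) auto
  then have ym: "y \<in> \<mm>" unfolding y_def using b(1) Suc.prems(3) zs by (intro a_closed) auto
  have yc: "y \<in> carrier R" using ym by (rule \<mm>_carrier)
  have J': "J = Idl (set (y # ys) \<union> set zs')"
  proof
    let ?J' = "Idl (set (y # ys) \<union> set zs')"
    have c': "set (y # ys) \<union> set zs' \<subseteq> carrier R" using c yc by auto
    have id': "ideal ?J' R" using c' by (rule genideal_ideal)
    have sJ: "set ys \<union> set zs \<subseteq> J" unfolding Suc.prems(5) using c zs by (intro genideal_self) auto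
    have sJ': "set (y # ys) \<union> set zs' \<subseteq> ?J'" using c' by (rule genideal_self)
    have bJ: "b \<in> J" "b \<in> ?J'"
      using b(1) genideal_minimal[OF idJ, of "set zs'"] genideal_minimal[OF id', of "set zs'"] sJ sJ' zs
      by auto
    have "y \<in> J"
      unfolding y_def using sJ zs bJ by (intro additive_subgroup.a_closed[OF ideal.axioms(1)[OF idJ]]) auto
    then show "?J' \<subseteq> J" using sJ zs by (intro genideal_minimal[OF idJ]) auto
    have "y \<oplus> \<ominus> b \<in> ?J'"
      using sJ' bJ by (intro additive_subgroup.a_closed[OF ideal.axioms(1)[OF id']]
          additive_subgroup.a_inv_closed[OF ideal.axioms(1)[OF id']]) auto
    moreover have "y \<oplus> \<ominus> b = z" unfolding y_def using c bc by algebra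
    ultimately have "z \<in> ?J'" by simp
    then show "J \<subseteq> ?J'" unfolding Suc.prems(5) using sJ' zs by (intro genideal_minimal[OF id']) auto
  qed
  have "has_depth t (adj N' y)"
    using has_depth_adj[OF sN' _ ym b(2)[folded y_def]] Suc.prems(8) unfolding N'_def by blast
  then have "has_depth t (N \<boxplus> lmul (y # ys) (carrier M))" unfolding N'_def adj_lmul(2)[OF N yc c(1)] .
  moreover have "reg_seq N (y # ys)" using Suc.prems(7) b(2) unfolding y_def N'_def by simp
  ultimately have "\<exists>ys' x. set ys' \<subseteq> \<mm> \<and> x \<in> \<mm> \<and> length ys' = length (y # ys) + t \<and> reg_seq N ys' \<and>
    J = Idl (insert x (set ys'))"
    using Suc.prems(2,3) ym zs by (intro Suc.IH[OF N _ _ zs(2) J' Suc.prems(6)]) auto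
  then show ?case by simp
qed

end


section \<open>The Hilbert--Serre theorem\<close>

context module
begin

definition stable where
  "stable ops C \<longleftrightarrow> (\<forall>z\<in>ops. \<forall>n. \<forall>u\<in>C n. z \<odot>\<^bsub>M\<^esub> u \<in> C (Suc n))"

lemma stableD: "stable ops C \<Longrightarrow> z \<in> ops \<Longrightarrow> u \<in> C n \<Longrightarrow> z \<odot>\<^bsub>M\<^esub> u \<in> C (Suc n)"
  unfolding stable_def by blast

text \<open>Sequences \<open>B \<le> A\<close> of submodules play the role of the graded module with components
  \<open>A n/B n\<close>, and \<open>ops\<close> that of its generators of degree one.\<close>
definition between where
  "between ops B A C \<longleftrightarrow> (\<forall>n. sub (C n) \<and> B n \<subseteq> C n \<and> C n \<subseteq> A n) \<and> stable ops C"

text \<open>The Noetherian property of the graded module. One K serves all degrees, since whole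
  families \<open>C k\<close> are compared.\<close>

definition graded_acc where
  "graded_acc ops B A \<longleftrightarrow> (\<forall>C. (\<forall>k. between ops B A (C k)) \<longrightarrow> (\<forall>k n. C k n \<subseteq> C (Suc k) n) \<longrightarrow>
     (\<exists>K. \<forall>k\<ge>K. C k = C K))"

lemma graded_accD:
  assumes "graded_acc ops B A" "\<And>k. between ops B A (C k)" "\<And>k n. C k n \<subseteq> C (Suc k) n"
  shows "\<exists>K. \<forall>k\<ge>K. C k = C K"
  using assms(1)[unfolded graded_acc_def, rule_format, of C] assms(2,3) by simp

lemma betweenD:
  assumes "between ops B A C"
  shows "sub (C n)" "B n \<subseteq> C n" "C n \<subseteq> A n" "stable ops C"
  using assms unfolding between_def by simp_all

text \<open>B + zA as a graded submodule: dividing by it instead of B reduces the graded module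
  modulo z. Nothing of degree 0 is a multiple of z.\<close>

fun add_image where
  "add_image z B A 0 = B 0"
| "add_image z B A (Suc n) = B (Suc n) \<boxplus> scale z (A n)"

lemma stable_pow:
  assumes "stable ops C" "z \<in> ops" "z \<in> carrier R" "\<And>n. C n \<subseteq> carrier M" "u \<in> C n"
  shows "z [^] (p :: nat) \<odot>\<^bsub>M\<^esub> u \<in> C (n + p)"
proof (induction p)
  case 0
  then show ?case using assms(4)[of n] assms(5) by auto
next
  case (Suc p)
  have u: "u \<in> carrier M" using assms(4,5) by blast
  have "z [^] Suc p \<odot>\<^bsub>M\<^esub> u = z \<odot>\<^bsub>M\<^esub> (z [^] p \<odot>\<^bsub>M\<^esub> u)"
    using assms(3) u smult_comm[of z "z [^] p" u] by (simp add: smult_assoc1)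
  then show ?case using stableD[OF assms(1,2) Suc] by simp
qed

text \<open>Hilbert's basis theorem for one variable: \<open>L k p\<close> below collects the leading coefficients of
  degree \<open>p\<close> in \<open>z\<close> of the members of \<open>C k\<close>.\<close>
lemma graded_acc_add_image:
  assumes A: "\<And>n. sub (A n)" "stable ops A" and B: "\<And>n. sub (B n)" "stable ops B"
    and z: "z \<in> ops" and ops: "ops \<subseteq> carrier R"
    and acc: "graded_acc ops (add_image z B A) A"
  shows "graded_acc ops B A"
  unfolding graded_acc_def
proof (intro allI impI)
  fix C assume C: "\<forall>k. between ops B A (C k)" and C_mono: "\<forall>k n. C k n \<subseteq> C (Suc k) n"
  have sC: "sub (C k n)" and BC: "B n \<subseteq> C k n" and CA: "C k n \<subseteq> A n" and stC: "stable ops (C k)" for k n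
    using betweenD[OF C[rule_format, of k]] by simp_all
  have zc: "z \<in> carrier R" using z ops by blast
  have zp: "z [^] p \<in> carrier R" for p :: nat using zc by simp
  have Ac: "A n \<subseteq> carrier M" and Bc: "B n \<subseteq> carrier M" for n using A B sub_subset by auto
  have Cmono: "C k n \<subseteq> C l n" if "k \<le> l" for k l n
    using lift_Suc_mono_le[of "\<lambda>k. C k n", OF _ that] C_mono by simp
  define q where "q p = z [^] Suc p" for p :: nat
  have qc: "q p \<in> carrier R" for p unfolding q_def by (rule zp)
  have q: "q p = z [^] p \<otimes> z" "q (Suc p) = z \<otimes> q p" for p
    unfolding q_def nat_pow_Suc[of z "Suc p"] by (rule nat_pow_Suc, rule m_comm[OF zp zc])
  \<comment> \<open>In degree n + p, \<open>E n p\<close> is z^(p+1) A, the terms of higher order in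
    z; for n = 0 there are none. A leading coefficient u of order p is thus one for which z^p u lies
    in C k up to terms of higher order.\<close>
  define E where "E n p = (case n of 0 \<Rightarrow> {\<zero>\<^bsub>M\<^esub>} | Suc m \<Rightarrow> scale (q p) (A m))" for n p :: nat
  have sE: "sub (E n p)" for n p
    unfolding E_def by (cases n) (auto intro: sub_zero_set sub_scale[OF qc A(1)])
  have E_op: "y \<odot>\<^bsub>M\<^esub> e \<in> E (Suc n) p" if y: "y \<in> ops" and e: "e \<in> E n p" for y e n p
  proof (cases n)
    case 0
    then have "e = \<zero>\<^bsub>M\<^esub>" using e by (simp add: E_def)
    then show ?thesis using sub_zero[OF sE] y ops by auto
  next
    case (Suc m)
    then obtain a where a: "a \<in> A m" "e = q p \<odot>\<^bsub>M\<^esub> a" using e by (auto simp: E_def scale_def)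
    have "y \<odot>\<^bsub>M\<^esub> e = q p \<odot>\<^bsub>M\<^esub> (y \<odot>\<^bsub>M\<^esub> a)"
      unfolding a(2) using y ops qc Ac a(1) by (intro smult_comm) auto
    moreover have "y \<odot>\<^bsub>M\<^esub> a \<in> A n" unfolding Suc by (rule stableD[OF A(2) y a(1)])
    ultimately show ?thesis by (simp add: E_def scaleI)
  qed
  have E_Suc: "z \<odot>\<^bsub>M\<^esub> e \<in> E n (Suc p)" if e: "e \<in> E n p" for e n p
  proof (cases n)
    case 0
    then show ?thesis using e zc by (simp add: E_def)
  next
    case (Suc m)
    then obtain a where a: "a \<in> A m" "e = q p \<odot>\<^bsub>M\<^esub> a" using e by (auto simp: E_def scale_def)
    have ac: "a \<in> carrier M" using a(1) Ac by blast
    have "z \<odot>\<^bsub>M\<^esub> e = q (Suc p) \<odot>\<^bsub>M\<^esub> a"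
      unfolding a(2) q(2) by (rule smult_assoc1[symmetric, OF zc qc ac])
    then show ?thesis using Suc a(1) by (simp add: E_def scaleI)
  qed
  define L where "L k p n = A n \<inter> colon (C k (n + p) \<boxplus> E n p) (z [^] p)" for k p n :: nat
  have sCE: "sub (C k n \<boxplus> E n' p)" for k n n' p by (intro sub_msum sC sE)
  have L_between: "between ops (add_image z B A) A (L k p)" for k p
    unfolding between_def
  proof (intro conjI allI)
    fix n
    show "sub (L k p n)" unfolding L_def by (intro sub_Int sub_colon A zp sCE)
    show "L k p n \<subseteq> A n" unfolding L_def by blast
    have low: "B n \<subseteq> L k p n"
    proof
      fix b assume b: "b \<in> B n"
      have "z [^] p \<odot>\<^bsub>M\<^esub> b \<in> B (n + p)" by (rule stable_pow[OF B(2) z zc Bc b])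
      then have "z [^] p \<odot>\<^bsub>M\<^esub> b \<in> C k (n + p) \<boxplus> E n p"
        using BC[of "n + p" k] msum_upper1[OF sC sE] by blast
      moreover have "b \<in> A n" using b BC CA by blast
      ultimately show "b \<in> L k p n" unfolding L_def using Ac by (auto simp: colon_def)
    qed
    show "add_image z B A n \<subseteq> L k p n"
    proof (cases n)
      case 0
      then show ?thesis using low by simp
    next
      case (Suc m)
      have "scale z (A m) \<subseteq> L k p n"
      proof
        fix w assume "w \<in> scale z (A m)"
        then obtain a where a: "a \<in> A m" "w = z \<odot>\<^bsub>M\<^esub> a" by (rule scaleE)
        have ac: "a \<in> carrier M" using a(1) Ac by blast
        have "z [^] p \<odot>\<^bsub>M\<^esub> w = q p \<odot>\<^bsub>M\<^esub> a"
          unfolding a(2) q(1) by (rule smult_assoc1[symmetric, OF zp zc ac])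
        then have "z [^] p \<odot>\<^bsub>M\<^esub> w \<in> E n p" using Suc a(1) by (simp add: E_def scaleI)
        then have "z [^] p \<odot>\<^bsub>M\<^esub> w \<in> C k (n + p) \<boxplus> E n p" using msum_upper2[OF sC sE] by blast
        moreover have "w \<in> A n" unfolding Suc a(2) by (rule stableD[OF A(2) z a(1)])
        ultimately show "w \<in> L k p n" unfolding L_def using Ac by (auto simp: colon_def)
      qed
      moreover have "sub (L k p n)" unfolding L_def by (intro sub_Int sub_colon A zp sCE)
      ultimately show ?thesis using low unfolding Suc add_image.simps by (intro msum_least)
    qed
  next
    show "stable ops (L k p)"
      unfolding stable_def
    proof (intro ballI allI)
      fix y n u assume y: "y \<in> ops" and u: "u \<in> L k p n"
      have yc: "y \<in> carrier R" using y ops by blast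
      have uA: "u \<in> A n" and uc: "u \<in> carrier M" using u Ac unfolding L_def by auto
      obtain v e where ve: "v \<in> C k (n + p)" "e \<in> E n p" "z [^] p \<odot>\<^bsub>M\<^esub> u = v \<oplus>\<^bsub>M\<^esub> e"
        using u unfolding L_def colon_def by (auto elim: msumE)
      have c: "v \<in> carrier M" "e \<in> carrier M" using sub_carrier[OF sC ve(1)] sub_carrier[OF sE ve(2)] .
      have "z [^] p \<odot>\<^bsub>M\<^esub> (y \<odot>\<^bsub>M\<^esub> u) = y \<odot>\<^bsub>M\<^esub> v \<oplus>\<^bsub>M\<^esub> y \<odot>\<^bsub>M\<^esub> e"
        unfolding smult_comm[OF zp yc uc] ve(3) by (rule smult_r_distr[OF yc c])
      moreover have "y \<odot>\<^bsub>M\<^esub> v \<in> C k (Suc n + p)" using stableD[OF stC y ve(1)] by simp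
      ultimately have "z [^] p \<odot>\<^bsub>M\<^esub> (y \<odot>\<^bsub>M\<^esub> u) \<in> C k (Suc n + p) \<boxplus> E (Suc n) p"
        using E_op[OF y ve(2)] by (simp add: msumI)
      then show "y \<odot>\<^bsub>M\<^esub> u \<in> L k p (Suc n)"
        unfolding L_def using stableD[OF A(2) y uA] yc uc by (auto simp: colon_def)
    qed
  qed
  have L_mono1: "L k p n \<subseteq> L (Suc k) p n" for k p n
    unfolding L_def using C_mono by (intro Int_mono colon_mono msum_mono order_refl) auto
  have L_mono2: "L k p n \<subseteq> L k (Suc p) n" for k p n
  proof
    fix u assume u: "u \<in> L k p n"
    have uA: "u \<in> A n" and uc: "u \<in> carrier M" using u Ac unfolding L_def by auto
    obtain v e where ve: "v \<in> C k (n + p)" "e \<in> E n p" "z [^] p \<odot>\<^bsub>M\<^esub> u = v \<oplus>\<^bsub>M\<^esub> e"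
      using u unfolding L_def colon_def by (auto elim: msumE)
    have c: "v \<in> carrier M" "e \<in> carrier M" using sub_carrier[OF sC ve(1)] sub_carrier[OF sE ve(2)] .
    have "z [^] Suc p \<odot>\<^bsub>M\<^esub> u = z \<odot>\<^bsub>M\<^esub> (z [^] p \<odot>\<^bsub>M\<^esub> u)"
      unfolding nat_pow_Suc m_comm[OF zp zc] by (rule smult_assoc1[OF zc zp uc])
    also have "\<dots> = z \<odot>\<^bsub>M\<^esub> v \<oplus>\<^bsub>M\<^esub> z \<odot>\<^bsub>M\<^esub> e" unfolding ve(3) by (rule smult_r_distr[OF zc c])
    also have "\<dots> \<in> C k (n + Suc p) \<boxplus> E n (Suc p)"
      using stableD[OF stC z ve(1)] E_Suc[OF ve(2)] by (simp add: msumI)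
    finally show "u \<in> L k (Suc p) n" unfolding L_def using uA uc by (intro IntI colonI)
  qed
  have Lmono: "L k p n \<subseteq> L k' p' n" if "k \<le> k'" "p \<le> p'" for k k' p p' n
    using lift_Suc_mono_le[of "\<lambda>k. L k p n", OF L_mono1 that(1)]
      lift_Suc_mono_le[of "\<lambda>p. L k' p n", OF L_mono2 that(2)] by blast
  \<comment> \<open>The diagonal chain settles all pairs of large indices; the finitely many orders
    below K0 are treated one by one.\<close>
  have "\<exists>K. \<forall>k\<ge>K. L k k = L K K"
    by (rule graded_accD[OF acc, of "\<lambda>k. L k k"]) (intro L_between Lmono le_SucI order_refl)+
  then obtain K0 where K0: "\<And>k. k \<ge> K0 \<Longrightarrow> L k k = L K0 K0" by blast
  have big: "L k p = L K0 K0" if "k \<ge> K0" "p \<ge> K0" for k p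
  proof (rule ext, rule antisym)
    fix n
    have "L k p n \<subseteq> L (max k p) (max k p) n" by (intro Lmono) auto
    then show "L k p n \<subseteq> L K0 K0 n" using K0[of "max k p"] that by simp
    show "L K0 K0 n \<subseteq> L k p n" by (intro Lmono that)
  qed
  have "\<exists>K. \<forall>k\<ge>K. L k p = L K p" for p
    by (rule graded_accD[OF acc, of "\<lambda>k. L k p"]) (intro L_between L_mono1)+
  then obtain f where f: "\<And>p k. k \<ge> f p \<Longrightarrow> L k p = L (f p) p" by metis
  define K where "K = K0 + (\<Sum>p<K0. f p)"
  have L_const: "L k p = L K p" if k: "k \<ge> K" for k p
  proof (cases "p < K0")
    case True
    have "f p \<le> (\<Sum>p<K0. f p)" using True by (intro member_le_sum) auto
    then have "f p \<le> K" "f p \<le> k" using k K_def by auto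
    then show ?thesis using f[of p k] f[of p K] by simp
  next
    case False
    then show ?thesis using big[of k p] big[of K p] k K_def by simp
  qed
  have "C k n = C K n" if k: "k \<ge> K" for k n
  proof (rule antisym[OF subsetI Cmono[OF k]])
    fix g assume g: "g \<in> C k n"
    \<comment> \<open>Subtracting members of C K removes the orders in z of g one after another. The
      remainder z^p a has its coefficient in degree n - p, so the process ends at p = n.\<close>
    have "p \<le> n \<Longrightarrow> \<exists>a\<in>A (n - p). \<exists>v\<in>C K n. g = v \<oplus>\<^bsub>M\<^esub> z [^] p \<odot>\<^bsub>M\<^esub> a" for p :: nat
    proof (induction p)
      case 0
      have "g \<in> A n" using g CA by blast
      then have "g \<in> A (n - 0)" "g \<in> carrier M" using Ac by auto
      then have "g = \<zero>\<^bsub>M\<^esub> \<oplus>\<^bsub>M\<^esub> z [^] (0 :: nat) \<odot>\<^bsub>M\<^esub> g" by simp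
      then have "\<exists>v\<in>C K n. g = v \<oplus>\<^bsub>M\<^esub> z [^] (0 :: nat) \<odot>\<^bsub>M\<^esub> g" by (rule bexI) (rule sub_zero[OF sC])
      then show ?case using \<open>g \<in> A (n - 0)\<close> by (rule bexI)
    next
      case (Suc p)
      then obtain a v where av: "a \<in> A (n - p)" "v \<in> C K n" "g = v \<oplus>\<^bsub>M\<^esub> z [^] p \<odot>\<^bsub>M\<^esub> a" by auto
      obtain m where m: "n - p = Suc m" "n - Suc p = m" using Suc.prems by (cases "n - p") auto
      have ac: "a \<in> carrier M" using av(1) Ac by blast
      have vc: "v \<in> carrier M" using sub_carrier[OF sC av(2)] .
      have "v \<in> C k n" using av(2) Cmono[OF k] by blast
      then have "z [^] p \<odot>\<^bsub>M\<^esub> a \<in> C k n"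
        using sub_add_cancel[OF sC[of k n], of v "z [^] p \<odot>\<^bsub>M\<^esub> a"] g av(3) zp ac by simp
      moreover have np: "n - p + p = n" using Suc.prems by simp
      ultimately have "z [^] p \<odot>\<^bsub>M\<^esub> a \<in> C k (n - p + p) \<boxplus> E (n - p) p"
        using msum_upper1[OF sC sE] by fastforce
      then have "a \<in> L k p (n - p)" unfolding L_def using av(1) ac by (simp add: colon_def)
      then have "a \<in> L K p (n - p)" using L_const[OF k] by simp
      then have "z [^] p \<odot>\<^bsub>M\<^esub> a \<in> C K n \<boxplus> E (n - p) p" unfolding L_def np by (simp add: colon_def)
      then obtain v' e where ve: "v' \<in> C K n" "e \<in> E (n - p) p" "z [^] p \<odot>\<^bsub>M\<^esub> a = v' \<oplus>\<^bsub>M\<^esub> e"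
        by (rule msumE)
      obtain a' where a': "a' \<in> A m" "e = q p \<odot>\<^bsub>M\<^esub> a'"
        using ve(2) unfolding m(1) E_def by (auto elim: scaleE)
      have c: "v' \<in> carrier M" "e \<in> carrier M"
        using sub_carrier[OF sC ve(1)] sub_carrier[OF sE ve(2)] .
      have "g = (v \<oplus>\<^bsub>M\<^esub> v') \<oplus>\<^bsub>M\<^esub> z [^] Suc p \<odot>\<^bsub>M\<^esub> a'"
        unfolding av(3) ve(3) a'(2)[unfolded q_def, symmetric] by (rule M.a_assoc[symmetric, OF vc c])
      moreover have "v \<oplus>\<^bsub>M\<^esub> v' \<in> C K n" by (rule sub_add[OF sC av(2) ve(1)])
      ultimately show ?case using a'(1) unfolding m(2) by blast
    qed
    \<comment> \<open>At order n the coefficient has degree 0, and \<open>E 0 n\<close> is zero, so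
      the remainder itself lies in C K.\<close>
    from this[of n] obtain a v where av: "a \<in> A 0" "v \<in> C K n" "g = v \<oplus>\<^bsub>M\<^esub> z [^] n \<odot>\<^bsub>M\<^esub> a" by auto
    have ac: "a \<in> carrier M" using av(1) Ac by blast
    have "v \<in> C k n" using av(2) Cmono[OF k] by blast
    then have "z [^] n \<odot>\<^bsub>M\<^esub> a \<in> C k (0 + n)"
      using sub_add_cancel[OF sC[of k n], of v "z [^] n \<odot>\<^bsub>M\<^esub> a"] g av(3) zp ac by simp
    then have "z [^] n \<odot>\<^bsub>M\<^esub> a \<in> C k (0 + n) \<boxplus> E 0 n" using msum_upper1[OF sC sE] by blast
    then have "a \<in> L k n 0" unfolding L_def using av(1) ac by (simp add: colon_def)
    then have "a \<in> L K n 0" using L_const[OF k] by simp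
    then have "z [^] n \<odot>\<^bsub>M\<^esub> a \<in> C K n \<boxplus> {\<zero>\<^bsub>M\<^esub>}" unfolding L_def E_def by (simp add: colon_def)
    then have "z [^] n \<odot>\<^bsub>M\<^esub> a \<in> C K n" using msum_absorb1[OF sC sub_zero_set] sub_zero[OF sC] by simp
    then show "g \<in> C K n" unfolding av(3) by (rule sub_add[OF sC av(2)])
  qed
  then show "\<exists>K. \<forall>k\<ge>K. C k = C K" by blast
qed

end

text \<open>Integer-valued polynomials of degree below r in the basis (X+i choose i). The Hilbert
  coefficients refer to the same basis, so for r = d + 1 they are the a i in reverse order up to
  sign, and their integrality is built in.\<close>

definition binomial_fun :: "nat \<Rightarrow> (nat \<Rightarrow> int) \<Rightarrow> nat \<Rightarrow> int" where
  "binomial_fun r a n = (\<Sum>i<r. a i * int ((n + i) choose i))"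

text \<open>By Pascal's rule (n+r choose r) = (n+1+r choose r) - (n+r choose r-1). The shift is
  needed because the kernel and the cokernel of a map of degree one are measured in different
  degrees.\<close>

lemma binomial_fun_shift: "\<exists>a'. \<forall>n. binomial_fun r a n = binomial_fun r a' (Suc n)"
proof (induction r arbitrary: a)
  case 0
  then show ?case by (simp add: binomial_fun_def)
next
  case (Suc r)
  show ?case
  proof (cases r)
    case 0
    then show ?thesis by (intro exI[of _ a]) (simp add: binomial_fun_def)
  next
    case s: (Suc s)
    define b where "b = a(s := a s - a r)"
    obtain b' where b': "\<forall>n. binomial_fun r a n = binomial_fun r b' (Suc n)" using Suc by blast
    define a' where "a' = b'(s := b' s - a r, r := a r)"
    have "binomial_fun (Suc r) a n = binomial_fun (Suc r) a' (Suc n)" for n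
    proof -
      have "binomial_fun (Suc r) a n = binomial_fun r b' (Suc n) + a r * int ((n + r) choose r)"
        using b' by (simp add: binomial_fun_def)
      also have "int ((n + r) choose r) = int ((Suc n + r) choose r) - int ((Suc n + s) choose s)"
        unfolding s by simp
      also have "binomial_fun r b' (Suc n) + a r * (int ((Suc n + r) choose r) - int ((Suc n + s) choose s)) =
          binomial_fun (Suc r) a' (Suc n)"
      proof -
        have "binomial_fun r b' (Suc n) = binomial_fun s b' (Suc n) + b' s * int ((Suc n + s) choose s)"
          unfolding s by (simp add: binomial_fun_def)
        moreover have "binomial_fun (Suc r) a' (Suc n) =
            binomial_fun s b' (Suc n) + (b' s - a r) * int ((Suc n + s) choose s) + a r * int ((Suc n + r) choose r)"
          unfolding s binomial_fun_def by (simp add: a'_def s)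
        ultimately show ?thesis by (simp add: algebra_simps)
      qed
      finally show ?thesis .
    qed
    then show ?thesis by blast
  qed
qed

lemma binomial_fun_diff: "binomial_fun r a n - binomial_fun r b n = binomial_fun r (\<lambda>i. a i - b i) n"
  by (simp add: binomial_fun_def sum_subtractf algebra_simps)

text \<open>Summation raises every index by one, as (X+i+1 choose i+1) has the difference (X+1+i
  choose i). The constant term absorbs the value at N.\<close>

lemma binomial_fun_sum:
  fixes f :: "nat \<Rightarrow> int"
  assumes "\<And>n. n \<ge> N \<Longrightarrow> f (Suc n) - f n = binomial_fun r a (Suc n)"
  shows "\<exists>b. \<forall>n\<ge>N. f n = binomial_fun (Suc r) b n"
proof -
  define g where "g n = (\<Sum>i<r. a i * int ((n + Suc i) choose Suc i))" for n
  have g: "g (Suc n) - g n = binomial_fun r a (Suc n)" for n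
    unfolding g_def binomial_fun_def sum_subtractf[symmetric]
    by (rule sum.cong) (simp_all add: algebra_simps)
  have "f n = (f N - g N) + g n" if "n \<ge> N" for n
    using that
  proof (induction n rule: dec_induct)
    case (step n)
    then show ?case using assms[of n] g[of n] by simp
  qed simp
  moreover have "c + g n = binomial_fun (Suc r) (case_nat c a) n" for c n
    unfolding binomial_fun_def g_def sum.lessThan_Suc_shift by simp
  ultimately show ?thesis by metis
qed

context module
begin

lemma betweenI:
  assumes "\<And>n. sub (C n)" "\<And>n. B n \<subseteq> C n" "\<And>n. C n \<subseteq> A n" "stable ops C"
  shows "between ops B A C"
  using assms unfolding between_def by simp

lemma stableI:
  assumes "\<And>z n u. z \<in> ops \<Longrightarrow> u \<in> C n \<Longrightarrow> z \<odot>\<^bsub>M\<^esub> u \<in> C (Suc n)"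
  shows "stable ops C"
  using assms unfolding stable_def by blast

text \<open>Induction on the generators through the exact sequence of multiplication by z, a map of
  degree one: the first difference of the Hilbert function is that of the cokernel minus that of the
  kernel.\<close>

theorem hilbert_serre:
  assumes "set zs \<subseteq> carrier R" "\<And>n. sub (A n)" "\<And>n. sub (B n)" "\<And>n. B n \<subseteq> A n"
    "\<And>n. rlen (B n) (A n) < \<infinity>" "stable (set zs) A" "stable (set zs) B"
    "graded_acc (set zs) B A"
  shows "\<exists>a N. \<forall>n\<ge>N. int (the_enat (rlen (B n) (A n))) = binomial_fun (length zs) a n"
  using assms
proof (induction zs arbitrary: A B)
  case Nil
  \<comment> \<open>Without generators all truncations are stable families, so the chain condition
    makes A/B vanish in large degrees.\<close>
  define C where "C k n = (if n < k then A n else B n)" for k n :: nat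
  have "\<exists>K. \<forall>k\<ge>K. C k = C K"
  proof (rule graded_accD[OF Nil.prems(8)])
    show "between (set []) B A (C k)" for k
      using Nil.prems(2,3,4) by (intro betweenI stableI) (auto simp: C_def)
    show "C k n \<subseteq> C (Suc k) n" for k n using Nil.prems(4) by (auto simp: C_def)
  qed
  then obtain K where K: "\<And>k. k \<ge> K \<Longrightarrow> C k = C K" by blast
  have "A n = B n" if "n \<ge> K" for n
    using fun_cong[OF K[of "Suc n"], of n] that by (simp add: C_def)
  then have "int (the_enat (rlen (B n) (A n))) = binomial_fun 0 a n" if "n \<ge> K" for n a
    using that by (simp add: rlen_refl binomial_fun_def zero_enat_def)
  then show ?case by auto
next
  case (Cons z zs)
  have z: "z \<in> carrier R" and zsc: "set zs \<subseteq> carrier R" using Cons.prems by auto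
  note sA = Cons.prems(2) and sB = Cons.prems(3) and BA = Cons.prems(4) and fin = Cons.prems(5)
  have stA: "stable (set zs) A" and stB: "stable (set zs) B"
    using Cons.prems(6,7) unfolding stable_def by auto
  have zA: "scale z (A n) \<subseteq> A (Suc n)" and zB: "scale z (B n) \<subseteq> B (Suc n)" for n
    using Cons.prems(6,7) unfolding stable_def scale_def by auto
  define K where "K n = A n \<inter> colon (B (Suc n)) z" for n
  define B' where "B' = add_image z B A"
  have sK: "sub (K n)" for n unfolding K_def by (intro sub_Int sub_colon sA sB z)
  have BK: "B n \<subseteq> K n" for n
    using BA[of n] zB[of n] sub_subset[OF sB[of n]] unfolding K_def by (auto simp: colon_def scale_def)
  have sB': "sub (B' n)" for n unfolding B'_def by (cases n) (auto intro: sub_msum sub_scale sA sB z)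
  have BB': "B n \<subseteq> B' n" for n
  proof (cases n)
    case (Suc m)
    then show ?thesis unfolding B'_def using msum_upper1[OF sB sub_scale[OF z sA]] by simp
  qed (simp add: B'_def)
  have B'A: "B' n \<subseteq> A n" for n
  proof (cases n)
    case (Suc m)
    then show ?thesis unfolding B'_def using msum_least[OF sA BA zA] by simp
  qed (simp add: B'_def BA)
  have finle: "rlen P Q < \<infinity>" if "sub P" "sub Q" "B n \<subseteq> P" "P \<subseteq> Q" "Q \<subseteq> A n" for P Q n
  proof -
    have PA: "P \<subseteq> A n" using that by blast
    have "rlen P Q \<le> rlen P (A n)" by (rule rlen_mono_top[OF that(2,1) sA that(4,5)])
    also have "\<dots> \<le> rlen (B n) (A n)" by (rule rlen_mono_bot[OF that(1) sB sA that(3) PA])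
    finally show ?thesis using fin[of n] by (rule le_less_trans)
  qed
  have "\<exists>a N. \<forall>n\<ge>N. int (the_enat (rlen (B n) (K n))) = binomial_fun (length zs) a n"
  proof (rule Cons.IH[OF zsc sK sB BK])
    show "rlen (B n) (K n) < \<infinity>" for n
      by (rule finle[OF sB sK order_refl BK]) (simp add: K_def)
    show "stable (set zs) K"
    proof (rule stableI)
      fix y n u assume y: "y \<in> set zs" and "u \<in> K n"
      then have u: "u \<in> A n" "u \<in> carrier M" "z \<odot>\<^bsub>M\<^esub> u \<in> B (Suc n)" by (auto simp: K_def colon_def)
      have yc: "y \<in> carrier R" using y zsc by auto
      have "z \<odot>\<^bsub>M\<^esub> (y \<odot>\<^bsub>M\<^esub> u) \<in> B (Suc (Suc n))"
        unfolding smult_comm[OF z yc u(2)] by (rule stableD[OF stB y u(3)])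
      then show "y \<odot>\<^bsub>M\<^esub> u \<in> K (Suc n)"
        using stableD[OF stA y u(1)] yc u(2) by (auto simp: K_def colon_def)
    qed
    show "stable (set zs) B" by (rule stB)
    show "graded_acc (set zs) B K"
      unfolding graded_acc_def
    proof (intro allI impI)
      fix C assume C: "\<forall>k. between (set zs) B K (C k)" and mono: "\<forall>k n. C k n \<subseteq> C (Suc k) n"
      show "\<exists>L. \<forall>k\<ge>L. C k = C L"
      proof (rule graded_accD[OF Cons.prems(8)])
        fix k
        note bt = betweenD[OF C[rule_format, of k]]
        \<comment> \<open>As z maps K into B, families between B and K are stable under z
          automatically and inherit the chain condition for A/B.\<close>
        have zC: "z \<odot>\<^bsub>M\<^esub> u \<in> C k (Suc n)" if "u \<in> C k n" for u n
          using that bt(3)[of n] bt(2)[of "Suc n"] by (auto simp: K_def colon_def)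
        show "between (set (z # zs)) B A (C k)"
        proof (rule betweenI)
          show "C k n \<subseteq> A n" for n using bt(3)[of n] by (auto simp: K_def)
          show "stable (set (z # zs)) (C k)"
          proof (rule stableI)
            fix y n u assume "y \<in> set (z # zs)" "u \<in> C k n"
            then show "y \<odot>\<^bsub>M\<^esub> u \<in> C k (Suc n)" using zC stableD[OF bt(4)] by auto
          qed
        qed (rule bt)+
      qed (use mono in blast)
    qed
  qed
  then obtain a N where a: "\<And>n. n \<ge> N \<Longrightarrow> int (the_enat (rlen (B n) (K n))) = binomial_fun (length zs) a n"
    by blast
  have "\<exists>a N. \<forall>n\<ge>N. int (the_enat (rlen (B' n) (A n))) = binomial_fun (length zs) a n"
  proof (rule Cons.IH[OF zsc sA sB' B'A])
    show "rlen (B' n) (A n) < \<infinity>" for n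
      by (rule finle[OF sB' sA BB' B'A order_refl])
    show "stable (set zs) A" by (rule stA)
    show "stable (set zs) B'"
    proof (rule stableI)
      fix y n u assume y: "y \<in> set zs" and u: "u \<in> B' n"
      have yc: "y \<in> carrier R" using y zsc by auto
      show "y \<odot>\<^bsub>M\<^esub> u \<in> B' (Suc n)"
      proof (cases n)
        case 0
        then have "y \<odot>\<^bsub>M\<^esub> u \<in> B (Suc n)" using u stableD[OF stB y] by (simp add: B'_def)
        then show ?thesis using BB' by blast
      next
        case (Suc m)
        then have "u \<in> B n \<boxplus> scale z (A m)" using u by (simp add: B'_def)
        then obtain b w where bw: "b \<in> B n" "w \<in> scale z (A m)" "u = b \<oplus>\<^bsub>M\<^esub> w" by (rule msumE)
        obtain v where v: "v \<in> A m" "w = z \<odot>\<^bsub>M\<^esub> v" using bw(2) by (rule scaleE)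
        have c: "b \<in> carrier M" "v \<in> carrier M" using sub_carrier[OF sB bw(1)] sub_carrier[OF sA v(1)] .
        have "y \<odot>\<^bsub>M\<^esub> u = y \<odot>\<^bsub>M\<^esub> b \<oplus>\<^bsub>M\<^esub> z \<odot>\<^bsub>M\<^esub> (y \<odot>\<^bsub>M\<^esub> v)"
          unfolding bw(3) v(2) using c yc z by (simp add: smult_r_distr smult_comm)
        also have "\<dots> \<in> B (Suc n) \<boxplus> scale z (A n)"
          using stableD[OF stB y bw(1)] stableD[OF stA y v(1)] Suc by (intro msumI scaleI) auto
        finally show ?thesis by (simp add: B'_def)
      qed
    qed
    show "graded_acc (set zs) B' A"
      unfolding graded_acc_def
    proof (intro allI impI)
      fix C assume C: "\<forall>k. between (set zs) B' A (C k)" and mono: "\<forall>k n. C k n \<subseteq> C (Suc k) n"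
      show "\<exists>L. \<forall>k\<ge>L. C k = C L"
      proof (rule graded_accD[OF Cons.prems(8)])
        fix k
        note bt = betweenD[OF C[rule_format, of k]]
        \<comment> \<open>Here z maps A into B', which gives stability under z.\<close>
        have zC: "z \<odot>\<^bsub>M\<^esub> u \<in> C k (Suc n)" if u: "u \<in> C k n" for u n
        proof -
          have "z \<odot>\<^bsub>M\<^esub> u \<in> scale z (A n)" using u bt(3)[of n] by (auto intro: scaleI)
          then have "z \<odot>\<^bsub>M\<^esub> u \<in> B' (Suc n)"
            unfolding B'_def using msum_upper2[OF sB sub_scale[OF z sA]] by auto
          then show ?thesis using bt(2) by blast
        qed
        show "between (set (z # zs)) B A (C k)"
        proof (rule betweenI)
          show "B n \<subseteq> C k n" for n using bt(2)[of n] BB'[of n] by blast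
          show "stable (set (z # zs)) (C k)"
          proof (rule stableI)
            fix y n u assume "y \<in> set (z # zs)" "u \<in> C k n"
            then show "y \<odot>\<^bsub>M\<^esub> u \<in> C k (Suc n)" using zC stableD[OF bt(4)] by auto
          qed
        qed (rule bt)+
      qed (use mono in blast)
    qed
  qed
  then obtain b N' where b: "\<And>n. n \<ge> N' \<Longrightarrow> int (the_enat (rlen (B' n) (A n))) = binomial_fun (length zs) b n"
    by blast
  have len: "rlen (B (Suc n)) (A (Suc n)) + rlen (B n) (K n) =
      rlen (B n) (A n) + rlen (B' (Suc n)) (A (Suc n))" for n
  proof -
    have "rlen (B (Suc n)) (A (Suc n)) = rlen (B (Suc n)) (B' (Suc n)) + rlen (B' (Suc n)) (A (Suc n))"
      by (rule rlen_additive[OF sB' sB sA BB' B'A])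
    moreover have "rlen (B n) (A n) = rlen (B n) (K n) + rlen (K n) (A n)"
      by (rule rlen_additive[OF sK sB sA BK]) (simp add: K_def)
    moreover have "rlen (K n) (A n) = rlen (B (Suc n)) (B' (Suc n))"
    proof -
      have "rlen (scale z (K n) \<boxplus> B (Suc n)) (scale z (A n) \<boxplus> B (Suc n)) = rlen (K n) (A n)"
        by (rule rlen_image_eq[OF z sA sK sB]) (auto simp: K_def)
      moreover have "scale z (K n) \<boxplus> B (Suc n) = B (Suc n)"
        by (rule msum_absorb2[OF sub_scale[OF z sK] sB]) (auto simp: K_def scale_def colon_def)
      moreover have "scale z (A n) \<boxplus> B (Suc n) = B' (Suc n)"
        unfolding B'_def by (simp add: msum_commute[OF sB sub_scale[OF z sA]])
      ultimately show ?thesis by simp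
    qed
    ultimately show ?thesis by (simp add: ac_simps)
  qed
  have step: "int (the_enat (rlen (B (Suc n)) (A (Suc n)))) - int (the_enat (rlen (B n) (A n))) =
      int (the_enat (rlen (B' (Suc n)) (A (Suc n)))) - int (the_enat (rlen (B n) (K n)))" for n
  proof -
    obtain p q r s where e: "rlen (B (Suc n)) (A (Suc n)) = enat p" "rlen (B n) (A n) = enat q"
      "rlen (B' (Suc n)) (A (Suc n)) = enat r" "rlen (B n) (K n) = enat s"
      using fin[of n] fin[of "Suc n"] finle[OF sB' sA BB' B'A order_refl, of "Suc n"]
        finle[OF sB sK order_refl BK, of n] by (auto simp: K_def elim!: less_infinityE)
    then have "p + s = q + r" using len[of n] by simp
    then show ?thesis unfolding e by simp
  qed
  \<comment> \<open>The kernel enters in degree n, the cokernel in degree n + 1; both are expressed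
    at n + 1.\<close>
  obtain a' where a': "\<And>n. binomial_fun (length zs) a n = binomial_fun (length zs) a' (Suc n)"
    using binomial_fun_shift by blast
  have "\<exists>c. \<forall>n\<ge>max N N'. int (the_enat (rlen (B n) (A n))) = binomial_fun (Suc (length zs)) c n"
  proof (rule binomial_fun_sum)
    fix n assume "max N N' \<le> n"
    then have "int (the_enat (rlen (B (Suc n)) (A (Suc n)))) - int (the_enat (rlen (B n) (A n))) =
        binomial_fun (length zs) b (Suc n) - binomial_fun (length zs) a' (Suc n)"
      unfolding step using a[of n] b[of "Suc n"] a' by simp
    then show "int (the_enat (rlen (B (Suc n)) (A (Suc n)))) - int (the_enat (rlen (B n) (A n))) =
        binomial_fun (length zs) (\<lambda>i. b i - a' i) (Suc n)"
      unfolding binomial_fun_diff .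
  qed
  then obtain c where "\<forall>n\<ge>max N N'. int (the_enat (rlen (B n) (A n))) = binomial_fun (length (z # zs)) c n"
    by auto
  then show ?case by (intro exI)
qed

end

section \<open>The associated graded module of an ideal\<close>

context noetherian_module
begin

text \<open>Modulo all generators the associated graded module is M/JM in degree 0 and zero
  elsewhere, so the chain condition is that of M. The generators are then restored one at a time by
  \<open>graded_acc_add_image\<close>.\<close>

lemma graded_acc_pw:
  assumes zs: "set zs \<subseteq> carrier R"
  shows "graded_acc (set zs) (\<lambda>n. pw zs (Suc n) (carrier M)) (\<lambda>n. pw zs n (carrier M))"
proof -
  note M = carrier_is_submodule
  define A where "A n = pw zs n (carrier M)" for n
  \<comment> \<open>The associated graded module divided by the generators in \<open>ys\<close>: in
    degree n > 0 the submodule (ys) J^(n-1) M is added to J^(n+1) M.\<close>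
  define B where "B ys n = (case n of 0 \<Rightarrow> A 1 | Suc m \<Rightarrow> A (Suc n) \<boxplus> lmul ys (A m))" for ys n
  have sA: "sub (A n)" for n unfolding A_def by (intro sub_pw zs M)
  have A_Suc: "A (Suc n) = lmul zs (A n)" for n by (simp add: A_def pw_Suc)
  have in_lmul: "z \<odot>\<^bsub>M\<^esub> u \<in> lmul zs K" if "z \<in> set zs" "u \<in> K" "sub K" for z u K
  proof -
    have "z \<odot>\<^bsub>M\<^esub> u \<in> idl_mult (Idl (set zs)) K"
      using that genideal_self[OF zs] by (intro idl_multI) auto
    then show ?thesis unfolding idl_mult_genideal[OF zs that(3)] .
  qed
  have stA: "stable (set zs) A"
    by (rule stableI) (auto simp: A_Suc intro: in_lmul sA)
  have sB: "sub (B ys n)" if "set ys \<subseteq> set zs" for ys n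
    using that zs unfolding B_def by (cases n) (auto intro!: sub_msum sA sub_lmul)
  have stB: "stable (set zs) (B ys)" if ys: "set ys \<subseteq> set zs" for ys
  proof (rule stableI)
    fix z n u assume z: "z \<in> set zs" and u: "u \<in> B ys n"
    have zc: "z \<in> carrier R" and ysc: "set ys \<subseteq> carrier R" using z ys zs by auto
    show "z \<odot>\<^bsub>M\<^esub> u \<in> B ys (Suc n)"
    proof (cases n)
      case 0
      then have "z \<odot>\<^bsub>M\<^esub> u \<in> A (Suc (Suc n))" using u stableD[OF stA z, of u 1] by (simp add: B_def)
      then show ?thesis
        unfolding B_def using msum_upper1[OF sA sub_lmul[OF ysc sA]] by auto
    next
      case (Suc m)
      then have "u \<in> A (Suc n) \<boxplus> lmul ys (A m)" using u by (simp add: B_def)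
      then obtain v w where vw: "v \<in> A (Suc n)" "w \<in> lmul ys (A m)" "u = v \<oplus>\<^bsub>M\<^esub> w" by (rule msumE)
      have c: "v \<in> carrier M" "w \<in> carrier M"
        using sub_carrier[OF sA vw(1)] sub_carrier[OF sub_lmul[OF ysc sA] vw(2)] .
      have "scale z (A m) \<subseteq> A n" unfolding Suc using stableD[OF stA z] by (auto simp: scale_def)
      then have "lmul ys (scale z (A m)) \<subseteq> lmul ys (A n)" by (rule lmul_mono)
      then have "z \<odot>\<^bsub>M\<^esub> w \<in> lmul ys (A n)"
        unfolding lmul_scale[OF ysc zc sA] using scaleI[OF vw(2)] by blast
      then have "z \<odot>\<^bsub>M\<^esub> v \<oplus>\<^bsub>M\<^esub> z \<odot>\<^bsub>M\<^esub> w \<in> A (Suc (Suc n)) \<boxplus> lmul ys (A n)"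
        using stableD[OF stA z vw(1)] by (intro msumI)
      then show ?thesis unfolding vw(3) smult_r_distr[OF zc c] by (simp add: B_def)
    qed
  qed
  have full: "graded_acc (set zs) (B zs) A"
    unfolding graded_acc_def
  proof (intro allI impI)
    fix C assume C: "\<forall>k. between (set zs) (B zs) A (C k)" and mono: "\<forall>k n. C k n \<subseteq> C (Suc k) n"
    have sC: "sub (C k n)" and BC: "B zs n \<subseteq> C k n" and CA: "C k n \<subseteq> A n" for k n
      using betweenD[OF C[rule_format, of k]] by simp_all
    have pos: "C k (Suc m) = A (Suc m)" for k m
    proof
      have "A (Suc m) \<subseteq> B zs (Suc m)"
        unfolding B_def using msum_upper2[OF sA[of "Suc (Suc m)"] sub_lmul[OF zs sA[of m]]] by (simp add: A_Suc)
      then show "A (Suc m) \<subseteq> C k (Suc m)" using BC by blast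
    qed (rule CA)
    have "\<exists>K. \<forall>k\<ge>K. C k 0 = C K 0"
      by (rule acc[of "\<lambda>k. C k 0"]) (use sC mono in auto)
    then obtain K where K: "\<And>k. k \<ge> K \<Longrightarrow> C k 0 = C K 0" by blast
    have "C k = C K" if "k \<ge> K" for k
    proof
      fix n show "C k n = C K n" using K[OF that] pos by (cases n) auto
    qed
    then show "\<exists>K. \<forall>k\<ge>K. C k = C K" by blast
  qed
  have step: "graded_acc (set zs) (B ys) A \<Longrightarrow> graded_acc (set zs) (B []) A" if "set ys \<subseteq> set zs" for ys
    using that
  proof (induction ys)
    case (Cons y ys)
    have y: "y \<in> set zs" and ys: "set ys \<subseteq> set zs" using Cons.prems by auto
    have ysc: "set ys \<subseteq> carrier R" and yc: "y \<in> carrier R" using y ys zs by auto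
    have "B (y # ys) n = add_image y (B ys) A n" for n
    proof (cases n)
      case (Suc m)
      have "A (Suc n) \<boxplus> (scale y (A m) \<boxplus> lmul ys (A m)) = A (Suc n) \<boxplus> (lmul ys (A m) \<boxplus> scale y (A m))"
        by (simp add: msum_commute[OF sub_scale[OF yc sA] sub_lmul[OF ysc sA]])
      also have "\<dots> = (A (Suc n) \<boxplus> lmul ys (A m)) \<boxplus> scale y (A m)"
        by (rule msum_assoc[symmetric, OF sA sub_lmul[OF ysc sA] sub_scale[OF yc sA]])
      finally show ?thesis using Suc by (simp add: B_def)
    qed (simp add: B_def)
    then have "B (y # ys) = add_image y (B ys) A" by blast
    then have "graded_acc (set zs) (B ys) A"
      using Cons.prems by (intro graded_acc_add_image[OF sA stA sB[OF ys] stB[OF ys] y zs]) simp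
    then show ?case using Cons.IH ys by blast
  qed
  have "B [] n = A (Suc n)" for n
  proof (cases n)
    case (Suc m)
    then show ?thesis using msum_absorb1[OF sA sub_zero_set] sub_zero[OF sA] by (simp add: B_def)
  qed (simp add: B_def)
  then have "B [] = (\<lambda>n. A (Suc n))" by blast
  then have "graded_acc (set zs) (\<lambda>n. A (Suc n)) A" using step[OF subset_refl full] by simp
  then show ?thesis unfolding A_def .
qed

text \<open>The first difference of g is the Hilbert function of the associated graded
  module.\<close>

theorem hilbert_samuel_eventually_binomial:
  assumes zs: "set zs \<subseteq> carrier R"
    and g: "\<And>n. rlen (pw zs (Suc n) (carrier M)) (carrier M) = enat (g n)"
  shows "\<exists>a N. \<forall>n\<ge>N. int (g n) = binomial_fun (Suc (length zs)) a n"
proof -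
  note M = carrier_is_submodule
  define A where "A n = pw zs n (carrier M)" for n
  have sA: "sub (A n)" for n unfolding A_def by (intro sub_pw zs M)
  have A_le: "A (Suc n) \<subseteq> A n" for n unfolding A_def by (intro pw_antimono zs M) simp
  have add: "rlen (A (Suc (Suc n))) (carrier M) = rlen (A (Suc (Suc n))) (A (Suc n)) + rlen (A (Suc n)) (carrier M)" for n
    by (rule rlen_additive[OF sA sA M A_le sub_subset[OF sA]])
  have fin: "rlen (A (Suc n)) (A n) < \<infinity>" for n
  proof -
    have "rlen (A (Suc n)) (A n) \<le> rlen (A (Suc n)) (carrier M)"
      by (rule rlen_mono_top[OF sA sA M A_le sub_subset[OF sA]])
    also have "\<dots> < \<infinity>" using g[of n] by (simp add: A_def)
    finally show ?thesis .
  qed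
  have acc: "graded_acc (set zs) (\<lambda>n. A (Suc n)) A"
    unfolding A_def by (rule graded_acc_pw[OF zs])
  have st: "stable (set zs) A"
  proof (rule stableI)
    fix z n u assume "z \<in> set zs" "u \<in> A n"
    then have "z \<odot>\<^bsub>M\<^esub> u \<in> idl_mult (Idl (set zs)) (A n)"
      using genideal_self[OF zs] by (intro idl_multI) auto
    then show "z \<odot>\<^bsub>M\<^esub> u \<in> A (Suc n)" unfolding idl_mult_genideal[OF zs sA] by (simp add: A_def pw_Suc)
  qed
  have st': "stable (set zs) (\<lambda>n. A (Suc n))" using st unfolding stable_def by blast
  obtain a N where aN: "\<And>n. n \<ge> N \<Longrightarrow> int (the_enat (rlen (A (Suc n)) (A n))) = binomial_fun (length zs) a n"
    using hilbert_serre[OF zs sA sA A_le fin st st' acc] by blast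
  have "\<exists>b. \<forall>n\<ge>N. int (g n) = binomial_fun (Suc (length zs)) b n"
  proof (rule binomial_fun_sum)
    fix n assume n: "N \<le> n"
    have "enat (g (Suc n)) = rlen (A (Suc (Suc n))) (A (Suc n)) + enat (g n)"
      using add[of n] g[of n] g[of "Suc n"] by (simp add: A_def)
    then have "int (g (Suc n)) - int (g n) = int (the_enat (rlen (A (Suc (Suc n))) (A (Suc n))))"
      by (cases "rlen (A (Suc (Suc n))) (A (Suc n))") auto
    then show "int (g (Suc n)) - int (g n) = binomial_fun (length zs) a (Suc n)"
      using aN[of "Suc n"] n by simp
  qed
  then show ?thesis by blast
qed

end

section \<open>Quotient modules and binomial bases\<close>

context module
begin

text \<open>Connects the recursion, which removes the top step, with the indexed ascending chains in
  \<open>module_length\<close>.\<close>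

lemma has_chain_iff:
  assumes "sub A"
  shows "has_chain n B A \<longleftrightarrow>
    (\<exists>D. (\<forall>i\<le>n. sub (D i)) \<and> (\<forall>i<n. D i \<subset> D (Suc i)) \<and> B \<subseteq> D 0 \<and> D n \<subseteq> A)"
  using assms
proof (induction n arbitrary: A)
  case 0
  then show ?case by (auto intro!: exI[of _ "\<lambda>_. A"])
next
  case (Suc n)
  show ?case
  proof
    assume "has_chain (Suc n) B A"
    then obtain C where C: "sub C" "C \<subset> A" "has_chain n B C" by auto
    then obtain D where D: "\<forall>i\<le>n. sub (D i)" "\<forall>i<n. D i \<subset> D (Suc i)" "B \<subseteq> D 0" "D n \<subseteq> C"
      using Suc.IH[OF C(1)] by auto
    define D' where "D' = D(Suc n := A)"
    have "\<forall>i\<le>Suc n. sub (D' i)" using D(1) Suc.prems by (auto simp: D'_def le_Suc_eq)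
    moreover have "D n \<subset> A" using D(4) C(2) by (rule subset_psubset_trans)
    then have "\<forall>i<Suc n. D' i \<subset> D' (Suc i)" using D(2) by (auto simp: D'_def less_Suc_eq)
    moreover have "B \<subseteq> D' 0" "D' (Suc n) \<subseteq> A" using D(3) by (auto simp: D'_def)
    ultimately show "\<exists>D. (\<forall>i\<le>Suc n. sub (D i)) \<and> (\<forall>i<Suc n. D i \<subset> D (Suc i)) \<and> B \<subseteq> D 0 \<and> D (Suc n) \<subseteq> A"
      by (intro exI[of _ D'] conjI)
  next
    assume "\<exists>D. (\<forall>i\<le>Suc n. sub (D i)) \<and> (\<forall>i<Suc n. D i \<subset> D (Suc i)) \<and> B \<subseteq> D 0 \<and> D (Suc n) \<subseteq> A"
    then obtain D where D: "\<forall>i\<le>Suc n. sub (D i)" "\<forall>i<Suc n. D i \<subset> D (Suc i)" "B \<subseteq> D 0" "D (Suc n) \<subseteq> A"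
      by (elim exE conjE)
    have s: "sub (D n)" using D(1) by simp
    have "has_chain n B (D n)"
      unfolding Suc.IH[OF s] using D(1-3) by (intro exI[of _ D] conjI) auto
    moreover have "D n \<subset> D (Suc n)" using D(2) by simp
    then have "D n \<subset> A" using D(4) by (rule psubset_subset_trans)
    ultimately show "has_chain (Suc n) B A" unfolding has_chain.simps using s by (intro exI[of _ "D n"] conjI)
  qed
qed

context
  fixes N assumes N: "sub N"
begin

abbreviation (input) "coset u \<equiv> N +>\<^bsub>M\<^esub> u"

lemma abelian_subgroup_N: "abelian_subgroup N M"
proof (rule abelian_subgroupI3)
  show "additive_subgroup N M" unfolding additive_subgroup_def using N by (rule submodule.axioms(1))
  show "abelian_group M" by unfold_locales
qed

lemma coset_eq_iff:
  assumes "u \<in> carrier M" "v \<in> carrier M"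
  shows "coset u = coset v \<longleftrightarrow> u \<ominus>\<^bsub>M\<^esub> v \<in> N"
proof -
  interpret abelian_subgroup N M by (rule abelian_subgroup_N)
  show ?thesis
    using a_rcos_module[OF assms(2,1)] a_repr_independence'[of u v] a_repr_independenceD[of u v] assms
    by (auto simp: a_minus_def)
qed

lemma coset_zero: "coset \<zero>\<^bsub>M\<^esub> = N"
proof -
  interpret abelian_subgroup N M by (rule abelian_subgroup_N)
  show ?thesis by (rule a_rcos_const) (rule sub_zero[OF N])
qed

lemma carrier_quot: "carrier (quot_module M N) = (\<lambda>u. coset u) ` carrier M"
  by (auto simp: quot_module_def A_RCOSETS_def')

lemma coset_add:
  assumes "u \<in> carrier M" "v \<in> carrier M"
  shows "coset u \<oplus>\<^bsub>quot_module M N\<^esub> coset v = coset (u \<oplus>\<^bsub>M\<^esub> v)"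
proof -
  interpret abelian_subgroup N M by (rule abelian_subgroup_N)
  show ?thesis using a_rcos_sum[OF assms] by (simp add: quot_module_def)
qed

lemma coset_smult:
  assumes "a \<in> carrier R" "u \<in> carrier M"
  shows "a \<odot>\<^bsub>quot_module M N\<^esub> coset u = coset (a \<odot>\<^bsub>M\<^esub> u)"
proof -
  interpret abelian_subgroup N M by (rule abelian_subgroup_N)
  have "coset (a \<odot>\<^bsub>M\<^esub> v) = coset (a \<odot>\<^bsub>M\<^esub> u)" if v: "v \<in> coset u" for v
  proof -
    have vc: "v \<in> carrier M" using v assms(2) a_elemrcos_carrier by blast
    have "v \<ominus>\<^bsub>M\<^esub> u \<in> N" using a_rcos_module[OF assms(2) vc] v by (simp add: a_minus_def)
    then have "a \<odot>\<^bsub>M\<^esub> v \<ominus>\<^bsub>M\<^esub> a \<odot>\<^bsub>M\<^esub> u \<in> N"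
      using sub_smult[OF N assms(1)] smult_diff[OF assms(1) vc assms(2)] by metis
    then show ?thesis using coset_eq_iff assms vc by simp
  qed
  moreover have "u \<in> coset u" using a_rcos_self[OF assms(2)] .
  ultimately have "(\<Union>v\<in>coset u. coset (a \<odot>\<^bsub>M\<^esub> v)) = coset (a \<odot>\<^bsub>M\<^esub> u)" by blast
  then show ?thesis by (simp add: quot_module_def)
qed

lemma zero_quot: "\<zero>\<^bsub>quot_module M N\<^esub> = N"
  by (simp add: quot_module_def)

text \<open>Besides the action on cosets, \<open>submodule\<close> refers only to the additive group
  of the record, and this is the factor group of the additive group of M by N.\<close>

lemma group_quot: "group (add_monoid (quot_module M N))"
proof -
  interpret abelian_subgroup N M by (rule abelian_subgroup_N)
  have "group (add_monoid M Mod N)" by (rule normal.factorgroup_is_group[OF a_normal])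
  then show ?thesis
    by (simp add: group_def monoid_def group_axioms_def Units_def
        FactGroup_def quot_module_def A_RCOSETS_def set_add_def)
qed

lemma coset_neg:
  assumes "u \<in> carrier M"
  shows "inv\<^bsub>add_monoid (quot_module M N)\<^esub> (coset u) = coset (\<ominus>\<^bsub>M\<^esub> u)"
proof (rule group.inv_equality[OF group_quot])
  show "coset (\<ominus>\<^bsub>M\<^esub> u) \<otimes>\<^bsub>add_monoid (quot_module M N)\<^esub> coset u = \<one>\<^bsub>add_monoid (quot_module M N)\<^esub>"
    using assms coset_add[of "\<ominus>\<^bsub>M\<^esub> u" u] by (simp add: M.l_neg coset_zero zero_quot)
qed (use assms in \<open>auto simp: carrier_quot\<close>)

lemma submodule_quot_image:
  assumes C: "sub C"
  shows "submodule ((\<lambda>u. coset u) ` C) R (quot_module M N)"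
proof (rule submodule.intro)
  show "subgroup ((\<lambda>u. coset u) ` C) (add_monoid (quot_module M N))"
  proof (rule group.subgroupI[OF group_quot])
    show "(\<lambda>u. coset u) ` C \<subseteq> carrier (add_monoid (quot_module M N))"
      using sub_subset[OF C] by (auto simp: carrier_quot)
    show "(\<lambda>u. coset u) ` C \<noteq> {}" using sub_zero[OF C] by auto
    fix a assume "a \<in> (\<lambda>u. coset u) ` C"
    then obtain u where u: "u \<in> C" "a = coset u" by auto
    then show "inv\<^bsub>add_monoid (quot_module M N)\<^esub> a \<in> (\<lambda>u. coset u) ` C"
      using coset_neg[OF sub_carrier[OF C u(1)]] sub_neg[OF C u(1)] by auto
    fix b assume "b \<in> (\<lambda>u. coset u) ` C"
    then obtain v where v: "v \<in> C" "b = coset v" by auto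
    have "a \<otimes>\<^bsub>add_monoid (quot_module M N)\<^esub> b = coset (u \<oplus>\<^bsub>M\<^esub> v)"
      using coset_add[OF sub_carrier[OF C u(1)] sub_carrier[OF C v(1)]] u v by simp
    then show "a \<otimes>\<^bsub>add_monoid (quot_module M N)\<^esub> b \<in> (\<lambda>u. coset u) ` C"
      using sub_add[OF C u(1) v(1)] by auto
  qed
  show "submodule_axioms ((\<lambda>u. coset u) ` C) R (quot_module M N)"
  proof
    fix a w assume a: "a \<in> carrier R" and "w \<in> (\<lambda>u. coset u) ` C"
    then obtain u where u: "u \<in> C" "w = coset u" by auto
    then show "a \<odot>\<^bsub>quot_module M N\<^esub> w \<in> (\<lambda>u. coset u) ` C"
      using coset_smult[OF a sub_carrier[OF C u(1)]] sub_smult[OF C a u(1)] by auto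
  qed
qed

lemma sub_preimage_quot:
  assumes H: "submodule H R (quot_module M N)"
  shows "sub {u \<in> carrier M. coset u \<in> H}" "N \<subseteq> {u \<in> carrier M. coset u \<in> H}"
proof -
  have sg: "subgroup H (add_monoid (quot_module M N))" using H by (rule submodule.axioms(1))
  have NH: "N \<in> H" using subgroup.one_closed[OF sg] by (simp add: zero_quot)
  show "sub {u \<in> carrier M. coset u \<in> H}"
  proof (rule submoduleI)
    show "\<zero>\<^bsub>M\<^esub> \<in> {u \<in> carrier M. coset u \<in> H}" using NH by (simp add: coset_zero)
    fix u assume u: "u \<in> {u \<in> carrier M. coset u \<in> H}"
    then show "\<ominus>\<^bsub>M\<^esub> u \<in> {u \<in> carrier M. coset u \<in> H}"
      using subgroup.m_inv_closed[OF sg, of "coset u"] coset_neg[of u] by simp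
    fix v assume v: "v \<in> {u \<in> carrier M. coset u \<in> H}"
    then show "u \<oplus>\<^bsub>M\<^esub> v \<in> {u \<in> carrier M. coset u \<in> H}"
      using u subgroup.m_closed[OF sg, of "coset u" "coset v"] coset_add[of u v] by simp
  next
    fix a u assume "a \<in> carrier R" "u \<in> {u \<in> carrier M. coset u \<in> H}"
    then show "a \<odot>\<^bsub>M\<^esub> u \<in> {u \<in> carrier M. coset u \<in> H}"
      using submodule.smult_closed[OF H, of a "coset u"] coset_smult[of a u] by simp
  qed auto
  show "N \<subseteq> {u \<in> carrier M. coset u \<in> H}"
  proof
    fix u assume u: "u \<in> N"
    then have "coset u = coset \<zero>\<^bsub>M\<^esub>"
      using coset_eq_iff[OF sub_carrier[OF N u] M.zero_closed] sub_diff[OF N u sub_zero[OF N]] by blast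
    then show "u \<in> {u \<in> carrier M. coset u \<in> H}" using u sub_carrier[OF N u] NH by (simp add: coset_zero)
  qed
qed

text \<open>The correspondence theorem for chains: preimages of submodules of M/N contain N, and
  images of submodules containing N remain strictly ordered.\<close>

lemma module_length_quot: "module_length R (quot_module M N) = rlen N (carrier M)"
proof -
  have "(\<exists>C :: nat \<Rightarrow> 'c set set. (\<forall>i\<le>n. submodule (C i) R (quot_module M N)) \<and> (\<forall>i<n. C i \<subset> C (Suc i)))
      \<longleftrightarrow> has_chain n N (carrier M)" for n
    unfolding has_chain_iff[OF carrier_is_submodule]
  proof
    assume "\<exists>C :: nat \<Rightarrow> 'c set set. (\<forall>i\<le>n. submodule (C i) R (quot_module M N)) \<and> (\<forall>i<n. C i \<subset> C (Suc i))"
    then obtain C :: "nat \<Rightarrow> 'c set set" where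
      C: "\<forall>i\<le>n. submodule (C i) R (quot_module M N)" "\<forall>i<n. C i \<subset> C (Suc i)"
      by (elim exE conjE)
    define D where "D i = {u \<in> carrier M. coset u \<in> C i}" for i
    have "D i \<subset> D (Suc i)" if i: "i < n" for i
    proof -
      obtain w where w: "w \<in> C (Suc i)" "w \<notin> C i" and le: "C i \<subseteq> C (Suc i)" using C(2) i by blast
      have "submodule (C (Suc i)) R (quot_module M N)" using C(1) i by simp
      then have "C (Suc i) \<subseteq> carrier (quot_module M N)"
        using submodule.axioms(1) subgroup.subset by fastforce
      then obtain u where "u \<in> carrier M" "w = coset u" using w(1) carrier_quot by auto
      then have "u \<in> D (Suc i)" "u \<notin> D i" using w by (auto simp: D_def)
      moreover have "D i \<subseteq> D (Suc i)" using le by (auto simp: D_def)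
      ultimately show ?thesis by blast
    qed
    moreover have "sub (D i)" if "i \<le> n" for i
      unfolding D_def using C(1) that by (intro sub_preimage_quot) simp
    moreover have "N \<subseteq> D 0" unfolding D_def using C(1) by (intro sub_preimage_quot) simp
    moreover have "D n \<subseteq> carrier M" by (auto simp: D_def)
    ultimately show "\<exists>D. (\<forall>i\<le>n. sub (D i)) \<and> (\<forall>i<n. D i \<subset> D (Suc i)) \<and> N \<subseteq> D 0 \<and> D n \<subseteq> carrier M"
      by (intro exI[of _ D]) blast
  next
    assume "\<exists>D. (\<forall>i\<le>n. sub (D i)) \<and> (\<forall>i<n. D i \<subset> D (Suc i)) \<and> N \<subseteq> D 0 \<and> D n \<subseteq> carrier M"
    then obtain D where D: "\<forall>i\<le>n. sub (D i)" "\<forall>i<n. D i \<subset> D (Suc i)" "N \<subseteq> D 0"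
      by (elim exE conjE)
    have ND: "N \<subseteq> D i" if "i \<le> n" for i
      using that
    proof (induction i)
      case (Suc i)
      then have "N \<subseteq> D i" "D i \<subset> D (Suc i)" using D(2) by simp_all
      then show ?case by blast
    qed (use D in simp)
    define C where "C i = (\<lambda>u. coset u) ` D i" for i
    have "C i \<subset> C (Suc i)" if i: "i < n" for i
    proof -
      have s: "sub (D i)" "sub (D (Suc i))" using D(1) i by simp_all
      obtain w where w: "w \<in> D (Suc i)" "w \<notin> D i" and le: "D i \<subseteq> D (Suc i)" using D(2) i by blast
      have wc: "w \<in> carrier M" using sub_carrier[OF s(2) w(1)] .
      have "coset w \<notin> C i"
      proof
        assume "coset w \<in> C i"
        then obtain v where v: "v \<in> D i" "coset w = coset v" by (auto simp: C_def)
        have vc: "v \<in> carrier M" using sub_carrier[OF s(1) v(1)] .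
        \<comment> \<open>Equal cosets differ by an element of N, and N lies in every member of the
          chain; so w would already be in \<open>D i\<close>.\<close>
        have "w \<ominus>\<^bsub>M\<^esub> v \<in> D i" using coset_eq_iff[OF wc vc] v(2) ND[of i] i by auto
        then show False using sub_diff_cancel[OF s(1) v(1) wc] w(2) by simp
      qed
      moreover have "coset w \<in> C (Suc i)" using w(1) by (auto simp: C_def)
      moreover have "C i \<subseteq> C (Suc i)" unfolding C_def using le by (rule image_mono)
      ultimately show ?thesis by blast
    qed
    moreover have "submodule (C i) R (quot_module M N)" if "i \<le> n" for i
      unfolding C_def using D(1) that by (intro submodule_quot_image) simp
    ultimately show "\<exists>C :: nat \<Rightarrow> 'c set set. (\<forall>i\<le>n. submodule (C i) R (quot_module M N)) \<and> (\<forall>i<n. C i \<subset> C (Suc i))"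
      by (intro exI[of _ C]) blast
  qed
  then have "{enat n | n. \<exists>C :: nat \<Rightarrow> 'c set set. (\<forall>i\<le>n. submodule (C i) R (quot_module M N)) \<and>
      (\<forall>i<n. C i \<subset> C (Suc i))} = enat ` {n. has_chain n N (carrier M)}"
    by auto
  then show ?thesis unfolding module_length_def rlen_def by simp
qed

lemma regular_on_quot_iff:
  assumes "a \<in> carrier R"
  shows "(\<forall>y\<in>carrier (quot_module M N). a \<odot>\<^bsub>quot_module M N\<^esub> y = \<zero>\<^bsub>quot_module M N\<^esub> \<longrightarrow>
      y = \<zero>\<^bsub>quot_module M N\<^esub>) \<longleftrightarrow> reg a N"
proof -
  have zero: "coset u = N \<longleftrightarrow> u \<in> N" if "u \<in> carrier M" for u
    using coset_eq_iff[OF that M.zero_closed] sub_diff[OF N _ sub_zero[OF N], of u]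
      sub_diff_cancel[OF N sub_zero[OF N] that] by (auto simp: coset_zero)
  show ?thesis
    unfolding carrier_quot zero_quot reg_def using assms by (simp add: coset_smult zero)
qed

end

section \<open>Translation of regular sequences and Hilbert-Samuel functions\<close>

lemma ideal_smult_eq: "ideal_smult R I M = idl_mult I (carrier M)"
  by (simp add: ideal_smult_def idl_mult_def)

lemma ideal_smult_genideal: "set xs \<subseteq> carrier R \<Longrightarrow> ideal_smult R (Idl (set xs)) M = lmul xs (carrier M)"
  unfolding ideal_smult_eq by (rule idl_mult_genideal[OF _ carrier_is_submodule])

lemma lmul_cong_set:
  assumes "set xs \<subseteq> carrier R" "set ys = set xs" "sub K"
  shows "lmul xs K = lmul ys K"
  using idl_mult_genideal[OF assms(1,3)] idl_mult_genideal[of ys K] assms by simp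

lemma regular_sequence_iff:
  assumes xs: "set xs \<subseteq> carrier R"
  shows "regular_sequence R M xs \<longleftrightarrow>
    (\<forall>i<length xs. reg (xs ! i) (lmul (take i xs) (carrier M))) \<and> lmul xs (carrier M) \<noteq> carrier M"
proof -
  have "(\<forall>y\<in>carrier (quot_by_ideal R M (Idl (set (take i xs)))).
      (xs ! i) \<odot>\<^bsub>quot_by_ideal R M (Idl (set (take i xs)))\<^esub> y = \<zero>\<^bsub>quot_by_ideal R M (Idl (set (take i xs)))\<^esub> \<longrightarrow>
      y = \<zero>\<^bsub>quot_by_ideal R M (Idl (set (take i xs)))\<^esub>) \<longleftrightarrow> reg (xs ! i) (lmul (take i xs) (carrier M))"
    if i: "i < length xs" for i
  proof -
    have t: "set (take i xs) \<subseteq> carrier R" using xs set_take_subset by fast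
    have xi: "xs ! i \<in> carrier R" using xs i by auto
    show ?thesis
      unfolding quot_by_ideal_def ideal_smult_genideal[OF t]
      by (rule regular_on_quot_iff[OF sub_lmul[OF t carrier_is_submodule] xi])
  qed
  then show ?thesis
    unfolding regular_sequence_def Let_def ideal_smult_genideal[OF xs] using xs by simp
qed

lemma idl_mult_ideal_prod:
  assumes I: "ideal I R" and zs: "set zs \<subseteq> carrier R"
  shows "idl_mult (I \<cdot> (Idl (set zs))) (carrier M) = lmul zs (idl_mult I (carrier M))"
proof -
  define J where "J = Idl (set zs)"
  define F where "F = idl_mult I (carrier M)"
  have J: "ideal J R" unfolding J_def using zs by (rule genideal_ideal)
  have Ic: "I \<subseteq> carrier R" and Jc: "J \<subseteq> carrier R" using ideal.Icarr[OF I] ideal.Icarr[OF J] by auto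
  have IJ: "I \<cdot> J \<subseteq> carrier R" by (rule ideal_prod_in_carrier[OF I J])
  have sF: "sub F" unfolding F_def by (intro sub_idl_mult Ic) simp
  have sJF: "sub (idl_mult J F)" by (intro sub_idl_mult Jc sub_subset sF)
  have sIJ: "sub (idl_mult (I \<cdot> J) (carrier M))" by (intro sub_idl_mult IJ) simp
  have "idl_mult (I \<cdot> J) (carrier M) \<subseteq> idl_mult J F"
  proof (rule idl_mult_least[OF sJF])
    fix c u assume c: "c \<in> I \<cdot> J" and u: "u \<in> carrier M"
    from c show "c \<odot>\<^bsub>M\<^esub> u \<in> idl_mult J F"
    proof (induction rule: ideal_prod.induct)
      case (prod i j)
      have "(i \<otimes> j) \<odot>\<^bsub>M\<^esub> u = j \<odot>\<^bsub>M\<^esub> (i \<odot>\<^bsub>M\<^esub> u)"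
        using prod Ic Jc u smult_comm[of i j u] by (simp add: subset_iff smult_assoc1)
      moreover have "i \<odot>\<^bsub>M\<^esub> u \<in> F" unfolding F_def using prod u by (intro idl_multI)
      ultimately show ?case using idl_multI[OF prod(2)] by simp
    next
      case (sum s t)
      have "(s \<oplus> t) \<odot>\<^bsub>M\<^esub> u = s \<odot>\<^bsub>M\<^esub> u \<oplus>\<^bsub>M\<^esub> t \<odot>\<^bsub>M\<^esub> u"
        using sum.hyps IJ u by (intro smult_l_distr) auto
      then show ?case using sub_add[OF sJF sum.IH] by simp
    qed
  qed
  moreover have "idl_mult J F \<subseteq> idl_mult (I \<cdot> J) (carrier M)"
  proof (rule idl_mult_least[OF sIJ])
    fix j w assume j: "j \<in> J" and w: "w \<in> F"
    have jc: "j \<in> carrier R" using j Jc by auto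
    have "F \<subseteq> colon (idl_mult (I \<cdot> J) (carrier M)) j"
      unfolding F_def
    proof (rule idl_mult_least[OF sub_colon[OF jc sIJ]])
      fix i u assume i: "i \<in> I" and u: "u \<in> carrier M"
      have ic: "i \<in> carrier R" using i Ic by auto
      have "(i \<otimes> j) \<odot>\<^bsub>M\<^esub> u \<in> idl_mult (I \<cdot> J) (carrier M)"
        by (rule idl_multI[OF ideal_prod.prod[OF i j] u])
      moreover have "(i \<otimes> j) \<odot>\<^bsub>M\<^esub> u = j \<odot>\<^bsub>M\<^esub> (i \<odot>\<^bsub>M\<^esub> u)"
        using ic jc u smult_comm[of i j u] by (simp add: smult_assoc1)
      ultimately show "i \<odot>\<^bsub>M\<^esub> u \<in> colon (idl_mult (I \<cdot> J) (carrier M)) j" using ic u by (simp add: colon_def)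
    qed
    then show "j \<odot>\<^bsub>M\<^esub> w \<in> idl_mult (I \<cdot> J) (carrier M)" using w by (auto simp: colon_def)
  qed
  ultimately have "idl_mult (I \<cdot> J) (carrier M) = idl_mult J F" by blast
  then show ?thesis unfolding J_def idl_mult_genideal[OF zs sF] unfolding F_def .
qed

text \<open>Powers in the monoid of ideals act on M by iterating \<open>lmul\<close>, since (J^k J)
  M = J (J^k M).\<close>

lemma hilbert_samuel_fun_eq:
  assumes zs: "set zs \<subseteq> carrier R"
  shows "hilbert_samuel_fun R (Idl (set zs)) M n = rlen (pw zs (Suc n) (carrier M)) (carrier M)"
proof -
  define J where "J = Idl (set zs)"
  have J: "ideal J R" unfolding J_def using zs by (rule genideal_ideal)
  interpret S: comm_monoid "ideals_set R" by (rule ideals_set_is_comm_monoid)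
  have "ideal (J [^]\<^bsub>ideals_set R\<^esub> k) R \<and> idl_mult (J [^]\<^bsub>ideals_set R\<^esub> k) (carrier M) = pw zs k (carrier M)" for k :: nat
  proof (induction k)
    case 0
    have "J [^]\<^bsub>ideals_set R\<^esub> (0 :: nat) = carrier R" by (simp add: ideals_set_def nat_pow_def)
    moreover have "idl_mult (carrier R) (carrier M) = carrier M"
    proof
      show "idl_mult (carrier R) (carrier M) \<subseteq> carrier M" by (rule idl_mult_least[OF carrier_is_submodule]) simp
      show "carrier M \<subseteq> idl_mult (carrier R) (carrier M)"
      proof
        fix u assume u: "u \<in> carrier M"
        then have "\<one> \<odot>\<^bsub>M\<^esub> u \<in> idl_mult (carrier R) (carrier M)" by (intro idl_multI) auto
        then show "u \<in> idl_mult (carrier R) (carrier M)" using u by simp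
      qed
    qed
    ultimately show ?case using oneideal by simp
  next
    case (Suc k)
    have "J [^]\<^bsub>ideals_set R\<^esub> (Suc k) = (J [^]\<^bsub>ideals_set R\<^esub> k) \<cdot> J"
      unfolding S.nat_pow_Suc by (simp add: ideals_set_def)
    then show ?case
      using Suc ideal_prod_is_ideal[OF _ J] idl_mult_ideal_prod[OF _ zs, folded J_def] by (simp add: pw_Suc)
  qed
  then have eq: "ideal_smult R (J [^]\<^bsub>ideals_set R\<^esub> (Suc n)) M = pw zs (Suc n) (carrier M)"
    unfolding ideal_smult_eq by blast
  have "sub (pw zs (Suc n) (carrier M))" by (intro sub_pw zs carrier_is_submodule)
  then show ?thesis
    unfolding hilbert_samuel_fun_def quot_by_ideal_def J_def[symmetric] Suc_eq_plus1[symmetric] eq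
    by (rule module_length_quot)
qed

end

context noetherian_local_module
begin

text \<open>Backward induction on the number of elements still to be divided out, because
  \<open>has_depth\<close> consumes the sequence from its front.\<close>

lemma has_depth_if_regular_sequence:
  assumes xs: "set xs \<subseteq> \<mm>" and reg: "\<forall>i<length xs. reg (xs ! i) (lmul (take i xs) (carrier M))"
  shows "has_depth (length xs) {\<zero>\<^bsub>M\<^esub>}"
proof -
  note M = carrier_is_submodule
  have xsc: "set xs \<subseteq> carrier R" using xs \<mm>_carrier by auto
  have "i \<le> length xs \<Longrightarrow> has_depth (length xs - i) (lmul (take i xs) (carrier M))" for i
  proof (induction "length xs - i" arbitrary: i)
    case 0
    then show ?case by simp
  next
    case (Suc k)
    have i: "i < length xs" using Suc.hyps(2) by simp
    have xi: "xs ! i \<in> \<mm>" using xs i by auto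
    have tc: "set (take i xs) \<subseteq> carrier R" using xsc set_take_subset by fast
    have "lmul (take (Suc i) xs) (carrier M) = lmul (xs ! i # take i xs) (carrier M)"
      using xsc i set_take_subset[of "Suc i" xs]
      by (intro lmul_cong_set M) (auto simp: take_Suc_conv_app_nth)
    also have "\<dots> = adj (lmul (take i xs) (carrier M)) (xs ! i)"
      using msum_commute[OF sub_scale[OF \<mm>_carrier[OF xi] M] sub_lmul[OF tc M]] by simp
    finally have eq: "lmul (take (Suc i) xs) (carrier M) = adj (lmul (take i xs) (carrier M)) (xs ! i)" .
    have k: "k = length xs - Suc i" using Suc.hyps(2) by simp
    have "has_depth k (adj (lmul (take i xs) (carrier M)) (xs ! i))"
      using Suc.hyps(1)[OF k] i unfolding k[symmetric] eq by simp
    then show ?case using reg i xi Suc.hyps(2)[symmetric] by auto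
  qed
  from this[of 0] show ?thesis by simp
qed

text \<open>\<open>reg_seq\<close> lists the last element first, hence the reversal. Properness
  follows from Nakayama's lemma: (ys)M = M would give M = \<mm>M and so M = 0.\<close>

lemma regular_sequence_rev:
  assumes ys: "set ys \<subseteq> \<mm>" and reg: "reg_seq {\<zero>\<^bsub>M\<^esub>} ys" and M0: "carrier M \<noteq> {\<zero>\<^bsub>M\<^esub>}"
  shows "regular_sequence R M (rev ys)"
proof -
  note M = carrier_is_submodule
  have "\<forall>i<length ys. reg (rev ys ! i) (lmul (take i (rev ys)) (carrier M))"
    using ys reg
  proof (induction ys)
    case (Cons z ys)
    have ysc: "set ys \<subseteq> carrier R" using Cons.prems(1) \<mm>_carrier by auto
    have "reg z (lmul ys (carrier M))" using Cons.prems(2) sub_lmul[OF ysc M] by simp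
    moreover have "lmul (rev ys) (carrier M) = lmul ys (carrier M)"
      using ysc by (intro lmul_cong_set M) auto
    ultimately show ?case using Cons by (auto simp: nth_append less_Suc_eq)
  qed simp
  moreover have ysc: "set (rev ys) \<subseteq> carrier R" using ys \<mm>_carrier by auto
  moreover have "lmul (rev ys) (carrier M) \<noteq> carrier M"
  proof
    assume eq: "lmul (rev ys) (carrier M) = carrier M"
    have id: "ideal (Idl (set (rev ys))) R" using ysc by (rule genideal_ideal)
    have "Idl (set (rev ys)) \<subseteq> \<mm>" using ys by (intro genideal_minimal is_ideal) simp
    then have "idl_mult (Idl (set (rev ys))) (carrier M) \<subseteq> idl_mult \<mm> (carrier M)"
      using a_subset by (intro idl_mult_least sub_idl_mult) (auto intro: idl_multI)
    then have le: "carrier M \<subseteq> idl_mult \<mm> (carrier M)"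
      unfolding idl_mult_genideal[OF ysc M] eq .
    have s: "sub (idl_mult \<mm> (carrier M))" using a_subset by (intro sub_idl_mult) auto
    have "carrier M \<subseteq> {\<zero>\<^bsub>M\<^esub>}"
      by (rule nakayama[OF M sub_zero_set]) (use le msum_upper1[OF s sub_zero_set] in blast)
    then show False using M0 by auto
  qed
  ultimately show ?thesis using regular_sequence_iff[OF ysc] by simp
qed

end

text \<open>Provides an actual regular sequence whose length is the depth: a set with finite
  supremum is finite.\<close>

lemma Sup_enat_attained:
  fixes S :: "enat set"
  assumes "Sup S = enat r" "S \<noteq> {}"
  shows "enat r \<in> S"
proof -
  have "finite S" using assms by (auto simp: Sup_enat_def split: if_splits)
  then have "Sup S = Max S" using assms(2) by (simp add: Sup_enat_def)
  then show ?thesis using Max_in[OF \<open>finite S\<close> assms(2)] assms(1) by simp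
qed

section \<open>Polynomials in the binomial basis and their leading coefficients\<close>

lemma poly_pochhammer: "poly (pochhammer p n) x = pochhammer (poly p x) n"
  by (induction n) (simp_all add: pochhammer_Suc)

lemma ex_gbinomial_poly:
  "\<exists>p :: rat poly. \<forall>x. poly p x = (\<Sum>i\<le>d. of_int (a i) * ((x + of_nat i) gchoose i))"
proof -
  \<comment> \<open>Uses (x+i choose i) = (x+1)(x+2)...(x+i)/i!.\<close>
  define p :: "rat poly" where
    "p = (\<Sum>i\<le>d. [:of_int (a i) / fact i:] * pochhammer [:1, 1:] i)"
  have "poly p x = (\<Sum>i\<le>d. of_int (a i) * ((x + of_nat i) gchoose i))" for x
    by (simp add: p_def poly_sum poly_pochhammer gbinomial_pochhammer' add.commute)
  then show ?thesis by blast
qed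

text \<open>Evaluation at x = -(j+1) makes the system triangular: (i-j-1 choose i) vanishes for i >
  j and is (-1)^j for i = j.\<close>

lemma gbinomial_basis_unique:
  fixes b c :: "nat \<Rightarrow> rat"
  assumes "\<And>x :: rat. (\<Sum>i\<le>d. b i * ((x + of_nat i) gchoose i)) = (\<Sum>i\<le>d. c i * ((x + of_nat i) gchoose i))"
    and "j \<le> d"
  shows "b j = c j"
  using assms(2)
proof (induction j rule: less_induct)
  case (less j)
  define x :: rat where "x = - of_nat (Suc j)"
  have big: "(x + of_nat i) gchoose i = 0" if "i > j" for i
  proof -
    have "x + of_nat i = of_nat (i - Suc j)" using that by (simp add: x_def of_nat_diff)
    then have "(x + of_nat i) gchoose i = of_nat ((i - Suc j) choose i)" by (simp only: binomial_gbinomial)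
    then show ?thesis using that by (simp add: binomial_eq_0)
  qed
  have eq: "(x + of_nat j) gchoose j = (- 1) ^ j"
  proof -
    have "x + of_nat j = - 1" by (simp add: x_def)
    moreover have "(- 1 :: rat) gchoose j = (- 1) ^ j * (of_nat j gchoose j)"
      using gbinomial_minus[of "1 :: rat" j] by simp
    ultimately show ?thesis by (simp add: binomial_gbinomial[symmetric])
  qed
  have split: "(\<Sum>i\<le>d. f i * ((x + of_nat i) gchoose i)) =
      (\<Sum>i<j. f i * ((x + of_nat i) gchoose i)) + f j * (- 1) ^ j" for f :: "nat \<Rightarrow> rat"
  proof -
    have "(\<Sum>i\<le>d. f i * ((x + of_nat i) gchoose i)) = (\<Sum>i\<le>j. f i * ((x + of_nat i) gchoose i))"
      by (rule sum.mono_neutral_right) (use less.prems big in auto)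
    also have "\<dots> = (\<Sum>i<j. f i * ((x + of_nat i) gchoose i)) + f j * ((x + of_nat j) gchoose j)"
      by (simp add: lessThan_Suc_atMost[symmetric])
    finally show ?thesis unfolding eq .
  qed
  have "(\<Sum>i<j. b i * ((x + of_nat i) gchoose i)) = (\<Sum>i<j. c i * ((x + of_nat i) gchoose i))"
    by (rule sum.cong) (use less in auto)
  then have "b j * (- 1) ^ j = c j * (- 1) ^ j" using assms(1)[of x] unfolding split by simp
  then show ?case by simp
qed

text \<open>A top coefficient of at most -1 would have to be outweighed by the lower terms. These
  are at most S * (n+m-1 choose m-1), while (n+m choose m) is (n+m)/m times that binomial
  coefficient.\<close>

lemma binomial_fun_lead_nonneg:
  assumes "\<And>n. n \<ge> N \<Longrightarrow> 0 \<le> binomial_fun (Suc m) b n"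
  shows "0 \<le> b m"
proof (rule ccontr)
  assume neg: "\<not> 0 \<le> b m"
  show False
  proof (cases m)
    case 0
    then show False using assms[of N] neg by (simp add: binomial_fun_def)
  next
    case (Suc k)
    define S where "S = (\<Sum>i<m. \<bar>b i\<bar>)"
    \<comment> \<open>At least N, and large enough that n + m exceeds m * S.\<close>
    define n where "n = N + nat (int m * S) + 1"
    have le: "(n + i) choose i \<le> (n + k) choose k" if "i < m" for i
    proof -
      have "(n + i) choose i = (n + i) choose n" using binomial_symmetric[of i "n + i"] by simp
      also have "\<dots> \<le> (n + k) choose n" using that Suc by (intro binomial_right_mono) simp
      also have "\<dots> = (n + k) choose k" using binomial_symmetric[of k "n + k"] by simp
      finally show ?thesis .
    qed
    define c where "c = int ((n + k) choose k)"
    have c: "c \<ge> 1" unfolding c_def by (simp add: Suc_leI zero_less_binomial)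
    have "(\<Sum>i<m. b i * int ((n + i) choose i)) \<le> (\<Sum>i<m. \<bar>b i\<bar> * c)"
    proof (rule sum_mono)
      fix i assume "i \<in> {..<m}"
      then have "int ((n + i) choose i) \<le> c" unfolding c_def using le by simp
      then have "\<bar>b i\<bar> * int ((n + i) choose i) \<le> \<bar>b i\<bar> * c" by (intro mult_left_mono) auto
      moreover have "b i * int ((n + i) choose i) \<le> \<bar>b i\<bar> * int ((n + i) choose i)"
        by (intro mult_right_mono) auto
      ultimately show "b i * int ((n + i) choose i) \<le> \<bar>b i\<bar> * c" by linarith
    qed
    also have "\<dots> = S * c" by (simp add: S_def sum_distrib_right)
    finally have low: "(\<Sum>i<m. b i * int ((n + i) choose i)) \<le> S * c" .
    have top: "b m * int ((n + m) choose m) \<le> - int ((n + m) choose m)"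
      using neg mult_right_mono[of "b m" "- 1" "int ((n + m) choose m)"] by simp
    have "0 \<le> binomial_fun (Suc m) b n" by (rule assms) (simp add: n_def)
    then have "int ((n + m) choose m) \<le> S * c" using low top by (simp add: binomial_fun_def)
    then have "int m * int ((n + m) choose m) \<le> int m * (S * c)" by (intro mult_left_mono) auto
    moreover have "m * ((n + m) choose m) = (n + m) * ((n + k) choose k)"
      using times_binomial_minus1_eq[of m "n + m"] Suc by simp
    then have "int m * int ((n + m) choose m) = int (n + m) * c"
      unfolding c_def of_nat_mult[symmetric] by simp
    ultimately have "int (n + m) * c \<le> (int m * S) * c" by (simp add: mult.assoc)
    then have "int (n + m) \<le> int m * S" using c by (simp add: mult_le_cancel_right)
    then show False unfolding n_def by linarith
  qed
qed

section \<open>The first Hilbert coefficient\<close>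

text \<open>The two bounds agree in their leading term, which forces the top coefficient to be l -
  h; the lower bound then leaves at least h > 0 for the next one.\<close>

proposition (in noetherian_local_module) hilbert_samuel_expansion:
  assumes depth: "module_depth R \<mm> M + 1 = enat d"
    and xs: "set xs \<subseteq> \<mm>" "length xs = d"
    and fin: "module_length R (quot_by_ideal R M (Idl (set xs))) < \<infinity>"
  shows "\<exists>a N. (\<forall>n\<ge>N. \<exists>g. hilbert_samuel_fun R (Idl (set xs)) M n = enat g \<and>
    int g = binomial_fun (Suc d) a n) \<and> 0 < a (d - 1)"
proof -
  note M = carrier_is_submodule
  let ?S = "{enat (length xs) | xs. set xs \<subseteq> \<mm> \<and> regular_sequence R M xs}"
  have M0: "carrier M \<noteq> {\<zero>\<^bsub>M\<^esub>}"
  proof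
    assume "carrier M = {\<zero>\<^bsub>M\<^esub>}"
    then show False using depth by (simp add: module_depth_def)
  qed
  then have Sup: "Sup ?S + 1 = enat d" using depth by (simp add: module_depth_def)
  obtain r where r: "Sup ?S = enat r" "d = Suc r"
    using Sup by (cases "Sup ?S") (auto simp: one_enat_def)
  have "regular_sequence R M []" using regular_sequence_iff[of "[]"] M0 by auto
  then have "?S \<noteq> {}" by (auto intro!: exI[of _ "[]"])
  from Sup_enat_attained[OF r(1) this] obtain bs where
    bs: "set bs \<subseteq> \<mm>" "regular_sequence R M bs" "length bs = r" by auto
  have xsc: "set xs \<subseteq> carrier R" using xs \<mm>_carrier by auto
  have bsc: "set bs \<subseteq> carrier R" using bs \<mm>_carrier by auto
  have "has_depth r {\<zero>\<^bsub>M\<^esub>}"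
    using has_depth_if_regular_sequence[OF bs(1)] bs(2,3) regular_sequence_iff[OF bsc] by simp
  then have has_depth: "has_depth r ({\<zero>\<^bsub>M\<^esub>} \<boxplus> lmul [] (carrier M))" by (simp add: sub_zero_set)
  have "rlen (lmul xs (carrier M)) (carrier M) < \<infinity>"
    using fin unfolding quot_by_ideal_def ideal_smult_genideal[OF xsc]
      module_length_quot[OF sub_lmul[OF xsc M]] .
  then have finJ: "rlen (idl_mult (Idl (set xs)) (carrier M)) (carrier M) < \<infinity>"
    unfolding idl_mult_genideal[OF xsc M] .
  have "\<exists>ys x. set ys \<subseteq> \<mm> \<and> x \<in> \<mm> \<and> length ys = length ([] :: 'a list) + r \<and>
      reg_seq {\<zero>\<^bsub>M\<^esub>} ys \<and> Idl (set xs) = Idl (insert x (set ys))"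
    by (rule regular_generators[OF sub_zero_set _ xs(1) _ _ finJ _ has_depth]) (use xs(2) r(2) in auto)
  then obtain ys x where ys: "set ys \<subseteq> \<mm>" "x \<in> \<mm>" "length ys = r" "reg_seq {\<zero>\<^bsub>M\<^esub>} ys"
    and J: "Idl (set xs) = Idl (set (x # ys))" by auto
  have ysc: "set ys \<subseteq> carrier R" and xysc: "set (x # ys) \<subseteq> carrier R" using ys \<mm>_carrier by auto
  have fin': "rlen (lmul (x # ys) (carrier M)) (carrier M) < \<infinity>"
    using finJ unfolding J idl_mult_genideal[OF xysc M] .
  \<comment> \<open>Otherwise x would extend \<open>ys\<close> to a regular sequence longer than the
    depth.\<close>
  have nreg: "\<not> reg x (pw ys (Suc 0) (carrier M))"
  proof
    assume "reg x (pw ys (Suc 0) (carrier M))"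
    then have "reg_seq {\<zero>\<^bsub>M\<^esub>} (x # ys)" using ys(4) sub_lmul[OF ysc M] by (simp add: pw_Suc)
    then have "regular_sequence R M (rev (x # ys))"
      using ys by (intro regular_sequence_rev M0) auto
    then have "enat (length (rev (x # ys))) \<in> ?S" using ys(1,2) by (auto intro!: exI[of _ "rev (x # ys)"])
    then have "enat (Suc r) \<le> Sup ?S" using ys(3) by (intro Sup_upper) simp
    then show False unfolding r(1) by simp
  qed
  obtain l h e :: nat and g where h: "h > 0"
    and g: "\<And>n. rlen (pw (x # ys) (Suc n) (carrier M)) (carrier M) = enat (g n)"
    and low: "\<And>n. l * ((n + Suc r) choose Suc r) + h * ((n + r) choose r) \<le> g n + h * ((n + Suc r) choose Suc r)"
    and upp: "\<And>n. g n + h * ((n + Suc r) choose Suc r) \<le> l * ((n + Suc r) choose Suc r) + e * ((n + r) choose r)"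
    using hilbert_samuel_bounds[OF ys(2,1,4) fin' nreg] unfolding ys(3) by metis
  obtain a N where "\<forall>n\<ge>N. int (g n) = binomial_fun (Suc (length (x # ys))) a n"
    using hilbert_samuel_eventually_binomial[OF xysc g] by blast
  then have a: "int (g n) = binomial_fun (Suc (Suc r)) a n" if "n \<ge> N" for n
    using that ys(3) by simp
  have split: "binomial_fun (Suc (Suc r)) b n =
      binomial_fun r b n + b r * int ((n + r) choose r) + b (Suc r) * int ((n + Suc r) choose Suc r)" for b n
    by (simp add: binomial_fun_def)
  have low': "int l * int ((n + Suc r) choose Suc r) + int h * int ((n + r) choose r)
      \<le> int (g n) + int h * int ((n + Suc r) choose Suc r)" for n
    using low[of n] by (simp only: of_nat_mult[symmetric] of_nat_add[symmetric] of_nat_le_iff)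
  have upp': "int (g n) + int h * int ((n + Suc r) choose Suc r)
      \<le> int l * int ((n + Suc r) choose Suc r) + int e * int ((n + r) choose r)" for n
    using upp[of n] by (simp only: of_nat_mult[symmetric] of_nat_add[symmetric] of_nat_le_iff)
  \<comment> \<open>The coefficients of g minus its lower bound.\<close>
  define b where "b = a(r := a r - int h, Suc r := a (Suc r) - (int l - int h))"
  have rest: "binomial_fun r b n = binomial_fun r a n" for n
    unfolding binomial_fun_def b_def by (rule sum.cong) auto
  have b_nonneg: "0 \<le> binomial_fun (Suc (Suc r)) b n" if "n \<ge> N" for n
    unfolding split[of b] rest using low'[of n] a[OF that] unfolding split[of a]
    by (simp add: b_def algebra_simps)
  then have "0 \<le> b (Suc r)" by (rule binomial_fun_lead_nonneg)
  moreover have "0 \<le> - b (Suc r)"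
  proof -
    \<comment> \<open>The coefficients of the upper bound minus g; the top one is the negative of
      that of b, so both vanish.\<close>
    define c where "c = (\<lambda>i. - a i)(r := int e - a r, Suc r := - b (Suc r))"
    have c: "binomial_fun r c n = - binomial_fun r a n" for n
      unfolding binomial_fun_def sum_negf[symmetric] c_def by (rule sum.cong) auto
    have "0 \<le> binomial_fun (Suc (Suc r)) c n" if "n \<ge> N" for n
      unfolding split[of c] c using upp'[of n] a[OF that] unfolding split[of a]
      by (simp add: c_def b_def algebra_simps)
    then have "0 \<le> c (Suc r)" by (rule binomial_fun_lead_nonneg)
    then show ?thesis by (simp add: c_def)
  qed
  \<comment> \<open>With the top term gone, b has lower degree and its next coefficient
    \<open>b r\<close> = a r - h becomes the leading one.\<close>
  ultimately have "b (Suc r) = 0" by simp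
  then have "0 \<le> binomial_fun (Suc r) b n" if "n \<ge> N" for n
    using b_nonneg[OF that] by (simp add: binomial_fun_def)
  then have "0 \<le> b r" by (rule binomial_fun_lead_nonneg)
  then have "0 < a (d - 1)" using h r(2) by (simp add: b_def)
  moreover have "hilbert_samuel_fun R (Idl (set xs)) M n = enat (g n)" for n
    unfolding J hilbert_samuel_fun_eq[OF xysc] by (rule g)
  ultimately show ?thesis using a r(2) by (intro exI[of _ a] exI[of _ N]) auto
qed

text \<open>Two candidates agree at all large integers and therefore everywhere, so the definite
  description is determined.\<close>

lemma hilbert_samuel_poly_eqI:
  assumes "\<And>n. n \<ge> N \<Longrightarrow> \<exists>l. hilbert_samuel_fun R J M n = enat l \<and> poly p (of_nat n) = of_nat l"
  shows "hilbert_samuel_poly R J M = p"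
  unfolding hilbert_samuel_poly_def
proof (rule the_equality)
  show "\<exists>N. \<forall>n\<ge>N. \<exists>l. hilbert_samuel_fun R J M n = enat l \<and> poly p (of_nat n) = of_nat l"
    using assms by blast
  fix q :: "rat poly"
  assume "\<exists>N. \<forall>n\<ge>N. \<exists>l. hilbert_samuel_fun R J M n = enat l \<and> poly q (of_nat n) = of_nat l"
  then obtain N' where N': "\<And>n. n \<ge> N' \<Longrightarrow> \<exists>l. hilbert_samuel_fun R J M n = enat l \<and> poly q (of_nat n) = of_nat l"
    by blast
  have "of_nat n \<in> {x. poly (q - p) x = 0}" if "n \<ge> max N N'" for n :: nat
    using assms[of n] N'[of n] that by auto
  then have "of_nat ` {max N N'..} \<subseteq> {x. poly (q - p) x = 0}" by blast
  moreover have "infinite ((of_nat :: nat \<Rightarrow> rat) ` {max N N'..})"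
    by (simp add: finite_image_iff infinite_Ici)
  ultimately have "infinite {x. poly (q - p) x = 0}" by (rule infinite_super)
  then have "q - p = 0" using poly_roots_finite by blast
  then show "q = p" by simp
qed

theorem proposition3p4:
  fixes R :: "('a, 'b) ring_scheme"
    and M :: "('a, 'm, 'c) module_scheme"
    and \<mm> J :: "'a set"
    and xs :: "'a list"
    and d :: nat
  assumes "noetherian_local_ring R \<mm>"
    and "module R M"
    and "fin_gen_module R M"
    and "module_dim R M = enat d"
    and "module_depth R \<mm> M + 1 = enat d"
    and "system_of_parameters R \<mm> M xs"
    and "J = Idl\<^bsub>R\<^esub> (set xs)"
  shows "hilbert_coeff R J M 1 < 0"
proof -
  interpret L: noetherian_local_ring R \<mm> by fact
  have nr: "noetherian_ring R" by unfold_locales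
  have "noetherian_module R M" by (rule module.noetherian_moduleI[OF assms(2) nr assms(3)])
  then interpret noetherian_local_module R M \<mm>
    by (rule noetherian_local_module.intro) fact
  have xs: "set xs \<subseteq> \<mm>" "length xs = d" "module_length R (quot_by_ideal R M (Idl\<^bsub>R\<^esub> (set xs))) < \<infinity>"
    using assms(4,6) unfolding system_of_parameters_def by simp_all
  obtain a N where a: "\<And>n. n \<ge> N \<Longrightarrow> \<exists>g. hilbert_samuel_fun R J M n = enat g \<and> int g = binomial_fun (Suc d) a n"
    and a_pos: "0 < a (d - 1)"
    using hilbert_samuel_expansion[OF assms(5) xs] unfolding assms(7) by blast
  \<comment> \<open>The index d - 1 is a truncated subtraction, so d = 0 has to be excluded; depth
    plus one is never 0.\<close>
  have d: "d \<ge> 1"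
  proof (rule ccontr)
    assume "\<not> d \<ge> 1"
    then have "module_depth R \<mm> M + 1 = 0" using assms(5) by (simp add: zero_enat_def)
    then show False by simp
  qed
  obtain p :: "rat poly" where p: "\<And>x. poly p x = (\<Sum>i\<le>d. of_int (a i) * ((x + of_nat i) gchoose i))"
    using ex_gbinomial_poly[of a d] by blast
  have "poly p (of_nat n) = of_int (binomial_fun (Suc d) a n)" for n
    unfolding p binomial_fun_def lessThan_Suc_atMost of_int_sum
    by (rule sum.cong) (simp_all add: of_nat_add[symmetric] binomial_gbinomial[symmetric] del: of_nat_add)
  then have poly: "hilbert_samuel_poly R J M = p"
    using a by (intro hilbert_samuel_poly_eqI[of N]) (metis of_int_of_nat_eq)
  have rev: "(\<Sum>i\<le>d. (-1) ^ i * of_int (e i) * ((x + of_nat (d - i)) gchoose (d - i))) =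
      (\<Sum>i\<le>d. ((-1) ^ (d - i) * of_int (e (d - i))) * ((x + of_nat i) gchoose i))" for e :: "nat \<Rightarrow> int" and x :: rat
    by (rule sum.reindex_bij_witness[of _ "\<lambda>i. d - i" "\<lambda>i. d - i"]) auto
  \<comment> \<open>Reversing the order of summation makes e_i the coefficient of (X+d-i choose d-i)
    up to the sign (-1)^i; beyond d the default 0 of the definition is used.\<close>
  define e where "e i = (if i \<le> d then (-1) ^ i * a (d - i) else 0)" for i
  have "hilbert_coeff R J M = e"
    unfolding hilbert_coeff_def poly assms(4) the_enat.simps Let_def
  proof (rule the_equality)
    have "(\<Sum>i\<le>d. of_int (a i) * ((x + of_nat i) gchoose i)) =
        (\<Sum>i\<le>d. ((-1) ^ (d - i) * of_int (e (d - i))) * ((x + of_nat i) gchoose i))" for x :: rat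
      by (rule sum.cong) (simp_all add: e_def power_add[symmetric] mult.assoc[symmetric])
    then show "(\<forall>i>d. e i = 0) \<and> (\<forall>x :: rat. poly p x =
        (\<Sum>i\<le>d. (-1) ^ i * of_int (e i) * ((x + of_nat (d - i)) gchoose (d - i))))"
      unfolding rev p by (simp add: e_def)
    fix e' :: "nat \<Rightarrow> int"
    assume e': "(\<forall>i>d. e' i = 0) \<and> (\<forall>x :: rat. poly p x =
        (\<Sum>i\<le>d. (-1) ^ i * of_int (e' i) * ((x + of_nat (d - i)) gchoose (d - i))))"
    have eq: "of_int (a j) = (-1 :: rat) ^ (d - j) * of_int (e' (d - j))" if "j \<le> d" for j
      by (rule gbinomial_basis_unique[OF e'[THEN conjunct2, rule_format, unfolded rev p] that])
    show "e' = e"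
    proof
      fix i
      show "e' i = e i"
      proof (cases "i \<le> d")
        case True
        have "(of_int (a (d - i)) :: rat) = of_int ((-1) ^ i * e' i)" using eq[of "d - i"] True by simp
        then have "a (d - i) = (-1) ^ i * e' i" by (simp only: of_int_eq_iff)
        then show ?thesis using True by (simp add: e_def mult.assoc[symmetric] power_add[symmetric])
      qed (use e' in \<open>simp add: e_def\<close>)
    qed
  qed
  \<comment> \<open>For i = 1 the sign is negative: e_1 = -a (d - 1).\<close>
  then show ?thesis using a_pos d by (simp add: e_def)
qed

end
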